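(* Let $X$ be a complex Banach space, $Y$ a dense subspace of $X$, and let $\{A_\alpha\}$ be a net of closed linear operators from $Y$ into $X$. Suppose there are constants $\Delta>0$, $M>0$, $\eta>0$ (independent of $\alpha$) such that for each $\alpha$: $(\mathrm{C}_1)$ $\sigma(A_\alpha)\subset\{\lambda\in\mathbb{C}:\lambda\neq 0,\ |\arg\lambda|\le \frac{\pi}{2}-\Delta\}$; $(\mathrm{C}_2)$ with $\omega(A_\alpha):=\inf\{\Re(\lambda):\lambda\in\sigma(A_\alpha)\}$, there is a number $\omega_1(A_\alpha)$ with $0<\omega_1(A_\alpha)\le\omega(A_\alpha)$ such that for every positive integer $n$ and every real $\lambda<\omega_1(A_\alpha)$, $\|((\lambda I-A_\alpha)^{-1})^n\|\le M(\omega_1(A_\alpha)-\lambda)^{-n}$; and moreover $\omega_1(A_\alpha)\ge\eta\,\omega(A_\alpha)$. Let $a\in\mathbb{R}$, let $b>a$ be finite or $+\infty$, let $h$ be real-valued, and define $$I(z):=\int_a^b\varphi(x)\mathrm{e}^{-zh(x)}\,\mathrm{d}x .$$ Assume: (i) $h(x)>h(a)$ for all $x\in(a,b)$, and for every $\delta>0$ the infimum of $h(x)-h(a)$ on $[a+\delta,b)$ is positive; (ii) $h'(x)$ and $\varphi(x)$ are continuous in a neighborhood of $x=a$, except possibly at $a$; (iii) as $x\to a^+$, $$h(x)\sim h(a)+\sum_{s=0}^\infty a_s(x-a)^{s+\mu},\qquad \varphi(x)\sim\sum_{s=0}^\infty b_s(x-a)^{s+\lambda-1},$$ where the expansion of $h$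 is differentiable (i.e. $h'(x)\sim\sum_{s\ge0}(s+\mu)a_s(x-a)^{s+\mu-1}$), $\lambda$ and $\mu$ are positive constants, and $a_0>0$; (iv) $I(z)$ converges absolutely for all sufficiently large $z$. Then the bounded linear operator $I(A_\alpha)=\int_a^b\varphi(x)\mathrm{e}^{-h(x)A_\alpha}\,\mathrm{d}x$ has the asymptotic expansion $$I(A_\alpha)\sim \mathrm{e}^{-h(a)A_\alpha}\sum_{s=0}^\infty\Gamma\!\left(\frac{s+\lambda}{\mu}\right)c_s\,A_\alpha^{-\frac{s+\lambda}{\mu}},\qquad\text{as }\|A_\alpha^{-1}\|\to0,$$ where the coefficients $c_s$ are defined by the expansion $$\frac{\varphi(x)}{h'(x)}\sim\sum_{s=0}^\infty c_s\,t^{(s+\lambda-\mu)/\mu},\qquad\text{as } t=h(x)-h(a)\to0^+ .$$ In particular, $c_0=b_0\mu^{-1}a_0^{-\lambda/\mu}$.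
   Context: $\sigma(A)$ denotes the spectrum of $A$. If a closed operator $A$ satisfies $(\mathrm{C}_1)$ and $(\mathrm{C}_2)$, then there is a strongly continuous semigroup $\{\mathrm{e}^{-tA}:0\le t<\infty\}$ of bounded linear operators on $X$ (generated by $-A$) with $\|\mathrm{e}^{-tA}\|\le M\mathrm{e}^{-t\omega_1}$ for all $t>0$. For $0<\beta<\infty$ the negative powers are defined by $$A^{-\beta}=\frac{1}{\Gamma(\beta)}\int_0^\infty t^{\beta-1}\mathrm{e}^{-tA}\,\mathrm{d}t .$$ Standing convention: under $(\mathrm{C}_1)$, $(\mathrm{C}_2)$ the operator $\mathrm{e}^{tA}$ is regarded as well-defined for every real $t$, so that $\mathrm{e}^{-h(a)A}$ is meaningful (and treated as a bounded operator) for either sign of $h(a)$, with $\mathrm{e}^{-h(x)A}=\mathrm{e}^{-h(a)A}\mathrm{e}^{-(h(x)-h(a))A}$. The operator $I(A_\alpha)$ is considered for those $\alpha$ with $\|A_\alpha^{-1}\|$ sufficiently small. Asymptotic expansions of operator-valued functions: for exponents $0<\lambda_0<\lambda_1<\cdots$, $F(A_\alpha)\sim\sum_{s\ge0}d_sA_\alpha^{-\lambda_s}$ as $\|A_\alpha^{-1}\|\to0$ means that for each integer $N\ge0$, $$\Big\|F(A_\alpha)-\sum_{s=0}^{N}d_sA_\alpha^{-\lambda_s}\Big\|=o\big(\|A_\alpha^{-\lambda_N}\|\big)\quad\text{as }\|A_\alpha^{-1}\|\to0,$$ i.e. for every $\varepsilon>0$ there is $\delta>0$ such that the left side is at most $\varepsilon\|A_\alpha^{-\lambda_N}\|$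 whenever $\|A_\alpha^{-1}\|<\delta$. An expansion $I(A_\alpha)\sim \mathrm{e}^{-h(a)A_\alpha}\sum_s d_sA_\alpha^{-\lambda_s}$ with a prefactor means that $\mathrm{e}^{h(a)A_\alpha}I(A_\alpha)=\int_a^b\varphi(x)\mathrm{e}^{-(h(x)-h(a))A_\alpha}\,\mathrm{d}x$ has the expansion $\sum_s d_sA_\alpha^{-\lambda_s}$ in this sense. Scalar expansions in (iii) and for $\varphi/h'$ are ordinary Poincaré asymptotic expansions. *)

theory Defs
  imports "HOL-Analysis.Analysis" "HOL-Library.Landau_Symbols"
begin

(* Complex Banach spaces. The library only has real Banach spaces (class banach); the class below
   adds a complex scalar multiplication that extends the real one and for which the given norm is
   homogeneous. *)

class complex_banach = banach +
  fixes scaleC :: "complex \<Rightarrow> 'a \<Rightarrow> 'a"  (infixr "*\<^sub>C" 75)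
  assumes scaleC_add_right: "c *\<^sub>C (x + y) = c *\<^sub>C x + c *\<^sub>C y"
    and scaleC_add_left: "(c + d) *\<^sub>C x = c *\<^sub>C x + d *\<^sub>C x"
    and scaleC_scaleC: "c *\<^sub>C (d *\<^sub>C x) = (c * d) *\<^sub>C x"
    and scaleC_one: "1 *\<^sub>C x = x"
    and scaleR_scaleC: "r *\<^sub>R x = complex_of_real r *\<^sub>C x"
    and norm_scaleC: "norm (c *\<^sub>C x) = cmod c * norm x"

instantiation complex :: complex_banach
begin

definition scaleC_complex :: "complex \<Rightarrow> complex \<Rightarrow> complex" where
  "scaleC_complex c x = c * x"

instance
  by standard (simp_all add: scaleC_complex_def algebra_simps norm_mult scaleR_conv_of_real)

end

definition csubspace :: "'a::complex_banach set \<Rightarrow> bool" where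
  "csubspace Y \<longleftrightarrow>
     0 \<in> Y \<and> (\<forall>u\<in>Y. \<forall>v\<in>Y. u + v \<in> Y) \<and> (\<forall>c. \<forall>u\<in>Y. c *\<^sub>C u \<in> Y)"

definition bounded_clinear :: "('a::complex_banach \<Rightarrow> 'a) \<Rightarrow> bool" where
  "bounded_clinear T \<longleftrightarrow> bounded_linear T \<and> (\<forall>c u. T (c *\<^sub>C u) = c *\<^sub>C T u)"


(* Unbounded operators. An operator with domain Y is a function A together with the set Y; the
   values of A outside Y are irrelevant. *)

definition clinear_on :: "'a::complex_banach set \<Rightarrow> ('a \<Rightarrow> 'a) \<Rightarrow> bool" where
  "clinear_on Y A \<longleftrightarrow>
     (\<forall>u\<in>Y. \<forall>v\<in>Y. A (u + v) = A u + A v) \<and> (\<forall>c. \<forall>u\<in>Y. A (c *\<^sub>C u) = c *\<^sub>C A u)"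

definition closed_operator :: "'a::complex_banach set \<Rightarrow> ('a \<Rightarrow> 'a) \<Rightarrow> bool" where
  "closed_operator Y A \<longleftrightarrow> clinear_on Y A \<and> closed {(u, A u) | u. u \<in> Y}"

definition op_inverse :: "'a::complex_banach set \<Rightarrow> ('a \<Rightarrow> 'a) \<Rightarrow> 'a \<Rightarrow> 'a" where
  "op_inverse Y A = inv_into Y A"

definition resolvent :: "'a::complex_banach set \<Rightarrow> ('a \<Rightarrow> 'a) \<Rightarrow> complex \<Rightarrow> 'a \<Rightarrow> 'a" where
  "resolvent Y A z = op_inverse Y (\<lambda>u. z *\<^sub>C u - A u)"

definition spectrum :: "'a::complex_banach set \<Rightarrow> ('a \<Rightarrow> 'a) \<Rightarrow> complex set" where
  "spectrum Y A =
     - {z. bij_betw (\<lambda>u. z *\<^sub>C u - A u) Y UNIV \<and> bounded_clinear (resolvent Y A z)}"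

(* Extended-real valued, so that an operator with empty spectrum has omega = \<infinity>. *)
definition omega :: "'a::complex_banach set \<Rightarrow> ('a \<Rightarrow> 'a) \<Rightarrow> ereal" where
  "omega Y A = (INF z\<in>spectrum Y A. ereal (Re z))"


(* Strongly continuous semigroups; only the values T t with t \<ge> 0 matter. *)

definition C0_semigroup :: "(real \<Rightarrow> 'a::complex_banach \<Rightarrow> 'a) \<Rightarrow> bool" where
  "C0_semigroup T \<longleftrightarrow>
     (\<forall>t\<ge>0. bounded_clinear (T t)) \<and> T 0 = id \<and>
     (\<forall>s\<ge>0. \<forall>t\<ge>0. T (s + t) = T s \<circ> T t) \<and>
     (\<forall>u. ((\<lambda>t. T t u) \<longlongrightarrow> u) (at_right 0))"

(* The second conjunct says that -A, with domain exactly Y, is the infinitesimal generator of T. *)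
definition generated_by_minus ::
    "'a::complex_banach set \<Rightarrow> ('a \<Rightarrow> 'a) \<Rightarrow> (real \<Rightarrow> 'a \<Rightarrow> 'a) \<Rightarrow> bool" where
  "generated_by_minus Y A T \<longleftrightarrow>
     C0_semigroup T \<and>
     (\<forall>u v. ((\<lambda>t. (1 / t) *\<^sub>R (T t u - u)) \<longlongrightarrow> v) (at_right 0) \<longleftrightarrow> u \<in> Y \<and> v = - A u)"

definition semigroup_of :: "'a::complex_banach set \<Rightarrow> ('a \<Rightarrow> 'a) \<Rightarrow> real \<Rightarrow> 'a \<Rightarrow> 'a" where
  "semigroup_of Y A = (SOME T. generated_by_minus Y A T)"

(* exp_minus Y A t is exp(-t A) for real t of either sign. For t < 0 it is the inverse of
   exp(t A) = exp(-(-t) A), and it is a genuine bounded operator iff exp_minus_bounded holds. *)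
definition exp_minus :: "'a::complex_banach set \<Rightarrow> ('a \<Rightarrow> 'a) \<Rightarrow> real \<Rightarrow> 'a \<Rightarrow> 'a" where
  "exp_minus Y A t = (if 0 \<le> t then semigroup_of Y A t else inv (semigroup_of Y A (- t)))"

definition exp_minus_bounded :: "'a::complex_banach set \<Rightarrow> ('a \<Rightarrow> 'a) \<Rightarrow> real \<Rightarrow> bool" where
  "exp_minus_bounded Y A t \<longleftrightarrow>
     0 \<le> t \<or> (bij (semigroup_of Y A (- t)) \<and> bounded_clinear (exp_minus Y A t))"


(* Operator integrals are strong (vector by vector): a strongly continuous semigroup need not be
   measurable for the operator norm. The vector-valued integral is the gauge integral, because the
   library's Bochner integral is restricted to second-countable spaces. *)

definition neg_power :: "'a::complex_banach set \<Rightarrow> ('a \<Rightarrow> 'a) \<Rightarrow> real \<Rightarrow> 'a \<Rightarrow> 'a" where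
  "neg_power Y A \<beta> u =
     (1 / Gamma \<beta>) *\<^sub>R integral {0<..} (\<lambda>t. (t powr (\<beta> - 1)) *\<^sub>R exp_minus Y A t u)"

(* laplace_op Y A \<phi> g S is the integral over S of \<phi>(x) exp(-g(x) A). *)
definition laplace_op ::
    "'a::complex_banach set \<Rightarrow> ('a \<Rightarrow> 'a) \<Rightarrow> (real \<Rightarrow> complex) \<Rightarrow> (real \<Rightarrow> real) \<Rightarrow> real set
     \<Rightarrow> 'a \<Rightarrow> 'a" where
  "laplace_op Y A \<phi> g S u = integral S (\<lambda>x. \<phi> x *\<^sub>C exp_minus Y A (g x) u)"

definition laplace_op_exists ::
    "'a::complex_banach set \<Rightarrow> ('a \<Rightarrow> 'a) \<Rightarrow> (real \<Rightarrow> complex) \<Rightarrow> (real \<Rightarrow> real) \<Rightarrow> real set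
     \<Rightarrow> bool" where
  "laplace_op_exists Y A \<phi> g S \<longleftrightarrow>
     (\<forall>u. (\<lambda>x. \<phi> x *\<^sub>C exp_minus Y A (g x) u) integrable_on S) \<and>
     bounded_clinear (laplace_op Y A \<phi> g S)"


definition directed_set :: "'i set \<Rightarrow> ('i \<Rightarrow> 'i \<Rightarrow> bool) \<Rightarrow> bool" where
  "directed_set I le \<longleftrightarrow>
     I \<noteq> {} \<and> (\<forall>i\<in>I. le i i) \<and>
     (\<forall>i\<in>I. \<forall>j\<in>I. \<forall>k\<in>I. le i j \<longrightarrow> le j k \<longrightarrow> le i k) \<and>
     (\<forall>i\<in>I. \<forall>j\<in>I. \<exists>k\<in>I. le i k \<and> le j k)"

(* Poincare expansion of f along the filter F in the gauge functions g 0, g 1, ... *)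
definition poincare_expansion ::
    "'x filter \<Rightarrow> ('x \<Rightarrow> 'b::real_normed_field) \<Rightarrow> (nat \<Rightarrow> 'x \<Rightarrow> real) \<Rightarrow> (nat \<Rightarrow> 'b) \<Rightarrow> bool" where
  "poincare_expansion F f g c \<longleftrightarrow>
     (\<forall>N. (\<lambda>x. f x - (\<Sum>s\<le>N. c s * of_real (g s x))) \<in> o[F](\<lambda>x. of_real (g N x)))"

(* F(A i) \<sim> \<Sum>s. d s (A i)^(-p s) as the norm of (A i)^(-1) tends to 0; the limit is taken over all
   indices with small norm, not along the direction of the net. *)
definition op_expansion ::
    "'i set \<Rightarrow> 'a::complex_banach set \<Rightarrow> ('i \<Rightarrow> 'a \<Rightarrow> 'a) \<Rightarrow> ('i \<Rightarrow> 'a \<Rightarrow> 'a)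
     \<Rightarrow> (nat \<Rightarrow> real) \<Rightarrow> (nat \<Rightarrow> complex) \<Rightarrow> bool" where
  "op_expansion I Y A F p d \<longleftrightarrow>
     (\<forall>N. \<forall>\<epsilon>>0. \<exists>\<delta>>0. \<forall>i\<in>I. onorm (op_inverse Y (A i)) < \<delta> \<longrightarrow>
        onorm (\<lambda>u. F i u - (\<Sum>s\<le>N. d s *\<^sub>C neg_power Y (A i) (p s) u))
          \<le> \<epsilon> * onorm (neg_power Y (A i) (p N)))"

end

(*
  For a sectorial operator with the resolvent bounds (C2) the semigroup exp(-tA) is the strong limit of
  the backward Euler powers (1 + (t/n) A)^(-n) (Hille-Yosida, in Kato's form), so that
  ||exp(-tA)|| <= M exp(-t omega_1). Near a, the substitution t = h(x) - h(a) turns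
  Gamma(p) A^(-p) = int t^(p-1) exp(-tA) dt into an integral over x, up to an exponentially small tail;
  subtracting these from the Laplace integral leaves the integrand
  (phi - sum c_s (h - h(a))^(p_s - 1) h') exp(-(h - h(a)) A), which is o((h - h(a))^(p_N - 1) h') and hence
  contributes o(omega_1^(-p_N)). The sector condition and omega_1 >= eta omega make ||A^(-1)|| comparable to
  1/omega_1 through the spectral radius, and the law A^(-p) A^(-q) = A^(-(p+q)) with integer p + q gives
  ||A^(-p)|| >= C omega_1^(-p), so the remainder is o(||A^(-p_N)||).
*)

theory Submission
  imports Defs
begin

subsection \<open>Strongly continuous families of operators\<close>

text \<open>\<open>semigroup_of\<close> is a Hilbert choice among the semigroups generated by -A, so
  nothing can be computed with it until existence and uniqueness of a generated semigroup are
  proved; this is why the Hille-Yosida theorem is needed with uniqueness. Every later estimate sees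
  an operator only through M and the number \<open>w\<close>, that is \<omega>_1, and thresholds are
  chosen before the operator, which gives uniformity over the net. The delicate side is the lower
  bound for the norm of A^(-p): an error o(w^(-p)) is o(||A^(-p)||) only if this norm is not much
  smaller than w^(-p). The spectral radius controls integer powers of A^(-1) only, so a fractional
  A^(-p) is completed to an integer power by two further factors with known upper bounds. The
  spectrum is nonempty because an empty one would have infinite omega, against \<omega>_1 \<ge>
  \<eta> omega. Only strong continuity is available, so operator limits and derivatives are taken
  vector by vector and made joint by a uniform norm bound.\<close>

lemma has_vector_derivative_iff_quotient:
  "(f has_vector_derivative d) (at r within S) \<longleftrightarrow>
     ((\<lambda>s. (1 / (s - r)) *\<^sub>R (f s - f r)) \<longlongrightarrow> d) (at r within S)"
proof -
  have "(f has_vector_derivative d) (at r within S) \<longleftrightarrow>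
      ((\<lambda>s. norm ((f s - f r - (s - r) *\<^sub>R d) /\<^sub>R norm (s - r))) \<longlongrightarrow> 0) (at r within S)"
    by (simp add: has_vector_derivative_def has_derivative_within bounded_linear_scaleR_left
        divide_inverse tendsto_norm_zero_iff algebra_simps)
  also have "\<dots> \<longleftrightarrow> ((\<lambda>s. norm ((1 / (s - r)) *\<^sub>R (f s - f r) - d)) \<longlongrightarrow> 0) (at r within S)"
  proof (rule tendsto_cong)
    have "norm ((f s - f r - (s - r) *\<^sub>R d) /\<^sub>R norm (s - r))
        = norm ((1 / (s - r)) *\<^sub>R (f s - f r) - d)" if "s \<noteq> r" for s
    proof -
      have "(1 / (s - r)) *\<^sub>R (f s - f r) - d = (1 / (s - r)) *\<^sub>R (f s - f r - (s - r) *\<^sub>R d)"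
        using that by (simp add: scaleR_diff_right)
      then show ?thesis by (simp add: divide_inverse)
    qed
    then show "\<forall>\<^sub>F s in at r within S. norm ((f s - f r - (s - r) *\<^sub>R d) /\<^sub>R norm (s - r))
        = norm ((1 / (s - r)) *\<^sub>R (f s - f r) - d)"
      by (auto simp: eventually_at_filter intro!: always_eventually)
  qed
  finally show ?thesis by (simp add: tendsto_norm_zero_iff LIM_zero_iff)
qed

text \<open>Caratheodory's form of differentiability. An exact difference formula, such as a
  telescoped resolvent identity, thus yields a derivative without remainder estimates.\<close>

lemma has_vector_derivative_slope:
  assumes "\<And>s. s \<in> S \<Longrightarrow> f s - f r = (s - r) *\<^sub>R q s" "r \<in> S" "continuous_on S q" "q r = d"
  shows "(f has_vector_derivative d) (at r within S)"
  unfolding has_vector_derivative_iff_quotient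
proof (rule Lim_transform_within[where d=1])
  show "(q \<longlongrightarrow> d) (at r within S)"
    using assms by (auto simp: continuous_on_def)
  show "q s = (1 / (s - r)) *\<^sub>R (f s - f r)" if "s \<in> S" "0 < dist s r" for s
    using assms(1)[OF that(1)] that(2) by simp
qed simp

text \<open>\<open>L x (q x) - L x v = L x (q x - v)\<close> is at most
  \<open>M * norm (q x - v)\<close>: a uniform norm bound turns strong convergence into convergence
  along moving arguments.\<close>

lemma strong_tendsto:
  fixes L :: "'c \<Rightarrow> 'a::real_normed_vector \<Rightarrow> 'b::real_normed_vector"
  assumes lin: "\<forall>\<^sub>F x in F. linear (L x)"
    and bound: "\<forall>\<^sub>F x in F. \<forall>v. norm (L x v) \<le> M * norm v"
    and lim: "((\<lambda>x. L x v) \<longlongrightarrow> l) F" and q: "(q \<longlongrightarrow> v) F"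
  shows "((\<lambda>x. L x (q x)) \<longlongrightarrow> l) F"
proof -
  have "((\<lambda>x. norm (q x - v)) \<longlongrightarrow> 0) F"
    using q by (simp add: tendsto_norm_zero LIM_zero)
  then have z: "((\<lambda>x. M * norm (q x - v)) \<longlongrightarrow> 0) F"
    using tendsto_mult_right_zero by blast
  have "((\<lambda>x. L x (q x) - L x v) \<longlongrightarrow> 0) F"
  proof (rule Lim_null_comparison[OF _ z])
    show "\<forall>\<^sub>F x in F. norm (L x (q x) - L x v) \<le> M * norm (q x - v)"
      using lin bound by eventually_elim (simp flip: linear_diff)
  qed
  from tendsto_add[OF this lim] show ?thesis by simp
qed

lemma strong_continuous_on:
  fixes L :: "'c::topological_space \<Rightarrow> 'a::real_normed_vector \<Rightarrow> 'b::real_normed_vector"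
  assumes lin: "\<And>x. x \<in> S \<Longrightarrow> linear (L x)"
    and bound: "\<And>x v. x \<in> S \<Longrightarrow> norm (L x v) \<le> M * norm v"
    and cont: "\<And>v. continuous_on S (\<lambda>x. L x v)"
    and f: "continuous_on R f" "f ` R \<subseteq> S" and g: "continuous_on R g"
  shows "continuous_on R (\<lambda>x. L (f x) (g x))"
  unfolding continuous_on_def
proof
  fix x assume x: "x \<in> R"
  have ev: "\<forall>\<^sub>F y in at x within R. f y \<in> S"
    using f(2) by (auto simp: eventually_at_filter intro!: always_eventually)
  have "continuous_on R (\<lambda>y. L (f y) (g x))"
    by (rule continuous_on_compose2[OF cont f])
  then have "((\<lambda>y. L (f y) (g x)) \<longlongrightarrow> L (f x) (g x)) (at x within R)"
    using x by (simp add: continuous_on_def)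
  moreover have "(g \<longlongrightarrow> g x) (at x within R)"
    using x g by (simp add: continuous_on_def)
  ultimately show "((\<lambda>y. L (f y) (g y)) \<longlongrightarrow> L (f x) (g x)) (at x within R)"
    by (rule strong_tendsto[where M=M, rotated 2]) (use ev lin bound in \<open>auto elim: eventually_mono\<close>)
qed

text \<open>The uniform bound makes the family at \<open>v\<close> a uniform limit of the families
  at approximating vectors of \<open>D\<close>, so an estimate involving A need only be made on its
  domain.\<close>

lemma continuous_on_dense_extension:
  fixes L :: "'c::topological_space \<Rightarrow> 'a::real_normed_vector \<Rightarrow> 'b::real_normed_vector"
  assumes lin: "\<And>x. x \<in> S \<Longrightarrow> linear (L x)"
    and bound: "\<And>x v. x \<in> S \<Longrightarrow> norm (L x v) \<le> M * norm v"
    and cont: "\<And>v. v \<in> D \<Longrightarrow> continuous_on S (\<lambda>x. L x v)"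
    and D: "closure D = UNIV"
  shows "continuous_on S (\<lambda>x. L x v)"
proof -
  have "v \<in> closure D" using D by simp
  then obtain u where u: "\<And>n. u n \<in> D" "u \<longlonglongrightarrow> v"
    by (auto simp: closure_sequential)
  have "uniform_limit S (\<lambda>n x. L x (u n)) (\<lambda>x. L x v) sequentially"
  proof (rule uniform_limitI)
    fix e :: real assume e: "e > 0"
    have "(\<lambda>n. M * norm (u n - v)) \<longlonglongrightarrow> 0"
      using u(2) by (intro tendsto_mult_right_zero tendsto_norm_zero LIM_zero)
    then have "\<forall>\<^sub>F n in sequentially. M * norm (u n - v) < e"
      using e order_tendstoD(2) by blast
    then show "\<forall>\<^sub>F n in sequentially. \<forall>x\<in>S. dist (L x (u n)) (L x v) < e"
    proof eventually_elim
      case (elim n)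
      have "dist (L x (u n)) (L x v) \<le> M * norm (u n - v)" if "x \<in> S" for x
        unfolding dist_norm using bound[OF that] by (metis lin[OF that] linear_diff)
      with elim show ?case by (meson le_less_trans)
    qed
  qed
  then show ?thesis
    by (rule uniform_limit_theorem[rotated]) (use u cont in auto)
qed

text \<open>The quotient splits into \<open>(1 / (s - r)) *\<^sub>R (L s (f r) - L r (f r))\<close>
  and \<open>L s\<close> applied to the quotient of \<open>f\<close>. Differentiability of
  \<open>L\<close> is thus asked only at the single vector \<open>f r\<close>.\<close>

lemma strong_product_rule:
  fixes L :: "real \<Rightarrow> 'a::real_normed_vector \<Rightarrow> 'b::real_normed_vector"
  assumes lin: "\<And>s. s \<in> S \<Longrightarrow> linear (L s)"
    and bound: "\<And>s v. s \<in> S \<Longrightarrow> norm (L s v) \<le> M * norm v"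
    and cont: "continuous_on S (\<lambda>s. L s f')" and r: "r \<in> S"
    and dL: "((\<lambda>s. L s (f r)) has_vector_derivative d) (at r within S)"
    and df: "(f has_vector_derivative f') (at r within S)"
  shows "((\<lambda>s. L s (f s)) has_vector_derivative d + L r f') (at r within S)"
proof -
  have ev: "\<forall>\<^sub>F s in at r within S. s \<in> S"
    by (auto simp: eventually_at_filter intro!: always_eventually)
  have "((\<lambda>s. L s ((1 / (s - r)) *\<^sub>R (f s - f r))) \<longlongrightarrow> L r f') (at r within S)"
  proof (rule strong_tendsto[where L=L and M=M])
    show "\<forall>\<^sub>F s in at r within S. linear (L s)"
      using ev by eventually_elim (rule lin)
    show "\<forall>\<^sub>F s in at r within S. \<forall>v. norm (L s v) \<le> M * norm v"
      using ev by eventually_elim (use bound in blast)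
    show "((\<lambda>s. L s f') \<longlongrightarrow> L r f') (at r within S)"
      using cont r by (simp add: continuous_on_def)
    show "((\<lambda>s. (1 / (s - r)) *\<^sub>R (f s - f r)) \<longlongrightarrow> f') (at r within S)"
      using df by (simp only: has_vector_derivative_iff_quotient)
  qed
  then have "((\<lambda>s. (1 / (s - r)) *\<^sub>R (L s (f r) - L r (f r)) + L s ((1 / (s - r)) *\<^sub>R (f s - f r)))
      \<longlongrightarrow> d + L r f') (at r within S)"
    by (intro tendsto_add dL[unfolded has_vector_derivative_iff_quotient])
  then show ?thesis
    unfolding has_vector_derivative_iff_quotient
  proof (rule Lim_transform_eventually)
    show "\<forall>\<^sub>F s in at r within S. (1 / (s - r)) *\<^sub>R (L s (f r) - L r (f r))
        + L s ((1 / (s - r)) *\<^sub>R (f s - f r)) = (1 / (s - r)) *\<^sub>R (L s (f s) - L r (f r))"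
      using ev by eventually_elim (simp add: linear_cmul linear_diff lin algebra_simps)
  qed
qed

lemma differentiable_bound_vector:
  fixes f :: "real \<Rightarrow> 'b::real_normed_vector"
  assumes "convex S" "\<And>x. x \<in> S \<Longrightarrow> (f has_vector_derivative f' x) (at x within S)"
    and "\<And>x. x \<in> S \<Longrightarrow> norm (f' x) \<le> B" "x \<in> S" "y \<in> S"
  shows "norm (f x - f y) \<le> B * \<bar>x - y\<bar>"
proof -
  have "onorm (\<lambda>h. h *\<^sub>R f' z) \<le> B" if "z \<in> S" for z
    using assms(3)[OF that] order_trans[OF norm_ge_zero assms(3)[OF that]]
    by (intro onorm_bound) (auto simp: mult.commute[of B] intro: mult_left_mono)
  then show ?thesis
    using differentiable_bound[OF assms(1), of f "\<lambda>x h. h *\<^sub>R f' x" B x y] assms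
    by (simp add: has_vector_derivative_def)
qed

text \<open>Baire: the closed sets \<open>E k\<close> cover the space, so one of them contains a
  ball, and a vector of length \<open>e\<close> is the difference of two points of that
  ball.\<close>

lemma uniform_boundedness_principle:
  fixes \<L> :: "('a::banach \<Rightarrow> 'b::real_normed_vector) set"
  assumes lin: "\<And>L. L \<in> \<L> \<Longrightarrow> bounded_linear L"
    and pw: "\<And>v. \<exists>C. \<forall>L\<in>\<L>. norm (L v) \<le> C"
  shows "\<exists>K. \<forall>L\<in>\<L>. \<forall>v. norm (L v) \<le> K * norm v"
proof -
  define E where "E k = {v. \<forall>L\<in>\<L>. norm (L v) \<le> real k}" for k :: nat
  have cl: "closed (E k)" for k
  proof -
    have "E k = (\<Inter>L\<in>\<L>. {v. norm (L v) \<le> real k})" by (auto simp: E_def)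
    moreover have "closed {v. norm (L v) \<le> real k}" if "L \<in> \<L>" for L
      by (intro closed_Collect_le continuous_intros
          linear_continuous_on[OF lin[OF that]])
    ultimately show ?thesis by auto
  qed
  have "(\<Union>k. E k) = UNIV"
  proof (rule UNIV_eq_I[symmetric])
    fix v
    obtain C where "\<forall>L\<in>\<L>. norm (L v) \<le> C" using pw by blast
    moreover obtain k :: nat where "C \<le> real k" using real_arch_simple by blast
    ultimately show "v \<in> (\<Union>k. E k)" by (auto simp: E_def intro!: exI[of _ k] intro: order_trans)
  qed
  then have "\<not> (\<forall>T\<in>range E. closed T \<and> interior T = {})"
    using Met_TC.metric_Baire_category_alt[of "range E"]
    by (auto simp: Met_TC.mcomplete_def Cauchy_convergent_iff convergent_def)
  with cl have "\<exists>k. interior (E k) \<noteq> {}" by blast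
  then obtain k x where "x \<in> interior (E k)" by blast
  then obtain e where e: "e > 0" "cball x e \<subseteq> E k"
    by (meson mem_interior_cball)
  have "norm (L v) \<le> (2 * real k / e) * norm v" if L: "L \<in> \<L>" for L v
  proof (cases "v = 0")
    case True
    then show ?thesis using linear_0[OF bounded_linear.linear[OF lin[OF L]]] by simp
  next
    case False
    interpret bounded_linear L by (rule lin[OF L])
    define z where "z = (e / norm v) *\<^sub>R v"
    have "norm (L x) \<le> real k" "norm (L (x + z)) \<le> real k"
      using e L False by (auto simp: z_def E_def dist_norm subset_iff)
    then have "norm (L z) \<le> 2 * real k"
      using norm_triangle_ineq4[of "L (x + z)" "L x"] by (simp add: add)
    moreover have "norm (L z) = (e / norm v) * norm (L v)"
      using e False by (simp add: z_def scaleR)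
    ultimately show ?thesis using e False by (simp add: field_simps)
  qed
  then show ?thesis by blast
qed

subsection \<open>The Hille-Yosida theorem\<close>

lemma scaleC_zero_left [simp]: "0 *\<^sub>C x = 0"
  using scaleR_scaleC[of 0 x] by simp

lemma bounded_linear_scaleC: "bounded_linear ((*\<^sub>C) c)"
proof
  show "\<exists>K. \<forall>x. norm (c *\<^sub>C x) \<le> norm x * K"
    by (intro exI[of _ "cmod c"]) (simp add: norm_scaleC mult.commute)
qed (simp_all add: scaleC_add_right scaleR_scaleC scaleC_scaleC mult.commute)

lemma bounded_clinearI:
  assumes "\<And>u v. T (u + v) = T u + T v" "\<And>c u. T (c *\<^sub>C u) = c *\<^sub>C T u"
    and "\<And>u. norm (T u) \<le> K * norm u"
  shows "bounded_clinear T"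
  unfolding bounded_clinear_def
proof (intro conjI allI)
  show "bounded_linear T"
  proof
    show "\<exists>K. \<forall>x. norm (T x) \<le> norm x * K"
      using assms(3) by (intro exI[of _ K]) (simp add: mult.commute)
  qed (simp_all add: assms scaleR_scaleC)
qed (fact assms(2))

text \<open>\<open>w\<close> stands for \<omega>_1 of a single operator. \<open>M \<ge> 1\<close>
  lets the power bounds include the identity; a smaller constant is enlarged before the locale is
  instantiated.\<close>

locale hille_yosida =
  fixes Y :: "'a::complex_banach set" and A :: "'a \<Rightarrow> 'a" and M w :: real
  assumes Y: "csubspace Y" and dense: "closure Y = UNIV" and A: "clinear_on Y A"
    and w: "w > 0" and M: "M \<ge> 1"
    and not_spectrum: "\<And>r. r < w \<Longrightarrow> complex_of_real r \<notin> spectrum Y A"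
    and resolvent_power: "\<And>n r. n \<ge> 1 \<Longrightarrow> r < w \<Longrightarrow>
      onorm (resolvent Y A (complex_of_real r) ^^ n) \<le> M / (w - r) ^ n"
begin

lemma Y_add: "u \<in> Y \<Longrightarrow> v \<in> Y \<Longrightarrow> u + v \<in> Y"
  and Y_scaleC: "u \<in> Y \<Longrightarrow> c *\<^sub>C u \<in> Y"
  using Y by (auto simp: csubspace_def)

lemma Y_scaleR: "u \<in> Y \<Longrightarrow> r *\<^sub>R u \<in> Y"
  by (simp add: scaleR_scaleC Y_scaleC)

lemma Y_diff: "u \<in> Y \<Longrightarrow> v \<in> Y \<Longrightarrow> u - v \<in> Y"
  using Y_add[of u "- 1 *\<^sub>R v"] Y_scaleR[of v "-1"] by simp

lemma A_add: "u \<in> Y \<Longrightarrow> v \<in> Y \<Longrightarrow> A (u + v) = A u + A v"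
  and A_scaleC: "u \<in> Y \<Longrightarrow> A (c *\<^sub>C u) = c *\<^sub>C A u"
  using A by (auto simp: clinear_on_def)

lemma A_scaleR: "u \<in> Y \<Longrightarrow> A (r *\<^sub>R u) = r *\<^sub>R A u"
  by (simp add: scaleR_scaleC A_scaleC)

lemma A_diff: "u \<in> Y \<Longrightarrow> v \<in> Y \<Longrightarrow> A (u - v) = A u - A v"
  using A_add[of u "- 1 *\<^sub>R v"] Y_scaleR[of v "-1"] A_scaleR[of v "-1"] by simp

section \<open>Real resolvents and the operators (1 + s A)^(-1)\<close>

lemma resolvent_real:
  assumes "r < w"
  defines "R \<equiv> resolvent Y A (complex_of_real r)"
  shows resolvent_in: "R v \<in> Y"
    and resolvent_right: "r *\<^sub>R R v - A (R v) = v"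
    and resolvent_left: "u \<in> Y \<Longrightarrow> R (r *\<^sub>R u - A u) = u"
    and resolvent_bounded: "bounded_clinear R"
proof -
  have bij: "bij_betw (\<lambda>u. complex_of_real r *\<^sub>C u - A u) Y UNIV" and "bounded_clinear R"
    using not_spectrum[OF assms(1)] by (auto simp: spectrum_def R_def)
  have R: "R = inv_into Y (\<lambda>u. r *\<^sub>R u - A u)"
    by (simp add: R_def resolvent_def op_inverse_def scaleR_scaleC)
  have bij: "bij_betw (\<lambda>u. r *\<^sub>R u - A u) Y UNIV"
    using bij by (simp add: scaleR_scaleC)
  then have v: "v \<in> (\<lambda>u. r *\<^sub>R u - A u) ` Y" for v by (simp add: bij_betw_def)
  show "R v \<in> Y" unfolding R by (rule inv_into_into[OF v])
  show "r *\<^sub>R R v - A (R v) = v" using f_inv_into_f[OF v] by (simp add: R)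
  show "R (r *\<^sub>R u - A u) = u" if "u \<in> Y"
    unfolding R using that by (rule inv_into_f_f[OF bij_betw_imp_inj_on[OF bij]])
  show "bounded_clinear R" by fact
qed

text \<open>For s > 0 the point -1/s lies to the left of \<open>w\<close>, and (-1/s - A)^(-1) = -s
  (1 + s A)^(-1); dividing by -s gives the operator wanted below.\<close>

definition res :: "real \<Rightarrow> 'a \<Rightarrow> 'a" where
  "res s = resolvent Y A (complex_of_real (- 1 / s))"

text \<open>\<open>F s\<close> is the inverse of \<open>1 + s A\<close>.\<close>

definition F :: "real \<Rightarrow> 'a \<Rightarrow> 'a" where
  "F s v = (if s = 0 then v else (- 1 / s) *\<^sub>R res s v)"

lemma F_0 [simp]: "F 0 v = v"
  by (simp add: F_def)

lemma neg_inverse_less_w: "s > 0 \<Longrightarrow> - 1 / s < w"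
  using w by (smt (verit) divide_neg_pos)

lemma res_bounded: "s > 0 \<Longrightarrow> bounded_clinear (res s)"
  unfolding res_def by (intro resolvent_bounded neg_inverse_less_w)

lemma F_in: "s > 0 \<Longrightarrow> F s v \<in> Y"
  using Y_scaleR[OF resolvent_in[OF neg_inverse_less_w], of s "- 1 / s" v]
  by (simp only: F_def res_def) simp

lemma F_eq:
  assumes "s \<ge> 0" shows "F s v + s *\<^sub>R A (F s v) = v"
proof (cases "s = 0")
  case False
  then have s: "s > 0" using assms by simp
  define x where "x = res s v"
  have x: "x \<in> Y" "(- 1 / s) *\<^sub>R x - A x = v"
    unfolding x_def res_def using neg_inverse_less_w[OF s] by (rule resolvent_in resolvent_right)+
  have F: "F s v = (- 1 / s) *\<^sub>R x" using s by (simp add: F_def x_def)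
  have "s *\<^sub>R A (F s v) = - A x" unfolding F A_scaleR[OF x(1)] using s by simp
  then show ?thesis using x(2) F by simp
qed simp

lemma F_bounded_clinear: "s \<ge> 0 \<Longrightarrow> bounded_clinear (F s)"
proof (cases "s = 0")
  case True
  then have "F s = (\<lambda>v. v)" by (simp add: fun_eq_iff)
  then show ?thesis by (simp add: bounded_clinear_def bounded_linear_ident)
next
  case False
  assume "s \<ge> 0"
  then have "bounded_clinear (res s)"
    using False by (intro res_bounded) simp
  moreover have "F s = (\<lambda>v. (- 1 / s) *\<^sub>R res s v)"
    using False by (simp add: fun_eq_iff F_def)
  ultimately show ?thesis
    unfolding bounded_clinear_def
    by (simp only: bounded_linear_compose[OF bounded_linear_scaleR_right])
       (simp add: scaleR_scaleC scaleC_scaleC mult.commute)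
qed

lemma F_linear: "s \<ge> 0 \<Longrightarrow> linear (F s)"
  using F_bounded_clinear by (auto simp: bounded_clinear_def bounded_linear.linear)

lemma F_power_bounded_clinear: "s \<ge> 0 \<Longrightarrow> bounded_clinear (F s ^^ n)"
proof (induction n)
  case 0
  then show ?case by (simp add: bounded_clinear_def id_def)
next
  case (Suc n)
  then have "bounded_linear (F s)" "bounded_linear (F s ^^ n)"
    and "\<And>c u. F s (c *\<^sub>C u) = c *\<^sub>C F s u" "\<And>c u. (F s ^^ n) (c *\<^sub>C u) = c *\<^sub>C (F s ^^ n) u"
    using F_bounded_clinear by (auto simp: bounded_clinear_def)
  then show ?case
    by (simp add: bounded_clinear_def bounded_linear_compose o_def)
qed

lemma F_power_linear: "s \<ge> 0 \<Longrightarrow> linear (F s ^^ n)"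
  using F_power_bounded_clinear by (auto simp: bounded_clinear_def bounded_linear.linear)

lemma F_left:
  assumes "s \<ge> 0" "u \<in> Y" shows "F s (u + s *\<^sub>R A u) = u"
proof (cases "s = 0")
  case False
  then have s: "s > 0" using assms by simp
  have "u = res s ((- 1 / s) *\<^sub>R u - A u)"
    unfolding res_def by (rule resolvent_left[symmetric, OF neg_inverse_less_w[OF s] assms(2)])
  also have "(- 1 / s) *\<^sub>R u - A u = (- 1 / s) *\<^sub>R (u + s *\<^sub>R A u)"
    using s by (simp add: algebra_simps)
  also have "res s \<dots>
      = (- 1 / s) *\<^sub>R res s (u + s *\<^sub>R A u)"
    using res_bounded[OF s]
    by (simp only: bounded_clinear_def bounded_linear.linear linear_cmul)
  also have "\<dots> = F s (u + s *\<^sub>R A u)" using s by (simp add: F_def)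
  finally show ?thesis by simp
qed simp

text \<open>Both \<open>s *\<^sub>R A (F s u)\<close> and \<open>s *\<^sub>R F s (A u)\<close> equal
  \<open>u - F s u\<close>, by the right and the left inverse law.\<close>

lemma F_A:
  assumes "s \<ge> 0" "u \<in> Y" shows "A (F s u) = F s (A u)" "F s u \<in> Y"
proof -
  show Y: "F s u \<in> Y" using assms F_in[of s u] by (cases "s = 0") auto
  show "A (F s u) = F s (A u)"
  proof (cases "s = 0")
    case False
    have "s *\<^sub>R A (F s u) = u - F s u" using F_eq[OF assms(1), of u] by (simp add: algebra_simps)
    moreover have "s *\<^sub>R F s (A u) = u - F s u"
      using F_left[OF assms] linear_add[OF F_linear[OF assms(1)]] linear_cmul[OF F_linear[OF assms(1)]]
      by (simp add: algebra_simps)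
    ultimately have "s *\<^sub>R A (F s u) = s *\<^sub>R F s (A u)" by simp
    with False show ?thesis by simp
  qed simp
qed

text \<open>Applying \<open>F s\<close> to (1 + r A) F_r v = v and moving A past it exhibits
  \<open>F s v\<close> as the image of \<open>F s (F r v)\<close> under 1 + r A; the left inverse
  law for \<open>F r\<close> finishes.\<close>

lemma F_commute:
  assumes "s \<ge> 0" "r \<ge> 0" shows "F s (F r v) = F r (F s v)"
proof (cases "r = 0")
  case False
  then have r: "F r v \<in> Y" using assms F_in by simp
  have "F s v = F s (F r v + r *\<^sub>R A (F r v))" by (simp add: F_eq assms)
  also have "\<dots> = F s (F r v) + r *\<^sub>R A (F s (F r v))"
    using linear_add[OF F_linear[OF assms(1)]] linear_cmul[OF F_linear[OF assms(1)]] F_A r assms by simp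
  finally show ?thesis using F_left[OF assms(2) F_A(2)[OF assms(1) r]] by simp
qed simp

text \<open>The resolvent identity. Written with \<open>A u\<close> on the right it also covers s =
  0 and r = 0, where F is the identity.\<close>

lemma F_diff:
  assumes "s \<ge> 0" "r \<ge> 0" "u \<in> Y" shows "F s u - F r u = (s - r) *\<^sub>R - F s (F r (A u))"
proof -
  note l = linear_add[OF F_linear[OF assms(1)]] linear_cmul[OF F_linear[OF assms(1)]]
  have "F r u + r *\<^sub>R A (F r u) = u" by (rule F_eq[OF assms(2)])
  then have "F s u = F s (F r u) + r *\<^sub>R F s (F r (A u))"
    using l F_A[OF assms(2,3)] by metis
  moreover have "F r u = F s (F r u) + s *\<^sub>R F s (F r (A u))"
    using F_left[OF assms(1) F_A(2)[OF assms(2,3)]] l F_A[OF assms(2,3)] by metis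
  ultimately have "F s u - F r u
      = (F s (F r u) + r *\<^sub>R F s (F r (A u))) - (F s (F r u) + s *\<^sub>R F s (F r (A u)))" by argo
  then show ?thesis by (simp add: algebra_simps)
qed

text \<open>The resolvent bound at -1/s has the distance w + 1/s, and n factors 1/s turn it into 1 +
  s w, whose n-th power at s = t/n tends to exp (w t).\<close>

lemma F_power_norm:
  assumes "s \<ge> 0" shows "norm ((F s ^^ n) v) \<le> M / (1 + s * w) ^ n * norm v"
proof (cases "s = 0 \<or> n = 0")
  case True
  \<comment> \<open>Both exceptional cases concern the identity, for which \<open>M \<ge> 1\<close>
    is the whole bound.\<close>
  have "(F 0 ^^ n) v = v" by (induction n) auto
  with True show ?thesis using M mult_right_mono[OF M, of "norm v"] by auto
next
  case False
  then have s: "s > 0" and n: "n \<ge> 1" using assms by auto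
  define R where "R = res s"
  have blR: "bounded_linear R" and r: "- 1 / s < w"
    using res_bounded neg_inverse_less_w s by (auto simp: bounded_clinear_def R_def)
  have "(F s ^^ n) v = (- 1 / s) ^ n *\<^sub>R (R ^^ n) v"
  proof (induction n)
    case (Suc n)
    have "(F s ^^ Suc n) v = F s ((- 1 / s) ^ n *\<^sub>R (R ^^ n) v)" by (simp only: funpow.simps o_def Suc)
    also have "\<dots> = (- 1 / s) *\<^sub>R R ((- 1 / s) ^ n *\<^sub>R (R ^^ n) v)" using s by (simp add: F_def R_def)
    also have "\<dots> = (- 1 / s) ^ Suc n *\<^sub>R (R ^^ Suc n) v"
      by (simp only: linear_cmul[OF bounded_linear.linear[OF blR]] scaleR_scaleR power_Suc funpow.simps o_def)
    finally show ?case .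
  qed simp
  then have "norm ((F s ^^ n) v) = (1 / s) ^ n * norm ((R ^^ n) v)"
    using s by (simp add: power_divide)
  moreover have "bounded_linear (R ^^ k)" for k
    by (induction k) (auto simp: id_def bounded_linear_ident o_def intro: bounded_linear_compose[OF blR])
  then have "norm ((R ^^ n) v) \<le> onorm (R ^^ n) * norm v" by (rule onorm)
  moreover have "onorm (R ^^ n) * norm v \<le> M / (w - (- 1 / s)) ^ n * norm v"
    using resolvent_power[OF n r] by (intro mult_right_mono) (auto simp: R_def res_def)
  ultimately have "norm ((F s ^^ n) v) \<le> (1 / s) ^ n * (M / (w - (- 1 / s)) ^ n * norm v)"
    using s by (simp only: mult_left_mono zero_le_power zero_le_divide_1_iff less_imp_le order_trans)
  also have "\<dots> = M / (s * (w + 1 / s)) ^ n * norm v"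
    by (simp add: power_mult_distrib power_divide)
  also have "s * (w + 1 / s) = 1 + s * w" using s by (simp add: field_simps)
  finally show ?thesis .
qed

lemma F_power_norm_M:
  assumes "s \<ge> 0" shows "norm ((F s ^^ n) v) \<le> M * norm v"
proof -
  have "1 \<le> (1 + s * w) ^ n" using assms w by (intro one_le_power) simp
  then have "M / (1 + s * w) ^ n \<le> M" using M by (simp add: field_simps)
  then show ?thesis using F_power_norm[OF assms, of n v] mult_right_mono[of _ M "norm v"] order_trans
    by (metis norm_ge_zero)
qed

lemma F_norm_M: "s \<ge> 0 \<Longrightarrow> norm (F s v) \<le> M * norm v"
  using F_power_norm_M[of s 1] by simp

lemma F_continuous: "continuous_on {0..} (\<lambda>s. F s v)"
proof (rule continuous_on_dense_extension[where M=M and D=Y])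
  fix u assume u: "u \<in> Y"
  have "(M * M * norm (A u))-lipschitz_on {0..} (\<lambda>s. F s u)"
  proof (rule lipschitz_onI)
    fix s r :: real assume sr: "s \<in> {0..}" "r \<in> {0..}"
    have "norm (F s (F r (A u))) \<le> M * (M * norm (A u))"
      using sr M by (intro order_trans[OF F_norm_M mult_left_mono[OF F_norm_M]]) auto
    then have "\<bar>s - r\<bar> * norm (F s (F r (A u))) \<le> \<bar>s - r\<bar> * (M * (M * norm (A u)))"
      by (intro mult_left_mono) auto
    then show "dist (F s u) (F r u) \<le> M * M * norm (A u) * dist s r"
      using sr u by (simp add: dist_norm F_diff mult_ac)
  qed (use M in simp)
  then show "continuous_on {0..} (\<lambda>s. F s u)" by (rule lipschitz_on_continuous_on)
qed (use F_linear F_norm_M dense in auto)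

lemma F_compose_continuous:
  assumes "continuous_on S f" "\<And>x. x \<in> S \<Longrightarrow> f x \<ge> 0" "continuous_on S g"
  shows "continuous_on S (\<lambda>x. F (f x) (g x))"
  by (rule strong_continuous_on[where S="{0..}" and M=M])
     (use F_linear F_norm_M F_continuous assms in auto)

lemma F_power_continuous:
  assumes "continuous_on S f" "\<And>x. x \<in> S \<Longrightarrow> f x \<ge> 0" "continuous_on S g"
  shows "continuous_on S (\<lambda>x. (F (f x) ^^ n) (g x))"
  using assms by (induction n) (auto intro: F_compose_continuous)

lemma F_power_commute:
  "s \<ge> 0 \<Longrightarrow> r \<ge> 0 \<Longrightarrow> F s ((F r ^^ n) v) = (F r ^^ n) (F s v)"
  by (induction n) (auto simp: F_commute)

lemma F_power_A:
  assumes "s \<ge> 0" "u \<in> Y" shows "A ((F s ^^ n) u) = (F s ^^ n) (A u)" "(F s ^^ n) u \<in> Y"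
  by (induction n) (use assms F_A in auto)

text \<open>Telescoping of a difference of n-th powers, each factor F_s - F_r being replaced by the
  resolvent identity; hence n terms with n + 1 factors each.\<close>

lemma F_power_diff:
  assumes "s \<ge> 0" "r \<ge> 0" "u \<in> Y"
  shows "(F s ^^ n) u - (F r ^^ n) u
    = (s - r) *\<^sub>R - (\<Sum>j<n. (F s ^^ Suc j) ((F r ^^ (n - j)) (A u)))"
proof (induction n)
  case (Suc n)
  note l = F_power_linear[OF assms(1)]
  have Y: "(F r ^^ n) u \<in> Y" using F_power_A assms by blast
  have "(F s ^^ Suc n) u - (F r ^^ Suc n) u
      = F s ((F s ^^ n) u - (F r ^^ n) u) + (F s ((F r ^^ n) u) - F r ((F r ^^ n) u))"
    by (simp add: linear_diff[OF F_linear[OF assms(1)]])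
  also have "F s ((F r ^^ n) u) - F r ((F r ^^ n) u) = (s - r) *\<^sub>R - F s ((F r ^^ Suc n) (A u))"
    using F_diff[OF assms(1,2) Y] F_power_A assms by simp
  also have "F s ((F s ^^ n) u - (F r ^^ n) u)
      = (s - r) *\<^sub>R - (\<Sum>j<n. (F s ^^ Suc (Suc j)) ((F r ^^ (n - j)) (A u)))"
    unfolding Suc
    by (simp add: linear_sum[OF F_linear[OF assms(1)]] linear_neg[OF F_linear[OF assms(1)]]
        linear_cmul[OF F_linear[OF assms(1)]])
  finally show ?case
    unfolding sum.lessThan_Suc_shift by (simp add: scaleR_diff_right del: sum.lessThan_Suc)
qed simp

lemma F_power_derivative:
  assumes "r \<ge> 0" "u \<in> Y"
  shows "((\<lambda>s. (F s ^^ n) u) has_vector_derivative (- real n) *\<^sub>R (F r ^^ Suc n) (A u)) (at r within {0..})"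
proof (rule has_vector_derivative_slope)
  fix s :: real assume "s \<in> {0..}"
  then show "(F s ^^ n) u - (F r ^^ n) u
      = (s - r) *\<^sub>R - (\<Sum>j<n. (F s ^^ Suc j) ((F r ^^ (n - j)) (A u)))"
    using F_power_diff assms by simp
next
  show "continuous_on {0..} (\<lambda>s. - (\<Sum>j<n. (F s ^^ Suc j) ((F r ^^ (n - j)) (A u))))"
    by (intro continuous_on_minus continuous_on_sum F_power_continuous continuous_intros) auto
  have "(F r ^^ Suc j) ((F r ^^ (n - j)) x) = (F r ^^ Suc n) x" if "j < n" for j x
    using that funpow_add[of "Suc j" "n - j" "F r"] by simp
  then show "- (\<Sum>j<n. (F r ^^ Suc j) ((F r ^^ (n - j)) (A u))) = (- real n) *\<^sub>R (F r ^^ Suc n) (A u)"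
    by (simp add: scaleR_conv_of_real sum_constant_scaleR del: funpow.simps)
qed (use assms in auto)


text \<open>The domain of A^2: the Cauchy estimate and the Taylor estimate below both cost two
  applications of A.\<close>

definition D2 :: "'a set" where "D2 = {u \<in> Y. A u \<in> Y}"

lemma F_tendsto_0:
  assumes "f \<longlonglongrightarrow> 0" "\<And>k. f k \<ge> 0" "q \<longlonglongrightarrow> v"
  shows "(\<lambda>k. F (f k) (q k)) \<longlonglongrightarrow> v"
proof (rule strong_tendsto[where L="\<lambda>k. F (f k)" and M=M and v=v])
  have "continuous_on {0..} (\<lambda>s. F s v)" by (rule F_continuous)
  then have "(\<lambda>k. F (f k) v) \<longlonglongrightarrow> F 0 v"
    by (rule continuous_on_tendsto_compose) (use assms in auto)
  then show "(\<lambda>k. F (f k) v) \<longlonglongrightarrow> v" by simp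
qed (use assms F_linear F_norm_M in auto)

lemma inverse_Suc_tendsto_0: "(\<lambda>k. c / real (Suc k)) \<longlonglongrightarrow> 0"
  using LIMSEQ_Suc[OF lim_const_over_n[of c]] by simp

lemma D2_dense: "closure D2 = UNIV"
proof (rule UNIV_eq_I[symmetric])
  fix v
  let ?f = "\<lambda>k. 1 / real (Suc k)"
  have "(\<lambda>k. F (?f k) (F (?f k) v)) \<longlonglongrightarrow> v"
    by (intro F_tendsto_0 inverse_Suc_tendsto_0 tendsto_const) auto
  moreover have "F (?f k) (F (?f k) v) \<in> D2" for k
    using F_in[of "?f k"] F_A[of "?f k" "F (?f k) v"] by (simp add: D2_def)
  ultimately show "v \<in> closure D2"
    unfolding closure_sequential by (intro exI[of _ "\<lambda>k. F (?f k) (F (?f k) v)"] conjI allI)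
qed

text \<open>\<open>D2\<close> is a core: since F commutes with A, the vectors
  \<open>F (1 / k) u\<close> approximate u in the graph norm. Identities linear in u and
  \<open>A u\<close> therefore extend from \<open>D2\<close> to \<open>Y\<close>.\<close>

lemma D2_core:
  assumes "u \<in> Y"
  obtains q where "\<And>k. q k \<in> D2" "q \<longlonglongrightarrow> u" "(\<lambda>k. A (q k)) \<longlonglongrightarrow> A u"
proof
  let ?f = "\<lambda>k. 1 / real (Suc k)"
  show "F (?f k) u \<in> D2" for k
    using assms F_A[of "?f k" u] F_in[of "?f k"] by (simp add: D2_def)
  show "(\<lambda>k. F (?f k) u) \<longlonglongrightarrow> u"
    by (intro F_tendsto_0 inverse_Suc_tendsto_0 tendsto_const) auto
  have "(\<lambda>k. F (?f k) (A u)) \<longlonglongrightarrow> A u"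
    by (intro F_tendsto_0 inverse_Suc_tendsto_0 tendsto_const) auto
  then show "(\<lambda>k. A (F (?f k) u)) \<longlonglongrightarrow> A u" using assms F_A by simp
qed

section \<open>Convergence of the backward Euler powers\<close>

definition V :: "nat \<Rightarrow> real \<Rightarrow> 'a \<Rightarrow> 'a" where
  "V n t = F (t / real n) ^^ n"

lemma V_linear: "t \<ge> 0 \<Longrightarrow> linear (V n t)"
  by (simp add: V_def F_power_linear)

lemma V_norm: "t \<ge> 0 \<Longrightarrow> norm (V n t v) \<le> M * norm v"
  by (simp add: V_def F_power_norm_M)

text \<open>The exponent k is kept apart from the step number n because the second derivative of
  \<open>V n\<close> differentiates the power n + 1 at step t/n.\<close>

lemma F_power_rescaled_derivative:
  assumes r: "r \<ge> 0" and u: "u \<in> Y" and n: "n > 0"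
  shows "((\<lambda>t. (F (t / real n) ^^ k) u) has_vector_derivative
      (- real k / real n) *\<^sub>R (F (r / real n) ^^ Suc k) (A u)) (at r within {0..})"
proof -
  have 1: "((\<lambda>t. t / real n) has_vector_derivative (1 / real n)) (at r within {0..})"
    using n by (auto intro!: derivative_eq_intros simp: has_real_derivative_iff_has_vector_derivative[symmetric])
  have "((\<lambda>s. (F s ^^ k) u) has_vector_derivative (- real k) *\<^sub>R (F (r / real n) ^^ Suc k) (A u))
      (at (r / real n) within (\<lambda>t. t / real n) ` {0..})"
    by (rule has_vector_derivative_within_subset[OF F_power_derivative]) (use r u n in auto)
  from vector_diff_chain_within[OF 1 this] show ?thesis by (simp add: o_def)
qed

lemma V_derivative:
  assumes "r \<ge> 0" "u \<in> Y" "n > 0"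
  shows "((\<lambda>t. V n t u) has_vector_derivative - (F (r / real n) ^^ Suc n) (A u)) (at r within {0..})"
  using F_power_rescaled_derivative[OF assms, of n] assms(3) by (simp add: V_def)

text \<open>Kato's estimate: differentiate \<open>V m (t - s) (V n s u)\<close> in \<open>s\<close>.\<close>

lemma V_diff_norm:
  assumes u: "u \<in> D2" and t: "t \<ge> 0" and n: "n > 0" "m > 0"
  shows "norm (V n t u - V m t u) \<le> M\<^sup>2 * t\<^sup>2 * (1 / real m + 1 / real n) * norm (A (A u))"
proof -
  have uY: "u \<in> Y" "A u \<in> Y" using u by (auto simp: D2_def)
  define g where "g s = V m (t - s) (V n s u)" for s
  define g' where "g' s = (F ((t - s) / real m) ^^ Suc m) (A (V n s u))
      + V m (t - s) (- (F (s / real n) ^^ Suc n) (A u))" for s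
  define B where "B = t * (1 / real m + 1 / real n) * (M * (M * norm (A (A u))))"
  have der: "(g has_vector_derivative g' r) (at r within {0..t})" if r: "r \<in> {0..t}" for r
    unfolding g_def g'_def
  proof (rule strong_product_rule[where M=M and L="\<lambda>s. V m (t - s)" and f="\<lambda>s. V n s u"])
    show "continuous_on {0..t} (\<lambda>s. V m (t - s) (- (F (r / real n) ^^ Suc n) (A u)))"
      unfolding V_def by (intro F_power_continuous continuous_intros) (use n in auto)
    have Y: "V n r u \<in> Y" using F_power_A uY r by (simp add: V_def)
    have 1: "((\<lambda>s. t - s) has_vector_derivative (- 1)) (at r within {0..t})"
      by (auto intro!: derivative_eq_intros simp: has_real_derivative_iff_has_vector_derivative[symmetric])
    have "((\<lambda>s. V m s (V n r u)) has_vector_derivative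
        - (F ((t - r) / real m) ^^ Suc m) (A (V n r u))) (at (t - r) within (\<lambda>s. t - s) ` {0..t})"
      by (rule has_vector_derivative_within_subset[OF V_derivative]) (use r n Y in auto)
    from vector_diff_chain_within[OF 1 this]
    show "((\<lambda>s. V m (t - s) (V n r u)) has_vector_derivative
        (F ((t - r) / real m) ^^ Suc m) (A (V n r u))) (at r within {0..t})"
      by (simp add: o_def)
    show "((\<lambda>s. V n s u) has_vector_derivative - (F (r / real n) ^^ Suc n) (A u)) (at r within {0..t})"
      by (rule has_vector_derivative_within_subset[OF V_derivative]) (use r n uY in auto)
  qed (use r V_linear V_norm in auto)
  have bound: "norm (g' s) \<le> B" if s: "s \<in> {0..t}" for s
  proof -
    define \<sigma> \<rho> where "\<sigma> = (t - s) / real m" and "\<rho> = s / real n"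
    define x where "x = (F \<rho> ^^ n) (A u)"
    have pos: "\<sigma> \<ge> 0" "\<rho> \<ge> 0" using s by (auto simp: \<sigma>_def \<rho>_def)
    have x: "x \<in> Y" "A x = (F \<rho> ^^ n) (A (A u))" using F_power_A pos uY by (auto simp: x_def)
    note l = F_power_linear[OF pos(1)]
    \<comment> \<open>The two terms differ in a single factor, \<open>F \<sigma>\<close> against
      \<open>F \<rho>\<close>, so the resolvent identity gains \<sigma> - \<rho>, of order 1/m +
      1/n, at the price of one more A.\<close>
    have "g' s = (F \<sigma> ^^ Suc m) x - (F \<sigma> ^^ m) (F \<rho> x)"
      using F_power_A pos uY linear_neg[OF l]
      by (simp add: g'_def V_def x_def flip: \<sigma>_def \<rho>_def)
    also have "\<dots> = (F \<sigma> ^^ m) (F \<sigma> x - F \<rho> x)"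
      by (simp add: linear_diff[OF l] funpow_swap1)
    also have "\<dots> = (\<sigma> - \<rho>) *\<^sub>R - (F \<sigma> ^^ Suc m) ((F \<rho> ^^ Suc n) (A (A u)))"
      using linear_neg[OF l] linear_cmul[OF l] x pos by (simp add: F_diff funpow_swap1)
    finally have "norm (g' s) = \<bar>\<sigma> - \<rho>\<bar> * norm ((F \<sigma> ^^ Suc m) ((F \<rho> ^^ Suc n) (A (A u))))"
      by simp
    also have "\<dots> \<le> (t * (1 / real m + 1 / real n)) * (M * (M * norm (A (A u))))"
    proof (intro mult_mono order_trans[OF F_power_norm_M mult_left_mono[OF F_power_norm_M]])
      have "\<sigma> \<le> t / real m" "\<rho> \<le> t / real n"
        using s by (auto simp: \<sigma>_def \<rho>_def intro!: divide_right_mono)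
      then show "\<bar>\<sigma> - \<rho>\<bar> \<le> t * (1 / real m + 1 / real n)"
        using pos by (simp add: distrib_left)
    qed (use pos M t in auto)
    finally show ?thesis by (simp add: B_def)
  qed
  have "norm (g t - g 0) \<le> B * \<bar>t - 0\<bar>"
    by (rule differentiable_bound_vector[OF _ der bound]) (use t in auto)
  moreover have "g t = V n t u" "g 0 = V m t u"
  proof -
    have "(F 0 ^^ k) v = v" for k v by (induction k) auto
    then show "g t = V n t u" "g 0 = V m t u" by (auto simp: g_def V_def)
  qed
  ultimately show ?thesis using t by (simp add: B_def power2_eq_square mult_ac)
qed

section \<open>The limit semigroup and its generator\<close>

definition T :: "real \<Rightarrow> 'a \<Rightarrow> 'a" where
  "T t v = lim (\<lambda>n. V (Suc n) t v)"

text \<open>Kato's estimate gives the Cauchy property on the dense set \<open>D2\<close>; the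
  uniform bound \<open>M\<close> carries it to every vector. Indexing by \<open>Suc n\<close> avoids
  the step t/0.\<close>

lemma V_tendsto_T:
  assumes t: "t \<ge> 0" shows "(\<lambda>n. V (Suc n) t v) \<longlonglongrightarrow> T t v"
proof -
  have "Cauchy (\<lambda>n. V (Suc n) t v)"
  proof (rule metric_CauchyI)
    fix e :: real assume e: "e > 0"
    obtain u where u: "u \<in> D2" "dist u v < e / (4 * M)"
      using D2_dense M e closure_approachable[of v D2] by (metis UNIV_I divide_pos_pos mult_pos_pos zero_less_numeral zero_less_one order_less_le_trans)
    define K where "K = M\<^sup>2 * t\<^sup>2 * norm (A (A u))"
    have K: "K \<ge> 0" by (simp add: K_def)
    have "\<forall>\<^sub>F n in sequentially. K / real (Suc n) < e / 4"
      using order_tendstoD(2)[OF inverse_Suc_tendsto_0] e by simp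
    then obtain N where N: "\<And>n. n \<ge> N \<Longrightarrow> K / real (Suc n) < e / 4"
      by (auto simp: eventually_sequentially)
    have "dist (V (Suc n) t v) (V (Suc m) t v) < e" if "n \<ge> N" "m \<ge> N" for n m
    proof -
      have close: "norm (V (Suc k) t v - V (Suc k) t u) < e / 4" for k
      proof -
        have "norm (V (Suc k) t v - V (Suc k) t u) \<le> M * norm (v - u)"
          using V_norm[OF t] linear_diff[OF V_linear[OF t]] by metis
        also have "\<dots> < M * (e / (4 * M))"
          using u(2) M by (intro mult_strict_left_mono) (auto simp: dist_norm norm_minus_commute)
        also have "\<dots> = e / 4" using M by simp
        finally show ?thesis .
      qed
      have "norm (V (Suc n) t u - V (Suc m) t u) \<le> K / real (Suc m) + K / real (Suc n)"
        using V_diff_norm[OF u(1) t, of "Suc n" "Suc m"] by (simp add: K_def field_simps)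
      then have mid: "norm (V (Suc n) t u - V (Suc m) t u) < e / 2"
        using N[OF that(1)] N[OF that(2)] by linarith
      have "V (Suc n) t v - V (Suc m) t v = (V (Suc n) t v - V (Suc n) t u)
          + (V (Suc n) t u - V (Suc m) t u) - (V (Suc m) t v - V (Suc m) t u)" by simp
      then have "norm (V (Suc n) t v - V (Suc m) t v) \<le> norm (V (Suc n) t v - V (Suc n) t u)
          + norm (V (Suc n) t u - V (Suc m) t u) + norm (V (Suc m) t v - V (Suc m) t u)"
        by (metis norm_triangle_le_diff norm_triangle_ineq add_right_mono)
      then show ?thesis using close[of n] close[of m] mid by (simp add: dist_norm)
    qed
    then show "\<exists>N. \<forall>m\<ge>N. \<forall>n\<ge>N. dist (V (Suc m) t v) (V (Suc n) t v) < e" by blast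
  qed
  then show ?thesis unfolding T_def by (simp add: Cauchy_convergent_iff convergent_LIMSEQ_iff)
qed

lemma T_norm:
  assumes t: "t \<ge> 0" shows "norm (T t v) \<le> M * exp (- w * t) * norm v"
proof (rule LIMSEQ_le)
  show "(\<lambda>n. norm (V (Suc n) t v)) \<longlonglongrightarrow> norm (T t v)"
    by (intro tendsto_norm V_tendsto_T t)
  have "(\<lambda>n. (1 + (w * t) / real (Suc n)) ^ Suc n) \<longlonglongrightarrow> exp (w * t)"
    by (rule LIMSEQ_Suc[OF tendsto_exp_limit_sequentially])
  then have "(\<lambda>n. M / (1 + (w * t) / real (Suc n)) ^ Suc n * norm v) \<longlonglongrightarrow> M / exp (w * t) * norm v"
    by (intro tendsto_intros) auto
  then show "(\<lambda>n. M / (1 + (w * t) / real (Suc n)) ^ Suc n * norm v) \<longlonglongrightarrow> M * exp (- w * t) * norm v"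
    by (simp add: exp_minus divide_inverse)
  have "norm (V (Suc n) t v) \<le> M / (1 + (w * t) / real (Suc n)) ^ Suc n * norm v" for n
    using F_power_norm[of "t / real (Suc n)" "Suc n" v] t by (simp add: V_def mult.commute del: funpow.simps)
  then show "\<exists>N. \<forall>n\<ge>N. norm (V (Suc n) t v) \<le> M / (1 + (w * t) / real (Suc n)) ^ Suc n * norm v"
    by blast
qed

lemma T_norm_M: "t \<ge> 0 \<Longrightarrow> norm (T t v) \<le> M * norm v"
proof (rule order_trans[OF T_norm])
  assume "t \<ge> 0"
  then have "exp (- w * t) \<le> 1" using w by simp
  then have "M * exp (- w * t) \<le> M" using M by simp
  then show "M * exp (- w * t) * norm v \<le> M * norm v" by (rule mult_right_mono) simp
qed

lemma V_bounded_clinear: "t \<ge> 0 \<Longrightarrow> bounded_clinear (V n t)"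
  by (simp add: V_def F_power_bounded_clinear)

lemma T_bounded_clinear:
  assumes t: "t \<ge> 0" shows "bounded_clinear (T t)"
proof (rule bounded_clinearI)
  fix u v c
  have "(\<lambda>n. V (Suc n) t (u + v)) \<longlonglongrightarrow> T t u + T t v"
    using tendsto_add[OF V_tendsto_T[OF t] V_tendsto_T[OF t]] linear_add[OF V_linear[OF t]] by simp
  then show "T t (u + v) = T t u + T t v" using V_tendsto_T[OF t] LIMSEQ_unique by blast
  have "(\<lambda>n. V (Suc n) t (c *\<^sub>C u)) \<longlonglongrightarrow> c *\<^sub>C T t u"
    using bounded_linear.tendsto[OF bounded_linear_scaleC V_tendsto_T[OF t]] V_bounded_clinear[OF t]
    by (simp add: bounded_clinear_def)
  then show "T t (c *\<^sub>C u) = c *\<^sub>C T t u" using V_tendsto_T[OF t] LIMSEQ_unique by blast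
qed (rule T_norm_M[OF t])

lemma T_linear: "t \<ge> 0 \<Longrightarrow> linear (T t)"
  using T_bounded_clinear by (auto simp: bounded_clinear_def bounded_linear.linear)

lemma T_0 [simp]: "T 0 v = v"
proof -
  have "(F 0 ^^ k) v = v" for k by (induction k) auto
  then have "V (Suc n) 0 v = v" for n by (simp add: V_def del: funpow.simps)
  then show ?thesis by (simp add: T_def)
qed

lemma T_continuous: "continuous_on {0..} (\<lambda>t. T t v)"
proof (rule continuous_on_dense_extension[where M=M and D=Y])
  fix u assume u: "u \<in> Y"
  have "(M * norm (A u))-lipschitz_on {0..} (\<lambda>t. T t u)"
  proof (rule lipschitz_onI)
    fix s t :: real assume st: "s \<in> {0..}" "t \<in> {0..}"
    have "norm (V (Suc n) s u - V (Suc n) t u) \<le> M * norm (A u) * \<bar>s - t\<bar>" for n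
    proof (rule differentiable_bound_vector[OF _ V_derivative])
      fix r :: real assume "r \<in> {0..}"
      then show "norm (- (F (r / real (Suc n)) ^^ Suc (Suc n)) (A u)) \<le> M * norm (A u)"
        using F_power_norm_M[of "r / real (Suc n)"] by (simp del: funpow.simps)
    qed (use u st in auto)
    then have "norm (T s u - T t u) \<le> M * norm (A u) * \<bar>s - t\<bar>"
      by (intro LIMSEQ_le_const2[OF tendsto_norm[OF tendsto_diff[OF V_tendsto_T V_tendsto_T]]])
         (use st in auto)
    then show "dist (T s u) (T t u) \<le> M * norm (A u) * dist s t" by (simp add: dist_norm)
  qed (use M in simp)
  then show "continuous_on {0..} (\<lambda>t. T t u)" by (rule lipschitz_on_continuous_on)
qed (use T_linear T_norm_M dense in auto)

lemma T_F:
  assumes "s \<ge> 0" "t \<ge> 0" shows "F s (T t v) = T t (F s v)"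
proof -
  have "bounded_linear (F s)" using F_bounded_clinear assms by (simp add: bounded_clinear_def)
  from bounded_linear.tendsto[OF this V_tendsto_T[OF assms(2)]]
  have "(\<lambda>n. V (Suc n) t (F s v)) \<longlonglongrightarrow> F s (T t v)"
    using assms F_power_commute by (simp add: V_def del: funpow.simps)
  then show ?thesis using V_tendsto_T[OF assms(2)] LIMSEQ_unique by blast
qed

text \<open>Writing u = F_1 (u + A u) makes \<open>T t u\<close> a value of F_1, with which T
  commutes; membership in the domain and commutation with A then follow from the inverse laws
  instead of a limit inside A.\<close>

lemma T_A:
  assumes "t \<ge> 0" "u \<in> Y" shows "T t u \<in> Y" "A (T t u) = T t (A u)"
proof -
  have u: "F 1 (u + A u) = u" using F_left[of 1 u] assms by simp
  then have Tu: "T t u = F 1 (T t (u + A u))" using T_F[of 1 t "u + A u"] assms by simp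
  then show "T t u \<in> Y" using F_in[of 1] by simp
  have "T t u + A (T t u) = T t (u + A u)"
    using F_eq[of 1 "T t (u + A u)"] unfolding Tu[symmetric] by simp
  then show "A (T t u) = T t (A u)" using linear_add[OF T_linear[OF assms(1)]] by simp
qed

text \<open>The remainder bound holds for every Euler power with a constant free of n and survives
  the limit; so T gets differentiated without interchanging limit and derivative.\<close>

lemma T_taylor:
  assumes u: "u \<in> D2" and st: "s \<ge> 0" "t \<ge> 0"
  shows "norm (T t u - T s u + (t - s) *\<^sub>R T s (A u)) \<le> 2 * M * norm (A (A u)) * (t - s)\<^sup>2"
proof -
  have uY: "u \<in> Y" "A u \<in> Y" using u by (auto simp: D2_def)
  define B where "B = 2 * M * norm (A (A u))"
  have B: "B \<ge> 0" using M by (simp add: B_def)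
  have V: "norm (V (Suc n) t u - V (Suc n) s u - (t - s) *\<^sub>R - F (s / real (Suc n)) (V (Suc n) s (A u)))
      \<le> B * (t - s)\<^sup>2" for n
  proof -
    define f' where "f' r = - (F (r / real (Suc n)) ^^ Suc (Suc n)) (A u)" for r
    have "norm (f' x - f' s) \<le> B * \<bar>x - s\<bar>" if "x \<ge> 0" for x
    proof -
      have "norm ((F (x / real (Suc n)) ^^ Suc (Suc n)) (A u) - (F (s / real (Suc n)) ^^ Suc (Suc n)) (A u))
          \<le> B * \<bar>x - s\<bar>"
      proof (rule differentiable_bound_vector[OF _ F_power_rescaled_derivative])
        fix r :: real assume "r \<in> {0..}"
        then have "norm ((F (r / real (Suc n)) ^^ Suc (Suc (Suc n))) (A (A u))) \<le> M * norm (A (A u))"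
          by (intro F_power_norm_M) auto
        \<comment> \<open>Differentiating the power n + 2 at step r/(n + 1) produces the factor (n +
          2)/(n + 1); this is the 2 in \<open>B\<close>.\<close>
        moreover have "real (Suc (Suc n)) / real (Suc n) \<le> 2" by (simp add: field_simps)
        ultimately have "real (Suc (Suc n)) / real (Suc n)
            * norm ((F (r / real (Suc n)) ^^ Suc (Suc (Suc n))) (A (A u))) \<le> 2 * (M * norm (A (A u)))"
          by (intro mult_mono) auto
        then show "norm ((- real (Suc (Suc n)) / real (Suc n))
            *\<^sub>R (F (r / real (Suc n)) ^^ Suc (Suc (Suc n))) (A (A u))) \<le> B"
          by (simp add: B_def del: funpow.simps of_nat_Suc)
      qed (use that st uY in auto)
      then show ?thesis by (simp add: f'_def norm_minus_commute del: funpow.simps)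
    qed
    then have "norm (f' x - f' s) \<le> B * \<bar>t - s\<bar>" if "x \<in> closed_segment s t" for x
    proof -
      have "x \<ge> 0" "\<bar>x - s\<bar> \<le> \<bar>t - s\<bar>"
        using that st by (auto simp: closed_segment_eq_real_ivl split: if_splits)
      then show ?thesis
        using \<open>\<And>x. x \<ge> 0 \<Longrightarrow> norm (f' x - f' s) \<le> B * \<bar>x - s\<bar>\<close> mult_left_mono[OF _ B] order_trans by blast
    qed
    moreover have "((\<lambda>t. V (Suc n) t u) has_vector_derivative f' x) (at x within closed_segment s t)"
      if "x \<in> closed_segment s t" for x
      unfolding f'_def
      by (rule has_vector_derivative_within_subset[OF V_derivative])
         (use that st uY in \<open>auto simp: closed_segment_eq_real_ivl split: if_splits\<close>)
    ultimately have "norm (V (Suc n) t u - V (Suc n) s u - (t - s) *\<^sub>R f' s) \<le> norm (t - s) * (B * \<bar>t - s\<bar>)"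
      by (intro vector_differentiable_bound_linearization[where S="closed_segment s t"]) auto
    then show ?thesis by (simp add: f'_def V_def power2_eq_square mult_ac)
  qed
  have "(\<lambda>n. F (s / real (Suc n)) (V (Suc n) s (A u))) \<longlonglongrightarrow> T s (A u)"
    by (rule F_tendsto_0) (use st V_tendsto_T inverse_Suc_tendsto_0 in auto)
  then have "(\<lambda>n. norm (V (Suc n) t u - V (Suc n) s u - (t - s) *\<^sub>R - F (s / real (Suc n)) (V (Suc n) s (A u))))
      \<longlonglongrightarrow> norm (T t u - T s u - (t - s) *\<^sub>R - T s (A u))"
    by (intro tendsto_intros V_tendsto_T st)
  from LIMSEQ_le_const2[OF this] V show ?thesis by (auto simp: B_def)
qed

lemma T_derivative_D2:
  assumes u: "u \<in> D2" and s: "s \<ge> 0"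
  shows "((\<lambda>t. T t u) has_vector_derivative - T s (A u)) (at s within {0..})"
proof -
  define B where "B = 2 * M * norm (A (A u))"
  have "((\<lambda>t. (1 / (t - s)) *\<^sub>R (T t u - T s u) - - T s (A u)) \<longlongrightarrow> 0) (at s within {0..})"
  proof (rule Lim_null_comparison)
    have "((\<lambda>t. B * \<bar>t - s\<bar>) \<longlongrightarrow> B * \<bar>s - s\<bar>) (at s within {0..})"
      by (intro tendsto_intros)
    then show "((\<lambda>t. B * \<bar>t - s\<bar>) \<longlongrightarrow> 0) (at s within {0..})" by simp
    have "norm ((1 / (t - s)) *\<^sub>R (T t u - T s u) - - T s (A u)) \<le> B * \<bar>t - s\<bar>"
      if "t \<ge> 0" "t \<noteq> s" for t
    proof -
      have "(1 / (t - s)) *\<^sub>R (T t u - T s u) - - T s (A u)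
          = (1 / (t - s)) *\<^sub>R (T t u - T s u + (t - s) *\<^sub>R T s (A u))"
        using that by (simp add: scaleR_add_right)
      then have "norm ((1 / (t - s)) *\<^sub>R (T t u - T s u) - - T s (A u))
          = norm (T t u - T s u + (t - s) *\<^sub>R T s (A u)) / \<bar>t - s\<bar>" by simp
      also have "\<dots> \<le> B * (t - s)\<^sup>2 / \<bar>t - s\<bar>"
        using T_taylor[OF u s that(1)] by (intro divide_right_mono) (auto simp: B_def)
      also have "\<dots> = B * \<bar>t - s\<bar>"
        by (metis power2_abs power2_eq_square times_divide_eq_right nonzero_mult_div_cancel_right
            abs_eq_0 right_minus_eq that(2))
      finally show ?thesis .
    qed
    then show "\<forall>\<^sub>F t in at s within {0..}. norm ((1 / (t - s)) *\<^sub>R (T t u - T s u) - - T s (A u)) \<le> B * \<bar>t - s\<bar>"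
      by (auto simp: eventually_at_filter intro!: always_eventually)
  qed
  then show ?thesis unfolding has_vector_derivative_iff_quotient by (rule LIM_zero_cancel)
qed

lemma T_integrable: "0 \<le> s \<Longrightarrow> (\<lambda>r. T r v) integrable_on {s..t}"
  by (rule integrable_continuous_real) (rule continuous_on_subset[OF T_continuous], auto)

text \<open>In integrated form the equation on \<open>D2\<close> involves only \<open>q k\<close>
  and \<open>A (q k)\<close>, so it passes to the limit along a core sequence; differentiating back
  gives the equation on all of \<open>Y\<close>.\<close>

lemma T_integral:
  assumes u: "u \<in> Y" and t: "t \<ge> 0"
  shows "T t u = u - integral {0..t} (\<lambda>s. T s (A u))"
proof -
  let ?Iu = "integral {0..t} (\<lambda>s. T s (A u))"
  obtain q where q: "\<And>k. q k \<in> D2" "q \<longlonglongrightarrow> u" "(\<lambda>k. A (q k)) \<longlonglongrightarrow> A u"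
    using D2_core[OF u] by blast
  have eq: "T t (q k) = q k - integral {0..t} (\<lambda>s. T s (A (q k)))" for k
  proof -
    have "((\<lambda>s. - T s (A (q k))) has_integral T t (q k) - T 0 (q k)) {0..t}"
      by (rule fundamental_theorem_of_calculus[OF t])
         (rule has_vector_derivative_within_subset[OF T_derivative_D2], use q in auto)
    from integral_unique[OF has_integral_neg[OF this]] show ?thesis by simp
  qed
  have "(\<lambda>k. integral {0..t} (\<lambda>s. T s (A (q k))) - ?Iu) \<longlonglongrightarrow> 0"
  proof (rule Lim_null_comparison)
    show "(\<lambda>k. t * (M * norm (A (q k) - A u))) \<longlonglongrightarrow> 0"
      by (intro tendsto_mult_right_zero tendsto_norm_zero LIM_zero q)
    have "norm (integral {0..t} (\<lambda>s. T s (A (q k))) - ?Iu)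
        \<le> t * (M * norm (A (q k) - A u))" for k
    proof -
      have "integral {0..t} (\<lambda>s. T s (A (q k))) - ?Iu
          = integral {0..t} (\<lambda>s. T s (A (q k)) - T s (A u))"
        by (intro integral_diff[symmetric] T_integrable) auto
      also have "norm \<dots> \<le> integral {0..t} (\<lambda>s. M * norm (A (q k) - A u))"
      proof (rule integral_norm_bound_integral)
        fix x assume "x \<in> {0..t}"
        then show "norm (T x (A (q k)) - T x (A u)) \<le> M * norm (A (q k) - A u)"
          using T_norm_M[of x "A (q k) - A u"] linear_diff[OF T_linear[of x]] by simp
      qed (intro integrable_diff T_integrable integrable_const_ivl order_refl)+
      also have "\<dots> = t * (M * norm (A (q k) - A u))" using t by simp
      finally show ?thesis .
    qed
    then show "\<forall>\<^sub>F k in sequentially. norm (integral {0..t} (\<lambda>s. T s (A (q k)))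
        - ?Iu) \<le> t * (M * norm (A (q k) - A u))" by simp
  qed
  then have "(\<lambda>k. q k - integral {0..t} (\<lambda>s. T s (A (q k)))) \<longlonglongrightarrow> u - ?Iu"
    by (rule tendsto_diff[OF q(2) LIM_zero_cancel])
  moreover have "(\<lambda>k. T t (q k)) \<longlonglongrightarrow> T t u"
    using T_bounded_clinear[OF t] by (intro bounded_linear.tendsto[OF _ q(2)]) (simp add: bounded_clinear_def)
  ultimately show ?thesis unfolding eq using LIMSEQ_unique by blast
qed

lemma T_derivative:
  assumes u: "u \<in> Y" and s: "s \<ge> 0"
  shows "((\<lambda>t. T t u) has_vector_derivative - T s (A u)) (at s within {0..})"
proof -
  have "((\<lambda>t. integral {0..t} (\<lambda>s. T s (A u))) has_vector_derivative T s (A u)) (at s within {0..s + 1})"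
    using s by (intro integral_has_vector_derivative continuous_on_subset[OF T_continuous]) auto
  moreover have "at s within {0..s + 1} = at s within {0..}"
    by (rule at_within_nhd[of _ "{..<s + 1}"]) auto
  ultimately have "((\<lambda>t. u - integral {0..t} (\<lambda>s. T s (A u))) has_vector_derivative - T s (A u)) (at s within {0..})"
    by (auto intro!: derivative_eq_intros)
  then show ?thesis
    by (rule has_vector_derivative_transform[rotated 2]) (use T_integral u s in auto)
qed

text \<open>The two contributions to the derivative of \<open>T (t - s) (f s)\<close> in s cancel,
  so this function is constant, and its values at s = 0 and s = t are compared. Both the semigroup
  law and uniqueness rest on this.\<close>

lemma orbit_unique:
  assumes t: "t \<ge> 0" and f: "\<And>s. s \<in> {0..t} \<Longrightarrow> f s \<in> Y"
    and df: "\<And>s. s \<in> {0..t} \<Longrightarrow> (f has_vector_derivative - A (f s)) (at s within {0..t})"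
  shows "f t = T t (f 0)"
proof -
  have "((\<lambda>s. T (t - s) (f s)) has_vector_derivative 0) (at r within {0..t})" if r: "r \<in> {0..t}" for r
  proof -
    have 1: "((\<lambda>s. t - s) has_vector_derivative (- 1)) (at r within {0..t})"
      by (auto intro!: derivative_eq_intros simp: has_real_derivative_iff_has_vector_derivative[symmetric])
    have "((\<lambda>s. T s (f r)) has_vector_derivative - T (t - r) (A (f r)))
        (at (t - r) within (\<lambda>s. t - s) ` {0..t})"
      by (rule has_vector_derivative_within_subset[OF T_derivative]) (use r f in auto)
    from vector_diff_chain_within[OF 1 this]
    have "((\<lambda>s. T (t - s) (f r)) has_vector_derivative T (t - r) (A (f r))) (at r within {0..t})"
      by (simp add: o_def)
    moreover have "continuous_on {0..t} (\<lambda>s. T (t - s) (- A (f r)))"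
      by (rule continuous_on_compose2[OF T_continuous]) (auto intro!: continuous_intros)
    ultimately have "((\<lambda>s. T (t - s) (f s)) has_vector_derivative
        T (t - r) (A (f r)) + T (t - r) (- A (f r))) (at r within {0..t})"
      by (intro strong_product_rule[where M=M and L="\<lambda>s. T (t - s)" and f=f] df[OF r] r)
         (use T_linear T_norm_M in auto)
    then show ?thesis using linear_neg[OF T_linear[of "t - r"]] r by simp
  qed
  then obtain c where "\<And>s. s \<in> {0..t} \<Longrightarrow> T (t - s) (f s) = c"
    using has_vector_derivative_zero_constant[of "{0..t}" "\<lambda>s. T (t - s) (f s)"] by auto
  from this[of 0] this[of t] t show ?thesis by simp
qed

lemma T_semigroup:
  assumes s: "s \<ge> 0" and t: "t \<ge> 0" shows "T (s + t) v = T s (T t v)"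
proof -
  have *: "T (s + t) u = T s (T t u)" if u: "u \<in> Y" for u
  proof -
    have "T (s + t) u = T s (T (0 + t) u)"
    proof (rule orbit_unique[OF s, of "\<lambda>s. T (s + t) u"])
      fix r assume r: "r \<in> {0..s}"
      then show "T (r + t) u \<in> Y" using T_A u t by simp
      have 1: "((\<lambda>s. s + t) has_vector_derivative 1) (at r within {0..s})"
        by (auto intro!: derivative_eq_intros simp: has_real_derivative_iff_has_vector_derivative[symmetric])
      have "((\<lambda>s. T s u) has_vector_derivative - T (r + t) (A u)) (at (r + t) within (\<lambda>s. s + t) ` {0..s})"
        by (rule has_vector_derivative_within_subset[OF T_derivative]) (use r u t in auto)
      from vector_diff_chain_within[OF 1 this]
      show "((\<lambda>s. T (s + t) u) has_vector_derivative - A (T (r + t) u)) (at r within {0..s})"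
        using T_A u t r by (simp add: o_def)
    qed
    then show ?thesis by simp
  qed
  have "v \<in> closure Y" using dense by simp
  then obtain q where q: "\<And>k. q k \<in> Y" "q \<longlonglongrightarrow> v"
    by (auto simp: closure_sequential)
  have bl: "r \<ge> 0 \<Longrightarrow> bounded_linear (T r)" for r
    using T_bounded_clinear by (simp add: bounded_clinear_def)
  have "(\<lambda>k. T (s + t) (q k)) \<longlonglongrightarrow> T (s + t) v"
    by (rule bounded_linear.tendsto[OF bl q(2)]) (use s t in auto)
  moreover have "(\<lambda>k. T s (T t (q k))) \<longlonglongrightarrow> T s (T t v)"
    by (rule bounded_linear.tendsto[OF bl[OF s] bounded_linear.tendsto[OF bl[OF t] q(2)]])
  ultimately show ?thesis unfolding *[OF q(1)] by (rule LIMSEQ_unique)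
qed

lemma T_generated: "generated_by_minus Y A T"
proof -
  have "((\<lambda>t. T t u) \<longlongrightarrow> u) (at_right 0)" for u
  proof -
    have "((\<lambda>t. T t u) \<longlongrightarrow> T 0 u) (at 0 within {0..})"
      using T_continuous[of u] unfolding continuous_on_def by (rule bspec) simp
    then have "((\<lambda>t. T t u) \<longlongrightarrow> T 0 u) (at_right 0)"
      by (rule tendsto_within_subset) auto
    then show ?thesis by simp
  qed
  then have C0: "C0_semigroup T"
    unfolding C0_semigroup_def by (auto simp: T_bounded_clinear T_semigroup fun_eq_iff)
  have lim: "((\<lambda>t. (1 / t) *\<^sub>R (T t u - u)) \<longlongrightarrow> - A u) (at_right 0)" if "u \<in> Y" for u
  proof -
    have "((\<lambda>t. T t u) has_vector_derivative - T 0 (A u)) (at 0 within {0<..})"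
      by (rule has_vector_derivative_within_subset[OF T_derivative]) (use that in auto)
    then show ?thesis by (simp add: has_vector_derivative_iff_quotient)
  qed
  \<comment> \<open>F_1 moves the quotient into the domain: the limit becomes F_1 v = -A F_1 u, so u
    = F_1 u + A F_1 u = F_1 (u - v) lies in \<open>Y\<close>.\<close>
  have "u \<in> Y \<and> v = - A u" if uv: "((\<lambda>t. (1 / t) *\<^sub>R (T t u - u)) \<longlongrightarrow> v) (at_right 0)" for u v
  proof -
    have bl: "bounded_linear (F 1)" using F_bounded_clinear[of 1] by (simp add: bounded_clinear_def)
    have Y: "F 1 u \<in> Y" using F_in by simp
    have "((\<lambda>t. F 1 ((1 / t) *\<^sub>R (T t u - u))) \<longlongrightarrow> F 1 v) (at_right 0)"
      by (rule bounded_linear.tendsto[OF bl uv])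
    moreover have "\<forall>\<^sub>F t in at_right 0. F 1 ((1 / t) *\<^sub>R (T t u - u)) = (1 / t) *\<^sub>R (T t (F 1 u) - F 1 u)"
      by (auto simp: eventually_at_filter T_F linear_cmul[OF bounded_linear.linear[OF bl]]
          linear_diff[OF bounded_linear.linear[OF bl]] intro!: always_eventually)
    ultimately have "((\<lambda>t. (1 / t) *\<^sub>R (T t (F 1 u) - F 1 u)) \<longlongrightarrow> F 1 v) (at_right 0)"
      by (rule Lim_transform_eventually)
    then have "F 1 v = - A (F 1 u)"
      using lim[OF Y] tendsto_unique trivial_limit_at_right_real by blast
    then have u: "u = F 1 (u - v)"
      using F_eq[of 1 u] linear_diff[OF bounded_linear.linear[OF bl], of u v] by simp
    moreover have "F 1 (u - v) + A (F 1 (u - v)) = u - v" using F_eq[of 1 "u - v"] by simp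
    ultimately have "u + A u = u - v" by simp
    then show ?thesis using u F_in[of 1 "u - v"] by (simp add: algebra_simps eq_neg_iff_add_eq_0)
  qed
  with C0 lim show ?thesis unfolding generated_by_minus_def by blast
qed

end

section \<open>Uniqueness of the generated semigroup\<close>

lemma C0_semigroup_tendsto_0:
  assumes "C0_semigroup S"
  shows "((\<lambda>t. S t v) \<longlongrightarrow> v) (at 0 within {0..})" "S 0 v = v"
proof -
  have "at (0::real) within {0..} = at_right 0"
    by (rule at_within_Ici_at_right)
  then show "((\<lambda>t. S t v) \<longlongrightarrow> v) (at 0 within {0..})" "S 0 v = v"
    using assms by (auto simp: C0_semigroup_def)
qed

text \<open>Were the norms unbounded on every interval at 0, a null sequence of times would give
  pointwise bounded operators with unbounded norms, against uniform boundedness. The bound on a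
  first interval is then iterated by the semigroup law.\<close>

lemma C0_semigroup_locally_bounded:
  assumes S: "C0_semigroup S" and t: "t \<ge> 0"
  obtains K where "K \<ge> 1" "\<And>s v. s \<in> {0..t} \<Longrightarrow> norm (S s v) \<le> K * norm v"
proof -
  have bl: "s \<ge> 0 \<Longrightarrow> bounded_linear (S s)" for s
    using S by (simp add: C0_semigroup_def bounded_clinear_def)
  have "\<exists>n. \<forall>s\<in>{0..1 / real (Suc n)}. \<forall>v. norm (S s v) \<le> real n * norm v"
  proof (rule ccontr)
    assume "\<not> ?thesis"
    then have "\<forall>n. \<exists>s. s \<in> {0..1 / real (Suc n)} \<and> (\<exists>v. \<not> norm (S s v) \<le> real n * norm v)" by blast
    then obtain f where f: "\<And>n. f n \<in> {0..1 / real (Suc n)}"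
      "\<And>n. \<exists>v. \<not> norm (S (f n) v) \<le> real n * norm v" by metis
    have f0: "f \<longlonglongrightarrow> 0"
      by (rule real_tendsto_sandwich[OF _ _ tendsto_const LIMSEQ_Suc[OF lim_const_over_n[of 1]]])
         (use f(1) in auto)
    have "\<exists>C. \<forall>L\<in>range (\<lambda>n. S (f n)). norm (L v) \<le> C" for v
    proof -
      have "continuous (at 0 within {0..}) (\<lambda>t. S t v)"
        using C0_semigroup_tendsto_0[OF S] by (simp add: continuous_within)
      then have "(\<lambda>n. S (f n) v) \<longlonglongrightarrow> S 0 v"
        by (rule continuous_within_tendsto_compose) (use f(1) f0 in auto)
      then have "Bseq (\<lambda>n. S (f n) v)" by (rule convergentI[THEN convergent_imp_Bseq])
      then show ?thesis by (auto simp: Bseq_def)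
    qed
    then obtain K where K: "\<And>n v. norm (S (f n) v) \<le> K * norm v"
      using uniform_boundedness_principle[of "range (\<lambda>n. S (f n))"] bl f(1) by fastforce
    obtain n :: nat where "K \<le> real n" using real_arch_simple by blast
    then have "norm (S (f n) v) \<le> real n * norm v" for v
      using K[of n v] mult_right_mono[of K "real n" "norm v"] by simp
    with f(2) show False by blast
  qed
  then obtain n where n: "\<And>s v. s \<in> {0..1 / real (Suc n)} \<Longrightarrow> norm (S s v) \<le> real n * norm v" by blast
  \<comment> \<open>\<open>C \<ge> 1\<close> makes the powers of \<open>C\<close> increase, so a
    single power serves all times up to t.\<close>
  define \<delta> C where "\<delta> = 1 / real (Suc n)" and "C = max 1 (real n)"
  have \<delta>: "\<delta> > 0" and C: "C \<ge> 1" by (auto simp: \<delta>_def C_def)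
  have base: "norm (S s v) \<le> C * norm v" if "s \<in> {0..\<delta>}" for s v
    using n[of s v] that mult_right_mono[of "real n" C "norm v"] by (simp add: \<delta>_def C_def)
  have step: "norm (S s v) \<le> C ^ Suc k * norm v" if "s \<ge> 0" "s \<le> real k * \<delta>" for s v k
    using that
  proof (induction k arbitrary: s v)
    case 0
    then show ?case using base[of s v] \<delta> by simp
  next
    case (Suc k)
    show ?case
    proof (cases "s \<le> \<delta>")
      case True
      have "C \<le> C ^ Suc (Suc k)" using C by (intro self_le_power) auto
      then show ?thesis
        using base[of s v] True Suc(2) mult_right_mono[of C "C ^ Suc (Suc k)" "norm v"] by simp
    next
      case False
      then have s: "s - \<delta> \<ge> 0" "s - \<delta> \<le> real k * \<delta>" using Suc.prems by (auto simp: algebra_simps)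
      have "S (\<delta> + (s - \<delta>)) = S \<delta> \<circ> S (s - \<delta>)"
        using S \<delta> s(1) by (simp only: C0_semigroup_def less_imp_le)
      then have "norm (S s v) = norm (S \<delta> (S (s - \<delta>) v))" by simp
      also have "\<dots> \<le> C * norm (S (s - \<delta>) v)" using base \<delta> by simp
      also have "\<dots> \<le> C * (C ^ Suc k * norm v)" using Suc.IH[OF s] C by (intro mult_left_mono) auto
      finally show ?thesis by (simp add: mult_ac)
    qed
  qed
  obtain k :: nat where "t / \<delta> \<le> real k" using real_arch_simple by blast
  then have k: "t \<le> real k * \<delta>" using \<delta> by (simp add: field_simps)
  show ?thesis
    by (rule that[of "C ^ Suc k"]) (use step k C in \<open>auto intro: one_le_power simp del: power_Suc\<close>)
qed

lemma generated_orbit: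
  assumes S: "generated_by_minus Y A S" and u: "u \<in> Y" and r: "r \<ge> 0"
  shows "S r u \<in> Y" "A (S r u) = S r (A u)"
proof -
  have C0: "C0_semigroup S"
    and gen: "((\<lambda>t. (1 / t) *\<^sub>R (S t u - u)) \<longlongrightarrow> v) (at_right 0) \<longleftrightarrow> u \<in> Y \<and> v = - A u" for u v
    using S by (auto simp: generated_by_minus_def)
  have bl: "bounded_linear (S r)" and add: "\<And>s t. s \<ge> 0 \<Longrightarrow> t \<ge> 0 \<Longrightarrow> S (s + t) = S s \<circ> S t"
    using C0 r by (auto simp: C0_semigroup_def bounded_clinear_def)
  note l = bounded_linear.linear[OF bl]
  have "((\<lambda>t. (1 / t) *\<^sub>R (S t u - u)) \<longlongrightarrow> - A u) (at_right 0)" using gen u by blast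
  then have "((\<lambda>t. S r ((1 / t) *\<^sub>R (S t u - u))) \<longlongrightarrow> S r (- A u)) (at_right 0)"
    by (rule bounded_linear.tendsto[OF bl])
  moreover have "S r ((1 / t) *\<^sub>R (S t u - u)) = (1 / t) *\<^sub>R (S t (S r u) - S r u)" if "t > 0" for t
    using add[of r t] add[of t r] that r
    by (simp add: linear_cmul[OF l] linear_diff[OF l] add.commute fun_eq_iff)
  then have "\<forall>\<^sub>F t in at_right 0. S r ((1 / t) *\<^sub>R (S t u - u)) = (1 / t) *\<^sub>R (S t (S r u) - S r u)"
    by (auto simp: eventually_at_filter intro!: always_eventually)
  ultimately have "((\<lambda>t. (1 / t) *\<^sub>R (S t (S r u) - S r u)) \<longlongrightarrow> S r (- A u)) (at_right 0)"
    by (rule Lim_transform_eventually)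
  then show "S r u \<in> Y" "A (S r u) = S r (A u)"
    using gen linear_neg[OF l] by (auto simp: neg_eq_iff_add_eq_0 eq_neg_iff_add_eq_0)
qed

text \<open>The generator is a right derivative at 0 only. Factoring out the earlier of two times
  (\<open>split\<close>) turns right and left quotients at r into the quotient at 0 with step |s -
  r|, at the cost of the locally bounded operator \<open>S (min s r)\<close>.\<close>

lemma generated_derivative:
  assumes S: "generated_by_minus Y A S" and u: "u \<in> Y" and r: "r \<in> {0..t}"
  shows "((\<lambda>s. S s u) has_vector_derivative - A (S r u)) (at r within {0..t})"
proof -
  have C0: "C0_semigroup S" and gen: "((\<lambda>t. (1 / t) *\<^sub>R (S t u - u)) \<longlongrightarrow> - A u) (at_right 0)"
    using S u by (auto simp: generated_by_minus_def)
  have l: "s \<ge> 0 \<Longrightarrow> linear (S s)"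
    and add: "\<And>s t. s \<ge> 0 \<Longrightarrow> t \<ge> 0 \<Longrightarrow> S (s + t) = S s \<circ> S t" for s
    using C0 by (auto simp: C0_semigroup_def bounded_clinear_def bounded_linear.linear)
  have "t \<ge> 0" using r by simp
  then obtain K where K: "K \<ge> 1" "\<And>s v. s \<in> {0..t} \<Longrightarrow> norm (S s v) \<le> K * norm v"
    using C0_semigroup_locally_bounded[OF C0] by metis
  have split: "S s v - S p v = sgn (s - p) *\<^sub>R S (min s p) (S \<bar>s - p\<bar> v - v)"
    if "s \<ge> 0" "p \<ge> 0" for s p v
  proof (cases "s \<le> p")
    case True
    then have "S p v = S s (S (p - s) v)" using add[of s "p - s"] that by simp
    then show ?thesis using True that by (cases "s = p") (auto simp: linear_diff[OF l])
  next
    case False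
    then have "S s v = S p (S (s - p) v)" using add[of p "s - p"] that by simp
    then show ?thesis using False that by (auto simp: linear_diff[OF l])
  qed
  have abs: "filterlim (\<lambda>s. \<bar>s - r\<bar>) (at_right 0) (at r within {0..t})"
    unfolding filterlim_at
    by (auto intro!: tendsto_eq_intros always_eventually simp: eventually_at_filter)
  have ev: "\<forall>\<^sub>F s in at r within {0..t}. s \<in> {0..t} \<and> s \<noteq> r"
    by (auto simp: eventually_at_filter intro!: always_eventually)
  have "((\<lambda>s. S s v - S r v) \<longlongrightarrow> 0) (at r within {0..t})" for v
  proof (rule Lim_null_comparison)
    have "((\<lambda>t. S t v) \<longlongrightarrow> v) (at_right 0)" using C0 by (simp add: C0_semigroup_def)
    from filterlim_compose[OF this abs]
    show "((\<lambda>s. K * norm (S \<bar>s - r\<bar> v - v)) \<longlongrightarrow> 0) (at r within {0..t})"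
      by (intro tendsto_mult_right_zero tendsto_norm_zero LIM_zero)
    show "\<forall>\<^sub>F s in at r within {0..t}. norm (S s v - S r v) \<le> K * norm (S \<bar>s - r\<bar> v - v)"
      using ev by eventually_elim (use r K in \<open>auto simp: split abs_sgn_eq\<close>)
  qed
  note cont = this
  have "((\<lambda>s. (1 / (s - r)) *\<^sub>R (S s u - S r u) + S (min s r) (A u)) \<longlongrightarrow> 0) (at r within {0..t})"
  proof (rule Lim_null_comparison)
    from filterlim_compose[OF gen abs]
    show "((\<lambda>s. K * norm ((1 / \<bar>s - r\<bar>) *\<^sub>R (S \<bar>s - r\<bar> u - u) - - A u)) \<longlongrightarrow> 0) (at r within {0..t})"
      by (intro tendsto_mult_right_zero tendsto_norm_zero LIM_zero)
    show "\<forall>\<^sub>F s in at r within {0..t}. norm ((1 / (s - r)) *\<^sub>R (S s u - S r u) + S (min s r) (A u))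
        \<le> K * norm ((1 / \<bar>s - r\<bar>) *\<^sub>R (S \<bar>s - r\<bar> u - u) - - A u)"
      using ev
    proof eventually_elim
      case (elim s)
      have lm: "linear (S (min s r))" using elim r by (intro l) auto
      have "(1 / (s - r)) *\<^sub>R (S s u - S r u) + S (min s r) (A u)
          = S (min s r) ((1 / \<bar>s - r\<bar>) *\<^sub>R (S \<bar>s - r\<bar> u - u) - - A u)"
      proof -
        have "1 / (s - r) * sgn (s - r) = 1 / \<bar>s - r\<bar>" using elim by (auto simp: sgn_if abs_if field_simps)
        then have "(1 / (s - r)) *\<^sub>R (S s u - S r u) = (1 / \<bar>s - r\<bar>) *\<^sub>R S (min s r) (S \<bar>s - r\<bar> u - u)"
          using elim r split[of s r u] by simp
        then show ?thesis by (simp only: linear_cmul[OF lm] linear_add[OF lm] diff_minus_eq_add)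
      qed
      moreover have "min s r \<in> {0..t}" using elim r by auto
      ultimately show ?case using K(2) by presburger
    qed
  qed
  \<comment> \<open>The moving time \<open>min s r\<close> is replaced by r, by strong
    continuity.\<close>
  moreover have "((\<lambda>s. S (min s r) (A u) - S r (A u)) \<longlongrightarrow> 0) (at r within {0..t})"
  proof (rule Lim_null_comparison)
    show "((\<lambda>s. norm (S s (A u) - S r (A u))) \<longlongrightarrow> 0) (at r within {0..t})"
      by (intro tendsto_norm_zero cont)
  qed (auto simp: min_def intro!: always_eventually)
  ultimately have "((\<lambda>s. ((1 / (s - r)) *\<^sub>R (S s u - S r u) + S (min s r) (A u))
      - (S (min s r) (A u) - S r (A u))) \<longlongrightarrow> 0 - 0) (at r within {0..t})"
    by (rule tendsto_diff)
  then have "((\<lambda>s. (1 / (s - r)) *\<^sub>R (S s u - S r u) - - S r (A u)) \<longlongrightarrow> 0) (at r within {0..t})"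
    by simp
  then have "((\<lambda>s. (1 / (s - r)) *\<^sub>R (S s u - S r u)) \<longlongrightarrow> - S r (A u)) (at r within {0..t})"
    by (rule LIM_zero_cancel)
  moreover have "A (S r u) = S r (A u)" using generated_orbit[OF S u] r by simp
  ultimately show ?thesis unfolding has_vector_derivative_iff_quotient by simp
qed

context hille_yosida
begin

lemma generated_eq_T:
  assumes S: "generated_by_minus Y A S" and t: "t \<ge> 0"
  shows "S t v = T t v"
proof -
  have C0: "C0_semigroup S" using S by (simp add: generated_by_minus_def)
  then have bl: "bounded_linear (S t)" "bounded_linear (T t)"
    using t T_bounded_clinear[OF t] by (auto simp: C0_semigroup_def bounded_clinear_def)
  have eq: "S t u = T t u" if "u \<in> Y" for u
  proof -
    have "S t u = T t (S 0 u)"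
      by (rule orbit_unique[OF t, where f="\<lambda>s. S s u"])
         (use generated_orbit[OF S that] generated_derivative[OF S that] in auto)
    then show ?thesis using C0_semigroup_tendsto_0(2)[OF C0] by simp
  qed
  have "v \<in> closure Y" using dense by simp
  then obtain q where q: "\<And>k. q k \<in> Y" "q \<longlonglongrightarrow> v"
    by (auto simp: closure_sequential)
  have "(\<lambda>k. S t (q k)) \<longlonglongrightarrow> S t v" "(\<lambda>k. T t (q k)) \<longlonglongrightarrow> T t v"
    by (rule bounded_linear.tendsto[OF bl(1) q(2)] bounded_linear.tendsto[OF bl(2) q(2)])+
  then show ?thesis unfolding eq[OF q(1)] by (rule LIMSEQ_unique)
qed

lemma semigroup_of_eq: "t \<ge> 0 \<Longrightarrow> semigroup_of Y A t = T t"
  unfolding semigroup_of_def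
  using generated_eq_T[OF someI[of "generated_by_minus Y A", OF T_generated]] by (simp add: fun_eq_iff)

lemma exp_minus_eq: "t \<ge> 0 \<Longrightarrow> exp_minus Y A t = T t"
  by (simp add: exp_minus_def semigroup_of_eq)

end

subsection \<open>Vector-valued gauge integrals\<close>

text \<open>A pointwise deviation of at most e times \<open>w\<close> changes a Riemann sum by at
  most e times that of \<open>w\<close>, and fine sums of \<open>w\<close> are bounded; so the
  Cauchy criterion passes from the approximants to \<open>f\<close>.\<close>

lemma integrable_on_cbox_approx:
  fixes f :: "'n::euclidean_space \<Rightarrow> 'b::banach"
  assumes w: "w integrable_on cbox a b"
    and approx: "\<And>e::real. e > 0 \<Longrightarrow> \<exists>g. g integrable_on cbox a b \<and> (\<forall>x\<in>cbox a b. norm (f x - g x) \<le> e * w x)"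
  shows "f integrable_on cbox a b"
  unfolding integrable_Cauchy
proof (intro allI impI)
  fix e :: real assume e: "e > 0"
  \<comment> \<open>Every Riemann sum of \<open>w\<close> that is fine for \<open>\<gamma>1\<close>
    stays below \<open>W\<close>; with \<open>\<eta>\<close> chosen as below the deviation is at
    most e/3.\<close>
  define W where "W = \<bar>integral (cbox a b) w\<bar> + 1"
  have W: "W > 0" by (simp add: W_def)
  define \<eta> where "\<eta> = e / (3 * W)"
  have \<eta>: "\<eta> > 0" using e W by (simp add: \<eta>_def)
  obtain g where g: "g integrable_on cbox a b" "\<And>x. x \<in> cbox a b \<Longrightarrow> norm (f x - g x) \<le> \<eta> * w x"
    using approx[OF \<eta>] by blast
  obtain \<gamma>1 where \<gamma>1: "gauge \<gamma>1"
    "\<And>D. D tagged_division_of cbox a b \<Longrightarrow> \<gamma>1 fine D \<Longrightarrow>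
       norm ((\<Sum>(x,K)\<in>D. measure lborel K *\<^sub>R w x) - integral (cbox a b) w) < 1"
    using has_integralD[OF integrable_integral[OF w] zero_less_one] by metis
  have "e / 3 > 0" using e by simp
  then obtain \<gamma>2 where \<gamma>2: "gauge \<gamma>2"
    "\<And>D1 D2. D1 tagged_division_of cbox a b \<Longrightarrow> \<gamma>2 fine D1 \<Longrightarrow>
        D2 tagged_division_of cbox a b \<Longrightarrow> \<gamma>2 fine D2 \<Longrightarrow>
        norm ((\<Sum>(x,K)\<in>D1. measure lborel K *\<^sub>R g x) - (\<Sum>(x,K)\<in>D2. measure lborel K *\<^sub>R g x)) < e / 3"
    using g(1) unfolding integrable_Cauchy by metis
  have close: "norm ((\<Sum>(x,K)\<in>D. measure lborel K *\<^sub>R f x) - (\<Sum>(x,K)\<in>D. measure lborel K *\<^sub>R g x)) \<le> e / 3"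
    if D: "D tagged_division_of cbox a b" "\<gamma>1 fine D" for D
  proof -
    have "(\<Sum>(x,K)\<in>D. measure lborel K *\<^sub>R f x) - (\<Sum>(x,K)\<in>D. measure lborel K *\<^sub>R g x)
        = (\<Sum>(x,K)\<in>D. measure lborel K *\<^sub>R (f x - g x))"
      by (simp add: sum_subtractf[symmetric] case_prod_unfold scaleR_diff_right)
    also have "norm \<dots> \<le> (\<Sum>(x,K)\<in>D. measure lborel K *\<^sub>R (\<eta> * w x))"
      unfolding case_prod_unfold
    proof (rule sum_norm_le)
      fix z assume "z \<in> D"
      then have "fst z \<in> cbox a b" using D(1) by (cases z) (auto dest: tag_in_interval)
      then show "norm (measure lborel (snd z) *\<^sub>R (f (fst z) - g (fst z))) \<le> measure lborel (snd z) *\<^sub>R (\<eta> * w (fst z))"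
        using g(2) by (simp add: mult_left_mono)
    qed
    also have "\<dots> = \<eta> * (\<Sum>(x,K)\<in>D. measure lborel K *\<^sub>R w x)"
      by (simp add: sum_distrib_left case_prod_unfold mult_ac)
    also have "\<dots> \<le> \<eta> * W"
      using \<gamma>1(2)[OF D] \<eta> by (intro mult_left_mono) (auto simp: W_def)
    finally show ?thesis using W by (simp add: \<eta>_def)
  qed
  show "\<exists>\<gamma>. gauge \<gamma> \<and> (\<forall>D1 D2. D1 tagged_division_of cbox a b \<and> \<gamma> fine D1 \<and>
      D2 tagged_division_of cbox a b \<and> \<gamma> fine D2 \<longrightarrow>
      norm ((\<Sum>(x,K)\<in>D1. measure lborel K *\<^sub>R f x) - (\<Sum>(x,K)\<in>D2. measure lborel K *\<^sub>R f x)) < e)"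
  proof (intro exI[of _ "\<lambda>x. \<gamma>1 x \<inter> \<gamma>2 x"] conjI allI impI)
    fix D1 D2
    assume "D1 tagged_division_of cbox a b \<and> (\<lambda>x. \<gamma>1 x \<inter> \<gamma>2 x) fine D1 \<and>
      D2 tagged_division_of cbox a b \<and> (\<lambda>x. \<gamma>1 x \<inter> \<gamma>2 x) fine D2"
    then have D: "D1 tagged_division_of cbox a b" "\<gamma>1 fine D1" "\<gamma>2 fine D1"
      "D2 tagged_division_of cbox a b" "\<gamma>1 fine D2" "\<gamma>2 fine D2"
      by (auto simp: fine_Int)
    show "norm ((\<Sum>(x,K)\<in>D1. measure lborel K *\<^sub>R f x) - (\<Sum>(x,K)\<in>D2. measure lborel K *\<^sub>R f x)) < e"
      using close[OF D(1,2)] close[OF D(4,5)] \<gamma>2(2)[OF D(1,3,4,6)] by norm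
  qed (use \<gamma>1 \<gamma>2 in \<open>auto intro: gauge_Int\<close>)
qed

lemma integrable_on_approx:
  fixes f :: "'n::euclidean_space \<Rightarrow> 'b::banach"
  assumes w: "w integrable_on S" and bound: "\<And>x. x \<in> S \<Longrightarrow> norm (f x) \<le> C * w x"
    and approx: "\<And>e::real. e > 0 \<Longrightarrow> \<exists>g. g integrable_on S \<and> (\<forall>x\<in>S. norm (f x - g x) \<le> e * w x)"
  shows "f integrable_on S"
proof (rule integrable_on_all_intervals_integrable_bound[OF _ bound integrable_on_mult_right[OF w]])
  let ?r = "\<lambda>f x. if x \<in> S then f x else 0"
  show "?r f integrable_on cbox a b" for a b
  proof (rule integrable_on_cbox_approx)
    show "?r w integrable_on cbox a b" by (rule integrable_altD(1)[OF w])
    fix e :: real assume "e > 0"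
    then obtain g where "g integrable_on S" "\<forall>x\<in>S. norm (f x - g x) \<le> e * w x" using approx by blast
    then show "\<exists>g. g integrable_on cbox a b \<and> (\<forall>x\<in>cbox a b. norm (?r f x - g x) \<le> e * ?r w x)"
      by (intro exI[of _ "?r g"]) (auto intro: integrable_altD(1))
  qed
qed

lemma scaleC_zero_right [simp]: "c *\<^sub>C 0 = 0"
  by (rule linear_0[OF bounded_linear.linear[OF bounded_linear_scaleC]])

text \<open>The values of \<open>E\<close> need not lie in a second-countable space, so Bochner integrability is not available;
  instead \<open>exp (c t) E t\<close> is approximated uniformly by step functions of \<open>t\<close>.\<close>

lemma kernel_integrable:
  fixes E :: "real \<Rightarrow> 'a::complex_banach" and k :: "real \<Rightarrow> complex" and g :: "real \<Rightarrow> real"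
  assumes E: "continuous_on {0..} E" "\<And>t. t \<ge> 0 \<Longrightarrow> norm (E t) \<le> C * exp (- c' * t)" "c < c'"
    and g: "\<And>x. x \<in> S \<Longrightarrow> g x \<ge> 0"
    and k: "\<And>r. (\<lambda>x. if g x < r then k x * of_real (exp (- c * g x)) else 0) integrable_on S"
    and k_abs: "(\<lambda>x. cmod (k x) * exp (- c * g x)) integrable_on S"
  shows "(\<lambda>x. k x *\<^sub>C E (g x)) integrable_on S"
proof (rule integrable_on_approx[OF k_abs])
  show "norm (k x *\<^sub>C E (g x)) \<le> \<bar>C\<bar> * (cmod (k x) * exp (- c * g x))" if "x \<in> S" for x
  proof -
    have "exp (- c' * g x) \<le> exp (- c * g x)" using E(3) g[OF that] by (simp add: mult_right_mono)
    then have "norm (E (g x)) \<le> \<bar>C\<bar> * exp (- c * g x)"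
      by (intro order_trans[OF E(2)[OF g[OF that]] mult_mono]) auto
    from mult_left_mono[OF this norm_ge_zero[of "k x"]] show ?thesis by (simp add: norm_scaleC mult_ac)
  qed
  fix e :: real assume e: "e > 0"
  \<comment> \<open>The gap c < c' makes \<open>H\<close> vanish at infinity, so finitely many steps
    on \<open>{0..R}\<close> and the value 0 beyond approximate it uniformly.\<close>
  define H where "H t = exp (c * t) *\<^sub>R E t" for t
  have H: "continuous_on {0..} H" unfolding H_def by (intro continuous_intros E)
  have "((\<lambda>t. exp (- (c' - c) * t)) \<longlongrightarrow> 0) at_top"
    by (rule filterlim_compose[OF exp_at_bot filterlim_tendsto_neg_mult_at_bot[OF tendsto_const _ filterlim_ident]])
       (use E(3) in simp)
  then have "((\<lambda>t. C * exp (- (c' - c) * t)) \<longlongrightarrow> 0) at_top"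
    by (rule tendsto_mult_right_zero)
  then have "\<forall>\<^sub>F t in at_top. C * exp (- (c' - c) * t) < e"
    using e order_tendstoD(2) by fastforce
  then obtain R0 where R0: "\<And>t. t \<ge> R0 \<Longrightarrow> C * exp (- (c' - c) * t) < e"
    by (auto simp: eventually_at_top_linorder)
  define R where "R = max R0 1"
  have R: "R > 0" by (simp add: R_def)
  have tail: "norm (H t) \<le> e" if "t \<ge> R" for t
  proof -
    have "norm (H t) \<le> exp (c * t) * (C * exp (- c' * t))"
      using E(2)[of t] that R by (simp add: H_def)
    also have "\<dots> = C * exp (- (c' - c) * t)" by (simp add: exp_add[symmetric] algebra_simps)
    finally show ?thesis using R0[of t] that by (simp add: R_def)
  qed
  have "uniformly_continuous_on {0..R} H"
    by (rule compact_uniformly_continuous[OF continuous_on_subset[OF H]]) auto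
  then obtain \<delta> where \<delta>: "\<delta> > 0" "\<And>t t'. t \<in> {0..R} \<Longrightarrow> t' \<in> {0..R} \<Longrightarrow> dist t' t < \<delta> \<Longrightarrow> dist (H t') (H t) < e"
    using e unfolding uniformly_continuous_on_def by metis
  obtain N :: nat where N: "R / \<delta> < real N" using reals_Archimedean2 by blast
  then have N0: "N > 0" using R \<delta>(1) by (metis divide_pos_pos of_nat_0_less_iff order_less_trans)
  define d where "d = R / real N"
  have d: "d > 0" "d < \<delta>" "real N * d = R" using N N0 R \<delta>(1) by (auto simp: d_def field_simps)
  define \<kappa> where "\<kappa> x = k x * of_real (exp (- c * g x))" for x
  \<comment> \<open>The cell j d \<le> g x < (j + 1) d enters as a difference of two sublevel sets
    of g, since only the truncations to sublevel sets are known to be integrable.\<close>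
  define G where "G x = (\<Sum>j<N. (if g x < real (Suc j) * d then \<kappa> x else 0) *\<^sub>C H (real j * d)
      - (if g x < real j * d then \<kappa> x else 0) *\<^sub>C H (real j * d))" for x
  have "(\<lambda>x. (if g x < r then \<kappa> x else 0) *\<^sub>C v) integrable_on S" for r v
  proof -
    have "bounded_linear (\<lambda>z. z *\<^sub>C v)"
    proof
      show "\<exists>K. \<forall>z. norm (z *\<^sub>C v) \<le> norm z * K" by (intro exI[of _ "norm v"]) (simp add: norm_scaleC)
    qed (simp_all add: scaleC_add_left scaleR_scaleC scaleC_scaleC scaleC_complex_def)
    from integrable_linear[OF k[of r, folded \<kappa>_def] this] show ?thesis by (simp add: o_def)
  qed
  then have "G integrable_on S" unfolding G_def by (intro integrable_sum integrable_diff) auto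
  moreover have "norm (k x *\<^sub>C E (g x) - G x) \<le> e * (cmod (k x) * exp (- c * g x))" if x: "x \<in> S" for x
  proof -
    have "exp (- c * g x) * exp (c * g x) = 1" by (simp flip: exp_add)
    then have kE: "k x *\<^sub>C E (g x) = \<kappa> x *\<^sub>C H (g x)"
      by (simp add: \<kappa>_def H_def scaleR_scaleC scaleC_scaleC mult.assoc flip: of_real_mult)
    define j0 where "j0 = nat \<lfloor>g x / d\<rfloor>"
    have "g x / d \<ge> 0" using g[OF x] d by simp
    then have "real j0 \<le> g x / d" "g x / d < real j0 + 1" unfolding j0_def by linarith+
    then have j0: "real j0 * d \<le> g x" "g x < real (Suc j0) * d" using d(1) by (auto simp: field_simps)
    have le_iff: "g x < real j * d \<longleftrightarrow> j0 < j" for j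
    proof
      assume "g x < real j * d"
      then have "real j0 * d < real j * d" using j0(1) by simp
      then show "j0 < j" using d(1) by simp
    next
      assume "j0 < j"
      then have "real (Suc j0) * d \<le> real j * d" using d(1) by (intro mult_right_mono) auto
      then show "g x < real j * d" using j0(2) by simp
    qed
    have "G x = (\<Sum>j<N. if j0 = j then \<kappa> x *\<^sub>C H (real j * d) else 0)"
      unfolding G_def le_iff by (intro sum.cong) (auto simp: less_Suc_eq)
    also have "\<dots> = (if j0 < N then \<kappa> x *\<^sub>C H (real j0 * d) else 0)" by simp
    finally have G: "G x = \<dots>" .
    have "norm (H (g x) - (if j0 < N then H (real j0 * d) else 0)) \<le> e"
    proof (cases "j0 < N")
      case True
      then have "g x < R" using le_iff[of N] d(3) by simp
      moreover have "dist (g x) (real j0 * d) < \<delta>" using j0 d(2) by (simp add: dist_real_def algebra_simps)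
      ultimately show ?thesis
        using \<delta>(2)[of "real j0 * d" "g x"] j0(1) d(1) g[OF x] True by (simp add: dist_norm)
    next
      case False
      then show ?thesis using tail[of "g x"] le_iff[of N] d(3) by simp
    qed
    then have "cmod (\<kappa> x) * norm (H (g x) - (if j0 < N then H (real j0 * d) else 0)) \<le> cmod (\<kappa> x) * e"
      by (rule mult_left_mono) simp
    moreover have "k x *\<^sub>C E (g x) - G x = \<kappa> x *\<^sub>C (H (g x) - (if j0 < N then H (real j0 * d) else 0))"
      unfolding kE G by (simp add: linear_diff[OF bounded_linear.linear[OF bounded_linear_scaleC]])
    ultimately show ?thesis by (simp add: norm_scaleC \<kappa>_def norm_mult mult_ac)
  qed
  ultimately show "\<exists>G. G integrable_on S \<and>
      (\<forall>x\<in>S. norm (k x *\<^sub>C E (g x) - G x) \<le> e * (cmod (k x) * exp (- c * g x)))" by blast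
qed

lemma powr_exp_absolutely_integrable:
  fixes p c :: real
  assumes "p > 0" "c > 0"
  shows "(\<lambda>t. t powr (p - 1) * exp (- c * t)) absolutely_integrable_on {0<..}"
proof -
  have "(\<lambda>t. norm (complex_of_real t powr (of_real p - 1) / of_real (exp (c * t)))) absolutely_integrable_on {0<..}"
    using absolutely_integrable_Gamma_integral[of "of_real p" c] assms by (intro set_integrable_norm) auto
  then show ?thesis
    by (rule absolutely_integrable_spike[OF _ negligible_empty])
       (auto simp: norm_mult norm_inverse norm_powr_real_powr exp_minus divide_inverse)
qed

lemma has_integral_Ioi_iff_Ici:
  fixes f :: "real \<Rightarrow> 'b::banach"
  shows "(f has_integral i) {a<..} \<longleftrightarrow> (f has_integral i) {a..}"
proof (rule has_integral_spike_set_eq)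
  have "{x \<in> {a..} - {a<..}. f x \<noteq> 0} \<subseteq> {a}" by auto
  then show "negligible {x \<in> {a..} - {a<..}. f x \<noteq> 0}"
    using negligible_subset negligible_sing by blast
  have "{x \<in> {a<..} - {a..}. f x \<noteq> 0} = {}" by auto
  then show "negligible {x \<in> {a<..} - {a..}. f x \<noteq> 0}" by (simp only: negligible_empty)
qed

lemma powr_kernel_integrable:
  fixes E :: "real \<Rightarrow> 'a::complex_banach"
  assumes E: "continuous_on {0..} E" "\<And>t. t \<ge> 0 \<Longrightarrow> norm (E t) \<le> C * exp (- c * t)"
    and p: "p > 0" "c > 0"
  shows "(\<lambda>t. t powr (p - 1) *\<^sub>R E t) integrable_on {0<..}"
proof -
  have ai: "(\<lambda>t. t powr (p - 1) * exp (- (c / 2) * t)) absolutely_integrable_on {0<..}"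
    using p by (intro powr_exp_absolutely_integrable) auto
  have "(\<lambda>t. of_real (t powr (p - 1)) *\<^sub>C E t) integrable_on {0<..}"
  \<comment> \<open>Half of the decay rate is kept in reserve: the kernel lemma wants a strict gap
    between its two rates.\<close>
  proof (rule kernel_integrable[where c="c / 2" and g="\<lambda>t. t", OF E])
    show "(\<lambda>t. if t < r then complex_of_real (t powr (p - 1)) * of_real (exp (- (c / 2) * t)) else 0)
        integrable_on {0<..}" for r
    proof -
      have "(\<lambda>t. t powr (p - 1) * exp (- (c / 2) * t)) integrable_on {..<r} \<inter> {0<..}"
        by (rule set_lebesgue_integral_eq_integral(1)[OF set_integrable_subset[OF ai]]) auto
      then have "(\<lambda>t. if t \<in> {..<r} then t powr (p - 1) * exp (- (c / 2) * t) else 0) integrable_on {0<..}"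
        by (simp only: integrable_restrict_Int)
      from integrable_linear[OF this bounded_linear_of_real[where 'a=complex]]
      show ?thesis by (simp add: o_def if_distrib cong: if_cong)
    qed
    show "(\<lambda>t. cmod (complex_of_real (t powr (p - 1))) * exp (- (c / 2) * t)) integrable_on {0<..}"
      using set_lebesgue_integral_eq_integral(1)[OF ai] by simp
  qed (use p in auto)
  then show ?thesis by (simp add: scaleR_scaleC)
qed

text \<open>The chain rule is applied to the primitive \<open>G\<close> of \<open>f\<close>. A
  singularity of \<open>f\<close> at 0 is harmless, as \<open>G\<close> is continuous there and
  derivatives are taken only in the interior.\<close>

lemma primitive_substitution:
  fixes f :: "real \<Rightarrow> 'b::banach"
  assumes f: "\<And>R. f integrable_on {0..R}" "continuous_on {0<..} f"
    and g: "continuous_on {a..b} g" "g a = 0" "a \<le> b"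
      "\<And>x. x \<in> {a<..<b} \<Longrightarrow> g x > 0" "\<And>x. x \<in> {a<..<b} \<Longrightarrow> (g has_real_derivative g' x) (at x)"
  shows "((\<lambda>x. g' x *\<^sub>R f (g x)) has_integral integral {0..g b} f) {a..b}"
proof -
  define G where "G t = integral {0..t} f" for t
  have "bounded (g ` {a..b})" by (intro compact_imp_bounded compact_continuous_image g) auto
  then obtain B where "\<forall>y\<in>g ` {a..b}. norm y \<le> B" unfolding bounded_iff by blast
  then have B: "\<bar>g x\<bar> \<le> B" if "x \<in> {a..b}" for x using that by simp
  have nonneg: "g x \<ge> 0" if "x \<in> {a..b}" for x
  proof (cases "a = b")
    case False
    have "{a..b} = closure {a<..<b}" using g(3) False by simp
    moreover have "closed {x \<in> {a..b}. 0 \<le> g x}"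
      by (intro continuous_on_closed_Collect_le continuous_intros g(1))
    moreover have "{a<..<b} \<subseteq> {x \<in> {a..b}. 0 \<le> g x}"
      using g(4) by (auto intro: less_imp_le)
    ultimately have "{a..b} \<subseteq> {x \<in> {a..b}. 0 \<le> g x}"
      by (metis closure_minimal)
    then show ?thesis using that by auto
  qed (use that g in auto)
  have cont: "continuous_on {a..b} (\<lambda>x. G (g x))"
  proof (rule continuous_on_compose2[OF _ g(1)])
    show "continuous_on {0..B} G" unfolding G_def by (rule indefinite_integral_continuous_1[OF f(1)])
    show "g ` {a..b} \<subseteq> {0..B}" using B nonneg by (auto simp: abs_le_iff)
  qed
  have "((\<lambda>x. g' x *\<^sub>R f (g x)) has_integral G (g b) - G (g a)) {a..b}"
  proof (rule fundamental_theorem_of_calculus_interior[OF g(3) cont])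
    fix x assume x: "x \<in> {a<..<b}"
    let ?I = "{0..g x + 1}"
    have "continuous (at (g x)) f"
      using f(2) g(4)[OF x] by (simp add: continuous_on_eq_continuous_at)
    then have "(G has_vector_derivative f (g x)) (at (g x) within ?I - {})"
      unfolding G_def using g(4)[OF x]
      by (intro integral_has_vector_derivative_continuous_at f(1)) (auto intro: continuous_at_imp_continuous_at_within)
    moreover have "at (g x) within ?I = at (g x)"
      using g(4)[OF x] by (intro at_within_interior) auto
    ultimately have "(G has_vector_derivative f (g x)) (at (g x))" by simp
    moreover have "(g has_vector_derivative g' x) (at x)"
      using g(5)[OF x] by (simp add: has_real_derivative_iff_has_vector_derivative)
    ultimately show "((\<lambda>x. G (g x)) has_vector_derivative g' x *\<^sub>R f (g x)) (at x)"
      using vector_diff_chain_at[of g "g' x" x G "f (g x)"] by (simp add: o_def)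
  qed
  then show ?thesis by (simp add: G_def g(2))
qed

section \<open>Integrals over half-lines as limits\<close>

lemma integral_tendsto_Ici:
  fixes f :: "real \<Rightarrow> 'b::banach"
  assumes "(f has_integral i) {0..}"
  shows "((\<lambda>R. integral {0..R} f) \<longlongrightarrow> i) at_top"
proof (rule tendstoI)
  fix e :: real assume "e > 0"
  then obtain B where B: "B > 0" "\<And>a b. ball 0 B \<subseteq> cbox a b \<Longrightarrow>
      norm (integral (cbox a b) (\<lambda>x. if x \<in> {0..} then f x else 0) - i) < e"
    using assms unfolding has_integral_alt'[of f] by meson
  have "dist (integral {0..R} f) i < e" if R: "R \<ge> B" for R
  proof -
    have "ball 0 B \<subseteq> cbox (- R) R" using R by (auto simp: dist_norm)
    then have "norm (integral (cbox (- R) R) (\<lambda>x. if x \<in> {0..} then f x else 0) - i) < e" by (rule B(2))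
    moreover have "{0..} \<inter> {-R..R} = {0..R}" using R B(1) by auto
    ultimately show ?thesis by (simp only: integral_restrict_Int dist_norm cbox_interval)
  qed
  then show "\<forall>\<^sub>F R in at_top. dist (integral {0..R} f) i < e"
    by (auto simp: eventually_at_top_linorder)
qed

lemma at_top_limit_eqI:
  fixes f :: "real \<Rightarrow> 'b::real_normed_vector"
  assumes "(f \<longlongrightarrow> l) at_top" "(e \<longlongrightarrow> 0) at_top" "\<And>R. R \<ge> 1 \<Longrightarrow> norm (f R - m) \<le> e R"
  shows "l = m"
proof -
  have "\<forall>\<^sub>F R in at_top. norm (f R - m) \<le> e R"
    using eventually_ge_at_top[of 1] by eventually_elim (rule assms(3))
  from LIM_zero_cancel[OF Lim_null_comparison[OF this assms(2)]]
  show ?thesis using assms(1) tendsto_unique trivial_limit_at_top_linorder by blast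
qed

subsection \<open>Negative powers\<close>

lemma Gamma_integral_scaled:
  assumes p: "p > 0" and c: "c > (0::real)"
  shows "((\<lambda>t. t powr (p - 1) * exp (- c * t)) has_integral Gamma p * c powr (- p)) {0<..}"
proof -
  define f :: "real \<Rightarrow> real" where "f t = t powr (p - 1) / exp t" for t
  have f: "(f has_integral Gamma p) {0..}" unfolding f_def by (rule Gamma_integral_real[OF p])
  have fi: "f integrable_on {0..R}" for R
    by (rule integrable_on_subinterval[OF has_integral_integrable[OF f]]) auto
  have cont: "continuous_on {0<..} f" unfolding f_def by (intro continuous_intros) auto
  let ?h = "\<lambda>t. t powr (p - 1) * exp (- c * t)"
  have hi: "?h integrable_on {0<..}"
    using set_lebesgue_integral_eq_integral(1)[OF powr_exp_absolutely_integrable[OF p c]] .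
  define i where "i = integral {0<..} ?h"
  have h: "(?h has_integral i) {0..}"
    using integrable_integral[OF hi] by (simp add: has_integral_Ioi_iff_Ici i_def)
  have eq: "integral {0..R} ?h = c powr (- p) * integral {0..c * R} f" if R: "R \<ge> 0" for R
  proof -
    have "((\<lambda>x. c *\<^sub>R f (c * x)) has_integral integral {0..c * R} f) {0..R}"
      by (rule primitive_substitution[OF fi cont])
         (use c R in \<open>auto intro!: continuous_intros derivative_eq_intros\<close>)
    from has_integral_mult_right[OF this, of "c powr (- p)"]
    have "((\<lambda>x. c powr (- p) * (c *\<^sub>R f (c * x))) has_integral c powr (- p) * integral {0..c * R} f) {0..R}" .
    moreover have "c powr (- p) * (c *\<^sub>R f (c * x)) = ?h x" if "x \<in> {0..R}" for x
    proof -
      have "c powr (- p) * (c * c powr (p - 1)) = 1" using c by (simp add: powr_minus powr_diff field_simps)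
      moreover have "c powr (- p) * (c *\<^sub>R f (c * x))
          = (c powr (- p) * (c * c powr (p - 1))) * (x powr (p - 1) / exp (c * x))"
        using that c by (simp add: f_def powr_mult)
      ultimately show ?thesis by (simp add: exp_minus divide_inverse)
    qed
    ultimately have "(?h has_integral c powr (- p) * integral {0..c * R} f) {0..R}"
      by (metis (no_types, lifting) has_integral_cong)
    then show ?thesis by (rule integral_unique)
  qed
  have "filterlim (\<lambda>R. c * R) at_top at_top"
    by (rule filterlim_tendsto_pos_mult_at_top[OF tendsto_const c filterlim_ident])
  then have "((\<lambda>R. c powr (- p) * integral {0..c * R} f) \<longlongrightarrow> c powr (- p) * Gamma p) at_top"
    by (intro tendsto_mult_left filterlim_compose[OF integral_tendsto_Ici[OF f]])
  moreover have "((\<lambda>R. c powr (- p) * integral {0..c * R} f) \<longlongrightarrow> i) at_top"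
    by (rule Lim_transform_eventually[OF integral_tendsto_Ici[OF h]])
       (use eq in \<open>auto simp: eventually_at_top_linorder intro!: exI[of _ 0]\<close>)
  ultimately have "i = c powr (- p) * Gamma p"
    using tendsto_unique trivial_limit_at_top_linorder by blast
  with h show ?thesis by (simp add: has_integral_Ioi_iff_Ici mult.commute)
qed

lemma powr_exp_tendsto_0:
  assumes "c > (0::real)" shows "((\<lambda>R. R powr p * exp (- c * R)) \<longlongrightarrow> 0) at_top"
proof -
  define n where "n = nat \<lceil>p\<rceil>"
  have n: "p \<le> real n" unfolding n_def by linarith
  have "filterlim (\<lambda>R. c * R) at_top at_top"
    by (rule filterlim_tendsto_pos_mult_at_top[OF tendsto_const assms filterlim_ident])
  from filterlim_compose[OF tendsto_power_div_exp_0 this]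
  have "((\<lambda>R. (c * R) ^ n / exp (c * R)) \<longlongrightarrow> 0) at_top" .
  then have z: "((\<lambda>R. (1 / c ^ n) * ((c * R) ^ n / exp (c * R))) \<longlongrightarrow> 0) at_top"
    by (rule tendsto_mult_right_zero)
  show ?thesis
  proof (rule Lim_null_comparison[OF _ z])
    have "norm (R powr p * exp (- c * R)) \<le> (1 / c ^ n) * ((c * R) ^ n / exp (c * R))" if R: "R \<ge> 1" for R
    proof -
      have "R powr p \<le> R powr real n" using R n by (intro powr_mono) auto
      also have "\<dots> = R ^ n" using R by (simp add: powr_realpow)
      finally have "R powr p * exp (- c * R) \<le> R ^ n * exp (- c * R)" by simp
      then show ?thesis using assms by (simp add: power_mult_distrib exp_minus field_simps)
    qed
    then show "\<forall>\<^sub>F R in at_top. norm (R powr p * exp (- c * R)) \<le> (1 / c ^ n) * ((c * R) ^ n / exp (c * R))"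
      by (auto simp: eventually_at_top_linorder)
  qed
qed

text \<open>The factor \<open>max 0 (r - s)\<close> extends the convolution kernel by zero to the
  whole square: for s > r it gives 0 powr (q - 1) = 0. The extension is continuous because q >
  1.\<close>

lemma Beta_integral_scaled:
  assumes p: "p > 1" and q: "q > 1" and r: "0 \<le> r" "r \<le> (R::real)"
  shows "((\<lambda>s. s powr (p - 1) * max 0 (r - s) powr (q - 1)) has_integral Beta p q * r powr (p + q - 1)) {0..R}"
proof -
  define f where "f s = s powr (p - 1) * max 0 (r - s) powr (q - 1)" for s
  have cont: "continuous_on {0..} f"
    unfolding f_def using p q by (intro continuous_intros continuous_on_powr') auto
  have fi: "f integrable_on {a..b}" if "a \<ge> 0" for a b
    by (rule integrable_continuous_real[OF continuous_on_subset[OF cont]]) (use that in auto)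
  have fi0: "f integrable_on {0..b}" for b by (rule fi) simp
  have cont': "continuous_on {0<..} f" by (rule continuous_on_subset[OF cont]) auto
  have 1: "((\<lambda>x. r *\<^sub>R f (r * x)) has_integral integral {0..r * 1} f) {0..1}" if "r > 0"
    by (rule primitive_substitution[OF fi0 cont'])
       (use that in \<open>auto intro!: continuous_intros derivative_eq_intros\<close>)
  have 2: "integral {0..r} f = Beta p q * r powr (p + q - 1)"
  proof (cases "r = 0")
    case False
    then have r0: "r > 0" using r by simp
    have "((\<lambda>x. r powr (p + q - 1) * (x powr (p - 1) * (1 - x) powr (q - 1)))
        has_integral r powr (p + q - 1) * Beta p q) {0..1}"
      by (intro has_integral_mult_right has_integral_Beta_real) (use p q in auto)
    moreover have "r powr (p + q - 1) * (x powr (p - 1) * (1 - x) powr (q - 1)) = r *\<^sub>R f (r * x)"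
      if x: "x \<in> {0..1}" for x
    proof -
      have "max 0 (r - r * x) = r * (1 - x)" using x r0 by (simp add: algebra_simps)
      moreover have "r powr (p + q - 1) = r * r powr (p - 1) * r powr (q - 1)"
        using r0 by (simp add: powr_add powr_diff)
      ultimately show ?thesis using x r0 by (simp add: f_def powr_mult)
    qed
    ultimately have "((\<lambda>x. r *\<^sub>R f (r * x)) has_integral r powr (p + q - 1) * Beta p q) {0..1}"
      by (metis (no_types, lifting) has_integral_cong)
    with 1[OF r0] show ?thesis by (simp add: has_integral_unique mult.commute)
  qed (use p q in simp)
  have "(f has_integral Beta p q * r powr (p + q - 1)) {0..r}"
    using integrable_integral[OF fi[of 0 r]] 2 by simp
  moreover have "(f has_integral 0) {r..R}"
    by (rule has_integral_is_0) (auto simp: f_def)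
  ultimately show ?thesis
    using has_integral_combine[OF r] unfolding f_def by fastforce
qed

context hille_yosida
begin

text \<open>This is Gamma(p) A^(-p), left unnormalised so that the factorial and Beta constants of
  the composition laws come out by themselves.\<close>

definition J :: "real \<Rightarrow> 'a \<Rightarrow> 'a" where
  "J p u = integral {0<..} (\<lambda>t. t powr (p - 1) *\<^sub>R T t u)"

lemma neg_power_eq: "neg_power Y A p u = (1 / Gamma p) *\<^sub>R J p u"
proof -
  have "integral {0<..} (\<lambda>t. t powr (p - 1) *\<^sub>R exp_minus Y A t u) = J p u"
    unfolding J_def by (rule integral_cong) (simp add: exp_minus_eq)
  then show ?thesis by (simp add: neg_power_def)
qed

lemma J_integrable: "p > 0 \<Longrightarrow> (\<lambda>t. t powr (p - 1) *\<^sub>R T t u) integrable_on {0<..}"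
  by (rule powr_kernel_integrable[OF T_continuous, where C="M * norm u" and c=w])
     (use T_norm w in \<open>auto simp: mult_ac\<close>)

lemma J_has_integral: "p > 0 \<Longrightarrow> ((\<lambda>t. t powr (p - 1) *\<^sub>R T t u) has_integral J p u) {0..}"
  using J_integrable[of p u] by (simp add: J_def integrable_integral flip: has_integral_Ioi_iff_Ici)

lemma J_integrable_interval:
  "p > 0 \<Longrightarrow> a \<ge> 0 \<Longrightarrow> (\<lambda>t. t powr (p - 1) *\<^sub>R T t u) integrable_on {a..b}"
  by (rule integrable_on_subinterval[OF has_integral_integrable[OF J_has_integral]]) auto

lemma J_tendsto:
  "p > 0 \<Longrightarrow> ((\<lambda>R. integral {0..R} (\<lambda>t. t powr (p - 1) *\<^sub>R T t u)) \<longlongrightarrow> J p u) at_top"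
  by (rule integral_tendsto_Ici[OF J_has_integral])

lemma J_norm:
  assumes p: "p > 0" shows "norm (J p u) \<le> M * Gamma p * w powr (- p) * norm u"
proof -
  have "norm (J p u) \<le> integral {0<..} (\<lambda>t. (M * norm u) * (t powr (p - 1) * exp (- w * t)))"
    unfolding J_def
  proof (rule integral_norm_bound_integral)
    fix t :: real assume "t \<in> {0<..}"
    then have "t powr (p - 1) * norm (T t u) \<le> t powr (p - 1) * (M * exp (- w * t) * norm u)"
      using T_norm[of t u] by (intro mult_left_mono) auto
    then show "norm (t powr (p - 1) *\<^sub>R T t u) \<le> (M * norm u) * (t powr (p - 1) * exp (- w * t))"
      by (simp add: mult_ac)
  qed (use J_integrable[OF p] Gamma_integral_scaled[OF p w] in \<open>auto intro!: integrable_on_mult_right\<close>)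
  also have "\<dots> = (M * norm u) * (Gamma p * w powr (- p))"
    by (intro integral_unique has_integral_mult_right Gamma_integral_scaled p w)
  finally show ?thesis by (simp add: mult_ac)
qed

lemma J_bounded_clinear:
  assumes p: "p > 0" shows "bounded_clinear (J p)"
proof (rule bounded_clinearI)
  fix u v :: 'a and c
  show "J p (u + v) = J p u + J p v"
    unfolding J_def integral_add[OF J_integrable[OF p] J_integrable[OF p], symmetric]
    by (rule integral_cong) (use linear_add[OF T_linear] in \<open>auto simp: scaleR_add_right\<close>)
  have "J p (c *\<^sub>C u) = integral {0<..} ((\<lambda>v. c *\<^sub>C v) \<circ> (\<lambda>t. t powr (p - 1) *\<^sub>R T t u))"
    unfolding J_def
    by (rule integral_cong)
       (use T_bounded_clinear in \<open>auto simp: bounded_clinear_def scaleR_scaleC scaleC_scaleC mult.commute\<close>)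
  also have "\<dots> = c *\<^sub>C J p u"
    unfolding J_def by (rule integral_linear[OF J_integrable[OF p] bounded_linear_scaleC])
  finally show "J p (c *\<^sub>C u) = c *\<^sub>C J p u" .
qed (rule J_norm[OF p])

section \<open>The inverse of A and the composition laws\<close>

abbreviation B :: "'a \<Rightarrow> 'a" where "B \<equiv> op_inverse Y A"

lemma B_eq: "B v = - resolvent Y A 0 v"
proof -
  define R where "R = resolvent Y A (complex_of_real 0)"
  have R: "R v \<in> Y" "- A (R v) = v" "\<And>u. u \<in> Y \<Longrightarrow> R (- A u) = u" for v
    using resolvent_in[OF w] resolvent_right[OF w, of v] resolvent_left[OF w] by (auto simp: R_def)
  have "inj_on A Y"
  proof (rule inj_onI)
    fix x y assume xy: "x \<in> Y" "y \<in> Y" and eq: "A x = A y"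
    show "x = y" using R(3)[OF xy(1), unfolded eq] R(3)[OF xy(2)] by (rule trans[OF sym])
  qed
  moreover have "A (- R v) = v" "- R v \<in> Y"
    using A_scaleR[OF R(1), of "-1" v] Y_scaleR[OF R(1), of "-1" v] R(2)[of v] by auto
  ultimately have "B v = - R v"
    unfolding op_inverse_def using inv_into_f_f[of A Y "- R v"] by simp
  then show ?thesis by (simp add: R_def)
qed

lemma B_in: "B v \<in> Y" and A_B: "A (B v) = v" and B_A: "u \<in> Y \<Longrightarrow> B (A u) = u"
  and B_bounded_clinear: "bounded_clinear B"
proof -
  have R: "resolvent Y A 0 v \<in> Y" "- A (resolvent Y A 0 v) = v"
    "\<And>u. u \<in> Y \<Longrightarrow> resolvent Y A 0 (- A u) = u" "bounded_clinear (resolvent Y A 0)" for v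
    using resolvent_in[OF w] resolvent_right[OF w, of v] resolvent_left[OF w] resolvent_bounded[OF w] by auto
  show "B v \<in> Y" "A (B v) = v"
    using A_scaleR[OF R(1), of "-1" v] Y_scaleR[OF R(1), of "-1" v] R(2)[of v] by (auto simp: B_eq)
  have "bounded_linear (resolvent Y A 0)" using R(4) by (simp add: bounded_clinear_def)
  note l = bounded_linear.linear[OF this] and this
  show "u \<in> Y \<Longrightarrow> B (A u) = u" using R(3)[of u] by (simp add: B_eq linear_neg[OF l(1)])
  have "- (c *\<^sub>C x) = c *\<^sub>C (- x)" for c and x :: 'a
    by (metis bounded_linear_scaleC bounded_linear.linear linear_neg)
  then have "bounded_clinear (\<lambda>v. - resolvent Y A 0 v)"
    using R(4) by (simp add: bounded_clinear_def bounded_linear_minus)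
  then show "bounded_clinear B" by (simp add: B_eq[abs_def])
qed

lemma J_1: "J 1 u = B u"
proof (rule at_top_limit_eqI[OF J_tendsto])
  show "((\<lambda>R. (M * norm (B u)) * (R powr 0 * exp (- w * R))) \<longlongrightarrow> 0) at_top"
    by (rule tendsto_mult_right_zero[OF powr_exp_tendsto_0[OF w]])
  fix R :: real assume R: "R \<ge> 1"
  \<comment> \<open>At t = 0 the weight is 0 powr 0 = 0 instead of 1, which matters on a null set
    only.\<close>
  have "integral {0..R} (\<lambda>t. t powr (1 - 1) *\<^sub>R T t u) = integral {0..R} (\<lambda>t. T t u)"
    by (rule integral_spike[of "{0}"]) auto
  then have "integral {0..R} (\<lambda>t. t powr (1 - 1) *\<^sub>R T t u) - B u = - T R (B u)"
    using T_integral[OF B_in, of R u] R by (simp add: A_B)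
  then show "norm (integral {0..R} (\<lambda>t. t powr (1 - 1) *\<^sub>R T t u) - B u) \<le> (M * norm (B u)) * (R powr 0 * exp (- w * R))"
    using T_norm[of R "B u"] R by (simp add: mult_ac)
qed simp

text \<open>Integration by parts: t^p T_t (B u) has derivative p t^(p-1) T_t (B u) - t^p T_t u, and
  it vanishes at 0 and at infinity.\<close>

lemma J_shift:
  assumes p: "p > 0" shows "J (p + 1) u = p *\<^sub>R J p (B u)"
proof -
  let ?f = "\<lambda>t. t powr (p - 1) *\<^sub>R T t (B u)" and ?g = "\<lambda>t. t powr (p + 1 - 1) *\<^sub>R T t u"
  have eq: "p *\<^sub>R integral {0..R} ?f - integral {0..R} ?g = R powr p *\<^sub>R T R (B u)" if R: "R \<ge> 0" for R
  proof -
    have "((\<lambda>t. p *\<^sub>R ?f t - ?g t) has_integral R powr p *\<^sub>R T R (B u) - 0 powr p *\<^sub>R T 0 (B u)) {0..R}"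
    proof (rule fundamental_theorem_of_calculus_interior[OF R])
      show "continuous_on {0..R} (\<lambda>t. t powr p *\<^sub>R T t (B u))"
        using p by (intro continuous_intros continuous_on_powr' continuous_on_subset[OF T_continuous]) auto
      fix t assume t: "t \<in> {0<..<R}"
      have "((\<lambda>t. T t (B u)) has_vector_derivative - T t u) (at t within {0..})"
        using T_derivative[OF B_in, of t u] t by (simp add: A_B)
      moreover have "at t within {0..} = at t" using t by (intro at_within_interior) auto
      ultimately have "((\<lambda>t. T t (B u)) has_vector_derivative - T t u) (at t)" by (simp only:)
      moreover have "((\<lambda>t. t powr p) has_real_derivative p * t powr (p - 1)) (at t)"
        using t by (auto intro!: derivative_eq_intros simp: powr_diff)
      ultimately have "((\<lambda>t. t powr p *\<^sub>R T t (B u)) has_vector_derivative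
          t powr p *\<^sub>R (- T t u) + (p * t powr (p - 1)) *\<^sub>R T t (B u)) (at t)"
        by (intro has_vector_derivative_scaleR)
      then show "((\<lambda>t. t powr p *\<^sub>R T t (B u)) has_vector_derivative p *\<^sub>R ?f t - ?g t) (at t)"
        by simp
    qed
    then have "integral {0..R} (\<lambda>t. p *\<^sub>R ?f t - ?g t) = R powr p *\<^sub>R T R (B u)"
      using p by (simp add: integral_unique)
    moreover have "integral {0..R} (\<lambda>t. p *\<^sub>R ?f t - ?g t) = integral {0..R} (\<lambda>t. p *\<^sub>R ?f t) - integral {0..R} ?g"
      by (intro integral_diff integrable_cmul J_integrable_interval) (use p in auto)
    moreover have "integral {0..R} (\<lambda>t. p *\<^sub>R ?f t) = p *\<^sub>R integral {0..R} ?f" by (rule integral_cmul)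
    ultimately show ?thesis by metis
  qed
  have "p *\<^sub>R J p (B u) - J (p + 1) u = 0"
  proof (rule at_top_limit_eqI)
    show "((\<lambda>R. p *\<^sub>R integral {0..R} ?f - integral {0..R} ?g) \<longlongrightarrow> p *\<^sub>R J p (B u) - J (p + 1) u) at_top"
      using p by (intro tendsto_intros J_tendsto) auto
    show "((\<lambda>R. (M * norm (B u)) * (R powr p * exp (- w * R))) \<longlongrightarrow> 0) at_top"
      by (rule tendsto_mult_right_zero[OF powr_exp_tendsto_0[OF w]])
    fix R :: real assume "R \<ge> 1"
    then have R: "R \<ge> 0" by simp
    have "R powr p * norm (T R (B u)) \<le> R powr p * (M * exp (- w * R) * norm (B u))"
      by (intro mult_left_mono T_norm R) simp
    then show "norm (p *\<^sub>R integral {0..R} ?f - integral {0..R} ?g - 0) \<le> (M * norm (B u)) * (R powr p * exp (- w * R))"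
      unfolding eq[OF R] by (simp add: mult_ac)
  qed
  then show ?thesis by simp
qed

lemma J_nat: "J (real (Suc n)) u = fact n *\<^sub>R (B ^^ Suc n) u"
proof (induction n arbitrary: u)
  case (Suc n)
  have "J (real (Suc (Suc n))) u = real (Suc n) *\<^sub>R J (real (Suc n)) (B u)"
    using J_shift[of "real (Suc n)" u] by (simp add: add.commute)
  also have "\<dots> = real (Suc n) *\<^sub>R fact n *\<^sub>R (B ^^ Suc n) (B u)" by (simp only: Suc)
  also have "(B ^^ Suc n) (B u) = (B ^^ Suc (Suc n)) u" by (simp only: funpow_Suc_right o_def)
  also have "real (Suc n) *\<^sub>R fact n *\<^sub>R \<dots> = fact (Suc n) *\<^sub>R \<dots>" by (simp del: funpow.simps)
  finally show ?case .
qed (simp add: J_1)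


text \<open>For t \<ge> x, exp (-w t) \<le> exp (-w x / 2) exp (-w t / 2): one half of the decay
  pays for the smallness, the other keeps the integral convergent.\<close>

lemma J_tail_norm:
  assumes p: "p > 0" and x: "x \<ge> 0"
  shows "norm (J p u - integral {0..x} (\<lambda>t. t powr (p - 1) *\<^sub>R T t u))
    \<le> exp (- (w / 2) * x) * (M * Gamma p * (w / 2) powr (- p) * norm u)"
proof -
  let ?f = "\<lambda>t. t powr (p - 1) *\<^sub>R T t u"
  let ?g = "\<lambda>t. (M * norm u * exp (- (w / 2) * x)) * (t powr (p - 1) * exp (- (w / 2) * t))"
  have w2: "w / 2 > 0" using w by simp
  have gi: "(?g has_integral (M * norm u * exp (- (w / 2) * x)) * (Gamma p * (w / 2) powr (- p))) {0..}"
    using has_integral_mult_right[OF Gamma_integral_scaled[OF p w2]] by (simp only: has_integral_Ioi_iff_Ici)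
  have bound: "norm (integral {x..R} ?f) \<le> exp (- (w / 2) * x) * (M * Gamma p * (w / 2) powr (- p) * norm u)"
    for R
  proof -
    have "norm (integral {x..R} ?f) \<le> integral {x..R} ?g"
    proof (rule integral_norm_bound_integral)
      show "?g integrable_on {x..R}"
        by (rule integrable_on_subinterval[OF has_integral_integrable[OF gi]]) (use x in auto)
      fix t assume t: "t \<in> {x..R}"
      have "exp (- w * t) \<le> exp (- (w / 2) * x) * exp (- (w / 2) * t)"
      proof -
        have "w * x \<le> w * t" using t w by simp
        then show ?thesis by (simp flip: exp_add)
      qed
      then have "M * exp (- w * t) * norm u \<le> M * (exp (- (w / 2) * x) * exp (- (w / 2) * t)) * norm u"
        using M by (intro mult_right_mono mult_left_mono) auto
      then have "norm (T t u) \<le> M * (exp (- (w / 2) * x) * exp (- (w / 2) * t)) * norm u"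
        using T_norm[of t u] t x by simp
      then have "t powr (p - 1) * norm (T t u)
          \<le> t powr (p - 1) * (M * (exp (- (w / 2) * x) * exp (- (w / 2) * t)) * norm u)"
        by (intro mult_left_mono) auto
      then show "norm (?f t) \<le> ?g t" by (simp add: mult_ac)
    qed (rule J_integrable_interval[OF p x])
    also have "\<dots> \<le> integral {0..} ?g"
      by (rule integral_subset_le)
         (use x gi M integrable_on_subinterval[OF has_integral_integrable[OF gi], of x R]
          in \<open>auto intro: has_integral_integrable\<close>)
    also have "\<dots> = (M * norm u * exp (- (w / 2) * x)) * (Gamma p * (w / 2) powr (- p))"
      by (rule integral_unique[OF gi])
    finally show ?thesis by (simp add: mult_ac)
  qed
  have "integral {0..R} ?f - integral {0..x} ?f = integral {x..R} ?f" if "R \<ge> x" for R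
    using Henstock_Kurzweil_Integration.integral_combine[OF x that J_integrable_interval[OF p order_refl]]
    by (simp add: algebra_simps)
  then have "\<forall>\<^sub>F R in at_top. norm (integral {0..R} ?f - integral {0..x} ?f)
      \<le> exp (- (w / 2) * x) * (M * Gamma p * (w / 2) powr (- p) * norm u)"
    using bound by (auto simp: eventually_at_top_linorder intro!: exI[of _ x])
  then show ?thesis
    by (rule tendsto_upperbound[OF tendsto_norm[OF tendsto_diff[OF J_tendsto[OF p] tendsto_const]]]) simp
qed

text \<open>Truncating the double integral at \<open>R\<close> keeps the integrand continuous, so that Fubini's theorem for
  continuous functions applies.\<close>

lemma J_comp:
  assumes p: "p > 1" and q: "q > 1"
  shows "J p (J q u) = Beta p q *\<^sub>R J (p + q) u"
proof -
  \<comment> \<open>With r = s + t the composition becomes a double integral of s^(p-1) (r -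
    s)^(q-1) T_r u over s < r; \<open>L R\<close> restricts it to the square of side R.\<close>
  define f where "f s r = (s powr (p - 1) * max 0 (r - s) powr (q - 1)) *\<^sub>R T r u" for s r
  define L where "L R = integral {0..R} (\<lambda>s. integral {0..R} (f s))" for R
  have fcont: "continuous_on (cbox (0, 0) (y, z)) (\<lambda>(s, r). f s r)" for y z
    unfolding f_def case_prod_unfold using p q
    by (intro continuous_intros continuous_on_powr' continuous_on_compose2[OF T_continuous])
       (auto simp: cbox_Pair_eq)
  \<comment> \<open>Integrating over s first produces the Beta integral; integrating over r first,
    as in \<open>inner\<close>, produces \<open>T s\<close> applied to a truncated
    \<open>J q u\<close>.\<close>
  have L1: "L R = Beta p q *\<^sub>R integral {0..R} (\<lambda>r. r powr (p + q - 1) *\<^sub>R T r u)" for R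
  proof -
    have "L R = integral {0..R} (\<lambda>r. integral {0..R} (\<lambda>s. f s r))"
      using integral_swap_continuous[OF fcont] by (simp add: L_def)
    also have "\<dots> = integral {0..R} (\<lambda>r. Beta p q *\<^sub>R (r powr (p + q - 1) *\<^sub>R T r u))"
    proof (rule integral_cong)
      fix r assume "r \<in> {0..R}"
      then have "((\<lambda>s. f s r) has_integral (Beta p q * r powr (p + q - 1)) *\<^sub>R T r u) {0..R}"
        unfolding f_def by (intro has_integral_scaleR_left Beta_integral_scaled p q) auto
      then show "integral {0..R} (\<lambda>s. f s r) = Beta p q *\<^sub>R (r powr (p + q - 1) *\<^sub>R T r u)"
        by (simp add: integral_unique)
    qed
    finally show ?thesis by (simp only: integral_cmul)
  qed
  have inner: "integral {0..R} (f s) = s powr (p - 1) *\<^sub>R T s (integral {0..R - s} (\<lambda>t. t powr (q - 1) *\<^sub>R T t u))"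
    if s: "s \<in> {0..R}" for s R
  proof -
    have bl: "bounded_linear (T s)" using T_bounded_clinear[of s] s by (simp add: bounded_clinear_def)
    let ?h = "\<lambda>t. t powr (q - 1) *\<^sub>R T (s + t) u"
    have hcont: "continuous_on {0..} ?h"
      using q s by (intro continuous_intros continuous_on_powr' continuous_on_compose2[OF T_continuous]) auto
    have 1: "((\<lambda>x. 1 *\<^sub>R ?h (x - s)) has_integral integral {0..R - s} ?h) {s..R}"
    proof (rule primitive_substitution)
      show "?h integrable_on {0..x}" for x
        by (rule integrable_continuous_real[OF continuous_on_subset[OF hcont]]) auto
      show "continuous_on {0<..} ?h" by (rule continuous_on_subset[OF hcont]) auto
    qed (use s in \<open>auto intro!: continuous_intros derivative_eq_intros\<close>)
    have 1: "((\<lambda>x. max 0 (x - s) powr (q - 1) *\<^sub>R T x u) has_integral integral {0..R - s} ?h) {s..R}"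
      by (rule has_integral_eq[OF _ 1]) simp
    have 2: "((\<lambda>x. max 0 (x - s) powr (q - 1) *\<^sub>R T x u) has_integral 0) {0..s}"
      by (rule has_integral_is_0) auto
    have "((\<lambda>x. max 0 (x - s) powr (q - 1) *\<^sub>R T x u) has_integral 0 + integral {0..R - s} ?h) {0..R}"
      by (rule has_integral_combine[OF _ _ 2 1]) (use s in auto)
    then have "(f s has_integral s powr (p - 1) *\<^sub>R integral {0..R - s} ?h) {0..R}"
      unfolding f_def by (auto dest: has_integral_cmul[where c="s powr (p - 1)"])
    moreover have "integral {0..R - s} ?h = T s (integral {0..R - s} (\<lambda>t. t powr (q - 1) *\<^sub>R T t u))"
    proof -
      have "integral {0..R - s} ?h = integral {0..R - s} (T s \<circ> (\<lambda>t. t powr (q - 1) *\<^sub>R T t u))"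
        using s by (intro integral_cong) (simp add: T_semigroup linear_cmul[OF bounded_linear.linear[OF bl]])
      also have "\<dots> = T s (integral {0..R - s} (\<lambda>t. t powr (q - 1) *\<^sub>R T t u))"
        using q by (intro integral_linear[OF J_integrable_interval bl]) auto
      finally show ?thesis .
    qed
    ultimately show ?thesis by (simp add: integral_unique)
  qed
  define K where "K = M * (M * Gamma q * (w / 2) powr (- q) * norm u)"
  define D where "D = K * (Gamma p * (w / 2) powr (- p))"
  have w2: "w / 2 > 0" using w by simp
  \<comment> \<open>The missing tail starts at R - s and decays at rate w/2, while
    \<open>T s\<close> decays at rate w; together they leave exp (-w R / 2) times the integrable exp
    (-w s / 2).\<close>
  have L2: "norm (integral {0..R} (\<lambda>s. s powr (p - 1) *\<^sub>R T s (J q u)) - L R) \<le> exp (- (w / 2) * R) * D"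
    if R: "R \<ge> 0" for R
  proof -
    let ?G = "\<lambda>s. exp (- (w / 2) * R) * K * (s powr (p - 1) * exp (- (w / 2) * s))"
    have gi: "(?G
        has_integral exp (- (w / 2) * R) * D) {0..}"
      using has_integral_mult_right[OF Gamma_integral_scaled[of p "w / 2"], of "exp (- (w / 2) * R) * K"] p w2
      by (simp add: has_integral_Ioi_iff_Ici D_def mult_ac)
    have ii: "(\<lambda>s. integral {0..R} (f s)) integrable_on {0..R}"
    proof -
      from integral_continuous_on_param[of "cbox 0 R" 0 R f] fcont[of R R]
      have "continuous_on (cbox 0 R) (\<lambda>s. integral (cbox 0 R) (f s))" by (simp add: cbox_Pair_eq)
      then show ?thesis by (intro integrable_continuous_real) simp
    qed
    have "integral {0..R} (\<lambda>s. s powr (p - 1) *\<^sub>R T s (J q u)) - L R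
        = integral {0..R} (\<lambda>s. s powr (p - 1) *\<^sub>R T s (J q u) - integral {0..R} (f s))"
      unfolding L_def using p by (intro integral_diff[symmetric] J_integrable_interval ii) auto
    also have "norm \<dots> \<le> integral {0..R} ?G"
    proof (rule integral_norm_bound_integral)
      show "(\<lambda>s. s powr (p - 1) *\<^sub>R T s (J q u) - integral {0..R} (f s)) integrable_on {0..R}"
        using p by (intro integrable_diff J_integrable_interval ii) auto
      show "?G integrable_on {0..R}"
        by (rule integrable_on_subinterval[OF has_integral_integrable[OF gi]]) auto
      fix s assume s: "s \<in> {0..R}"
      define v where "v = J q u - integral {0..R - s} (\<lambda>t. t powr (q - 1) *\<^sub>R T t u)"
      have "norm (T s v) \<le> M * exp (- w * s) * norm v" using T_norm s by simp
      also have "\<dots> \<le> M * exp (- w * s) * (exp (- (w / 2) * (R - s)) * (M * Gamma q * (w / 2) powr (- q) * norm u))"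
        unfolding v_def using q s M by (intro mult_left_mono J_tail_norm) auto
      also have "\<dots> = K * (exp (- w * s) * exp (- (w / 2) * (R - s)))" by (simp add: K_def mult_ac)
      also have "exp (- w * s) * exp (- (w / 2) * (R - s)) = exp (- (w / 2) * R) * exp (- (w / 2) * s)"
        by (simp add: field_simps flip: exp_add)
      finally have "s powr (p - 1) * norm (T s v) \<le> s powr (p - 1) * (K * (exp (- (w / 2) * R) * exp (- (w / 2) * s)))"
        by (rule mult_left_mono) simp
      moreover have "s powr (p - 1) *\<^sub>R T s (J q u) - integral {0..R} (f s) = s powr (p - 1) *\<^sub>R T s v"
        unfolding inner[OF s] v_def using linear_diff[OF T_linear[of s]] s by (simp add: scaleR_diff_right)
      ultimately show "norm (s powr (p - 1) *\<^sub>R T s (J q u) - integral {0..R} (f s))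
          \<le> exp (- (w / 2) * R) * K * (s powr (p - 1) * exp (- (w / 2) * s))"
        by (simp add: mult_ac)
    qed
    also have "\<dots> \<le> integral {0..} ?G"
    proof (rule integral_subset_le)
      show "?G integrable_on {0..R}"
        by (rule integrable_on_subinterval[OF has_integral_integrable[OF gi]]) auto
      show "?G integrable_on {0..}"
        by (rule has_integral_integrable[OF gi])
      have "K \<ge> 0" using M q w by (simp add: K_def Gamma_real_nonneg)
      then show "\<forall>s\<in>{0..}. 0 \<le> exp (- (w / 2) * R) * K * (s powr (p - 1) * exp (- (w / 2) * s))" by simp
    qed auto
    also have "\<dots> = exp (- (w / 2) * R) * D" by (rule integral_unique[OF gi])
    finally show ?thesis .
  qed
  have "J p (J q u) - Beta p q *\<^sub>R J (p + q) u = 0"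
  proof (rule at_top_limit_eqI)
    show "((\<lambda>R. integral {0..R} (\<lambda>s. s powr (p - 1) *\<^sub>R T s (J q u)) - L R)
        \<longlongrightarrow> J p (J q u) - Beta p q *\<^sub>R J (p + q) u) at_top"
      unfolding L1 using p q by (intro tendsto_intros J_tendsto) auto
    have "((\<lambda>R. exp (- (w / 2) * R)) \<longlongrightarrow> 0) at_top"
      by (rule filterlim_compose[OF exp_at_bot filterlim_tendsto_neg_mult_at_bot[OF tendsto_const _ filterlim_ident]])
         (use w in simp)
    then show "((\<lambda>R. exp (- (w / 2) * R) * D) \<longlongrightarrow> 0) at_top" by (rule tendsto_mult_left_zero)
  qed (use L2 in simp)
  then show ?thesis by simp
qed


section \<open>Lower bounds through the spectral radius\<close>

lemma B_power_bounded_clinear: "bounded_clinear (B ^^ n)"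
proof (induction n)
  case (Suc n)
  then show ?case
    using B_bounded_clinear by (simp add: bounded_clinear_def bounded_linear_compose o_def)
qed (simp add: bounded_clinear_def id_def bounded_linear_ident)

text \<open>If \<open>z ^ n B ^ n\<close> is a contraction, then \<open>1 - z B\<close> divides the invertible operator
  \<open>1 - z ^ n B ^ n\<close>, with the commuting cofactor \<open>Q\<close>.\<close>

lemma spectrum_B_power:
  assumes z: "z \<in> spectrum Y A" and n: "n \<ge> 1"
  shows "(1 / cmod z) ^ n \<le> onorm (B ^^ n)"
proof (rule ccontr)
  assume "\<not> ?thesis"
  then have small: "onorm (B ^^ n) < (1 / cmod z) ^ n" by simp
  have z0: "z \<noteq> 0" using z not_spectrum[OF w] by auto
  have Bl: "B (u - v) = B u - B v" "B (c *\<^sub>C u) = c *\<^sub>C B u" for u v c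
    using B_bounded_clinear by (auto simp: bounded_clinear_def bounded_linear.linear linear_diff)
  have Bbl: "bounded_linear B" using B_bounded_clinear by (simp add: bounded_clinear_def)
  have Bn: "bounded_linear (B ^^ j)" for j using B_power_bounded_clinear by (simp add: bounded_clinear_def)
  define a where "a j v = z ^ j *\<^sub>C (B ^^ j) v" for j v
  define Q where "Q v = (\<Sum>j<n. a j v)" for v
  define q where "q = cmod z ^ n * onorm (B ^^ n)"
  have "q < cmod z ^ n * (1 / cmod z) ^ n" unfolding q_def using small z0 by (intro mult_strict_left_mono) auto
  then have q: "0 \<le> q" "q < 1" using z0 onorm_pos_le[OF Bn] by (auto simp: q_def power_divide)
  have a_lin: "linear (a j)" for j
    unfolding a_def
    by (rule bounded_linear.linear[OF bounded_linear_compose[OF bounded_linear_scaleC Bn]])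
  have Q_bl: "bounded_linear Q"
    unfolding Q_def a_def
    by (intro bounded_linear_sum bounded_linear_compose[OF bounded_linear_scaleC Bn])
  have Qn: "norm (Q v) \<le> onorm Q * norm v" for v by (rule onorm[OF Q_bl])
  have Kn: "norm (a n v) \<le> q * norm v" for v
    using onorm[OF Bn, of n v] z0 by (simp add: a_def norm_scaleC norm_power q_def mult_left_mono mult.assoc)
  have aB: "a j (z *\<^sub>C B v) = a (Suc j) v" "z *\<^sub>C B (a j v) = a (Suc j) v" for j v
  proof -
    have "(B ^^ j) (z *\<^sub>C B v) = z *\<^sub>C (B ^^ Suc j) v"
      using B_power_bounded_clinear[of j] by (simp add: bounded_clinear_def funpow_swap1)
    then show "a j (z *\<^sub>C B v) = a (Suc j) v" by (simp add: a_def scaleC_scaleC mult.commute)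
    show "z *\<^sub>C B (a j v) = a (Suc j) v" by (simp add: a_def Bl scaleC_scaleC)
  qed
  have Q1: "Q v - z *\<^sub>C B (Q v) = v - a n v" for v
  proof -
    have "z *\<^sub>C B (Q v) = (\<Sum>j<n. a (Suc j) v)"
      by (simp add: Q_def linear_sum[OF bounded_linear.linear[OF Bbl]]
          linear_sum[OF bounded_linear.linear[OF bounded_linear_scaleC]] aB)
    then show ?thesis
      using sum_lessThan_telescope'[of "\<lambda>j. a j v" n] by (simp add: Q_def sum_subtractf a_def scaleC_one)
  qed
  have Q2: "Q (v - z *\<^sub>C B v) = v - a n v" for v
  proof -
    have "Q (v - z *\<^sub>C B v) = (\<Sum>j<n. a j v - a (Suc j) v)"
      by (simp only: Q_def linear_diff[OF a_lin] aB)
    then show ?thesis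
      using sum_lessThan_telescope'[of "\<lambda>j. a j v" n] by (simp add: a_def scaleC_one)
  qed
  have apply_B: "u - z *\<^sub>C B u = - B (z *\<^sub>C u - A u)" if "u \<in> Y" for u
    using B_A[OF that] by (simp add: Bl)
  \<comment> \<open>Applying \<open>Q\<close> to (1 - z B) u = -B (z - A) u gives (1 - a_n) u, whose
    norm is at least (1 - q) times that of u. This yields injectivity and later the bound of the
    inverse.\<close>
  have bound: "norm u \<le> onorm Q * onorm B / (1 - q) * norm (z *\<^sub>C u - A u)" if u: "u \<in> Y" for u
  proof -
    have "norm u - q * norm u \<le> norm (u - a n u)"
      using norm_triangle_ineq2[of u "a n u"] Kn[of u] by simp
    also have "\<dots> = norm (Q (- B (z *\<^sub>C u - A u)))" using Q2[of u] apply_B[OF u] by simp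
    also have "\<dots> \<le> onorm Q * norm (B (z *\<^sub>C u - A u))" using Qn[of "- B (z *\<^sub>C u - A u)"] by simp
    also have "\<dots> \<le> onorm Q * (onorm B * norm (z *\<^sub>C u - A u))"
      by (intro mult_left_mono onorm[OF Bbl] onorm_pos_le[OF Q_bl])
    finally show ?thesis using q by (simp add: field_simps)
  qed
  let ?f = "\<lambda>u. z *\<^sub>C u - A u"
  have f_diff: "?f (u - v) = ?f u - ?f v" and f_add: "?f (u + v) = ?f u + ?f v"
    and f_scale: "?f (c *\<^sub>C u) = c *\<^sub>C ?f u" if "u \<in> Y" "v \<in> Y" for u v c
    using that by (auto simp: A_diff A_add A_scaleC scaleC_add_right scaleC_scaleC mult.commute
        linear_diff[OF bounded_linear.linear[OF bounded_linear_scaleC]])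
  have inj: "inj_on ?f Y"
  proof (rule inj_onI)
    fix u v assume uv: "u \<in> Y" "v \<in> Y" and eq: "?f u = ?f v"
    have "norm (u - v) \<le> onorm Q * onorm B / (1 - q) * norm (?f (u - v))"
      by (rule bound[OF Y_diff[OF uv]])
    also have "?f (u - v) = 0" unfolding f_diff[OF uv] using eq by simp
    finally show "u = v" by simp
  qed
  \<comment> \<open>The fixed point solves (1 - a_n) y = -v, the sign coming from z B - 1 = -(1 - z
    B); then B Q y is a preimage of v.\<close>
  have surj: "\<exists>u\<in>Y. ?f u = v" for v
  proof -
    have "\<exists>!y. (\<lambda>y. a n y - v) y = y"
    proof (rule banach_fix_type[OF q], intro allI)
      fix x y
      have "(a n x - v) - (a n y - v) = a n (x - y)" by (simp add: linear_diff[OF a_lin])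
      then show "dist (a n x - v) (a n y - v) \<le> q * dist x y" using Kn[of "x - y"] by (simp only: dist_norm)
    qed
    then obtain y where y: "a n y - v = y" by blast
    have "?f (B (Q y)) = z *\<^sub>C B (Q y) - Q y" by (simp add: A_B)
    also have "\<dots> = v" using Q1[of y] y by (simp add: algebra_simps)
    finally show ?thesis using B_in by blast
  qed
  have bij: "bij_betw ?f Y UNIV"
    unfolding bij_betw_def using inj surj by (auto simp: image_iff) metis
  define R where "R = resolvent Y A z"
  have R: "R v \<in> Y" "?f (R v) = v" for v
  proof -
    have "v \<in> ?f ` Y" using bij by (simp add: bij_betw_def)
    then show "R v \<in> Y" "?f (R v) = v"
      unfolding R_def resolvent_def op_inverse_def by (rule inv_into_into, rule f_inv_into_f)
  qed
  have R_eq: "u \<in> Y \<Longrightarrow> ?f u = v \<Longrightarrow> R v = u" for u v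
    using inj R[of v] by (auto dest: inj_onD)
  have "bounded_clinear R"
  proof (rule bounded_clinearI)
    show "R (u + v) = R u + R v" for u v
      by (rule R_eq) (use R Y_add in \<open>auto simp: f_add\<close>)
    show "R (c *\<^sub>C u) = c *\<^sub>C R u" for c u
      by (rule R_eq) (use R Y_scaleC f_scale[OF R(1) R(1)] in auto)
    show "norm (R u) \<le> onorm Q * onorm B / (1 - q) * norm u" for u
      using bound[OF R(1), of u] R(2) by simp
  qed
  with bij z show False by (simp add: spectrum_def R_def)
qed

lemma onorm_J:
  assumes "p > 0" shows "onorm (J p) \<le> M * Gamma p * w powr (- p)"
  by (rule onorm_bound[OF _ J_norm[OF assms]]) (use M assms in \<open>auto simp: Gamma_real_nonneg\<close>)

lemma J_bounded_linear: "p > 0 \<Longrightarrow> bounded_linear (J p)"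
  using J_bounded_clinear by (simp add: bounded_clinear_def)

text \<open>Up to a constant B^N is J_p B J_q with p + 1 + q = N, and the last two factors have
  norms at most of order w^(-1) and w^(-q); so a lower bound for B^N falls on J_p. The factor B
  raises p to p + 1 because \<open>J_comp\<close> asks for exponents above 1; for q this means N > p
  + 2.\<close>

lemma J_lower_bound:
  assumes p: "p > 0" and \<kappa>: "\<kappa> > 0" and N: "real N > p + 2"
    and B: "(\<kappa> / w) ^ N \<le> onorm (B ^^ N)"
  defines "q \<equiv> real N - (p + 1)"
  shows "(Beta (p + 1) q * fact (N - 1) * \<kappa> ^ N / (M\<^sup>2 * Gamma q * p)) * w powr (- p) \<le> onorm (J p)"
proof -
  have q: "q > 1" "p + 1 + q = real N" using N by (auto simp: q_def)
  have N0: "N = Suc (N - 1)" using N p by linarith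
  define b where "b = Beta (p + 1) q * fact (N - 1)"
  have "Beta (p + 1) q > 0" using p q by (simp add: Beta_def Gamma_real_pos)
  then have b: "b > 0" by (simp add: b_def)
  have eq: "b *\<^sub>R (B ^^ N) u = p *\<^sub>R J p (B (J q u))" for u
  proof -
    have "p *\<^sub>R J p (B (J q u)) = J (p + 1) (J q u)" using J_shift[OF p] by simp
    also have "\<dots> = Beta (p + 1) q *\<^sub>R J (real N) u" using J_comp[of "p + 1" q u] p q by simp
    also have "J (real N) u = fact (N - 1) *\<^sub>R (B ^^ N) u" using J_nat[of "N - 1" u] N0 by metis
    finally show ?thesis by (simp add: b_def)
  qed
  have Bbl: "bounded_linear B" using B_bounded_clinear by (simp add: bounded_clinear_def)
  have "J 1 = B" by (rule ext) (rule J_1)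
  then have oB: "onorm B \<le> M * w powr (- 1)" using onorm_J[of 1] by simp
  have "norm ((B ^^ N) u) \<le> (p * onorm (J p) * (M * w powr (- 1)) * (M * Gamma q * w powr (- q)) / b) * norm u" for u
  proof -
    have q0: "q > 0" using q by simp
    note nn = onorm_pos_le[OF J_bounded_linear[OF p]] onorm_pos_le[OF Bbl]
    have "norm (J q u) \<le> M * Gamma q * w powr (- q) * norm u" by (rule J_norm[OF q0])
    then have "norm (B (J q u)) \<le> (M * w powr (- 1)) * (M * Gamma q * w powr (- q) * norm u)"
      using M by (intro order_trans[OF onorm[OF Bbl] mult_mono[OF oB]]) auto
    then have "norm (J p (B (J q u))) \<le> onorm (J p) * ((M * w powr (- 1)) * (M * Gamma q * w powr (- q) * norm u))"
      by (intro order_trans[OF onorm[OF J_bounded_linear[OF p]] mult_left_mono] nn)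
    then have "p * norm (J p (B (J q u)))
        \<le> p * (onorm (J p) * ((M * w powr (- 1)) * (M * Gamma q * w powr (- q) * norm u)))"
      using p by (intro mult_left_mono) auto
    moreover have "b * norm ((B ^^ N) u) = p * norm (J p (B (J q u)))"
      using arg_cong[OF eq[of u], of norm] b p by simp
    ultimately have "b * norm ((B ^^ N) u)
        \<le> p * (onorm (J p) * ((M * w powr (- 1)) * (M * Gamma q * w powr (- q) * norm u)))" by simp
    moreover have "x \<le> (p * c * d * e / b) * y" if "b * x \<le> p * (c * (d * (e * y)))" for x c d e y :: real
      using that b by (simp add: field_simps)
    ultimately show ?thesis by blast
  qed
  moreover have "Gamma q > 0" using q by (intro Gamma_real_pos) simp
  moreover have "0 \<le> p * onorm (J p) * (M * w powr (- 1)) * (M * Gamma q * w powr (- q)) / b"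
    using p b M \<open>Gamma q > 0\<close> onorm_pos_le[OF J_bounded_linear[OF p]] by simp
  ultimately have "onorm (B ^^ N) \<le> p * onorm (J p) * (M * w powr (- 1)) * (M * Gamma q * w powr (- q)) / b"
    by (intro onorm_bound) auto
  with B have "(\<kappa> / w) ^ N \<le> p * onorm (J p) * (M * w powr (- 1)) * (M * Gamma q * w powr (- q)) / b" by simp
  \<comment> \<open>Since p + 1 + q = N, the powers of w belonging to B and J_q split off exactly
    and cancel.\<close>
  moreover have "(\<kappa> / w) ^ N = \<kappa> ^ N * (w powr (- p) * w powr (- 1) * w powr (- q))"
  proof -
    have "w powr (- p) * w powr (- 1) * w powr (- q) = w powr (- p + - 1 + - q)"
      by (simp only: powr_add)
    also have "- p + - 1 + - q = - real N" using q(2) by simp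
    also have "w powr (- real N) = inverse (w ^ N)" using w by (simp add: powr_minus powr_realpow)
    finally have e: "w powr (- p) * w powr (- 1) * w powr (- q) = inverse (w ^ N)" .
    show ?thesis unfolding e power_divide by (rule divide_inverse)
  qed
  ultimately have *: "\<kappa> ^ N * (w powr (- p) * w powr (- 1) * w powr (- q))
      \<le> p * onorm (J p) * (M * w powr (- 1)) * (M * Gamma q * w powr (- q)) / b" by simp
  have "(x * y) * (b * k * z) \<le> (x * y) * (M\<^sup>2 * G * p * c)"
    if "k * (z * x * y) \<le> p * c * (M * x) * (M * G * y) / b" for k x y z c G :: real
    using b that by (simp add: field_simps power2_eq_square)
  from this[OF *] have "(w powr (- 1) * w powr (- q)) * (b * \<kappa> ^ N * w powr (- p))
      \<le> (w powr (- 1) * w powr (- q)) * (M\<^sup>2 * Gamma q * p * onorm (J p))" .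
  then have "b * \<kappa> ^ N * w powr (- p) \<le> M\<^sup>2 * Gamma q * p * onorm (J p)"
    by (rule mult_left_le_imp_le) (use w in simp)
  then show ?thesis using M p \<open>Gamma q > 0\<close> by (simp add: b_def field_simps)
qed

end

text \<open>The constant is chosen before \<open>Y\<close>, \<open>A\<close> and \<open>w\<close>:
  it depends on p, \<kappa> and M only, as uniformity over the net demands.\<close>

lemma neg_power_lower_bound:
  assumes p: "p > 0" and \<kappa>: "\<kappa> > 0" and M: "M \<ge> 1"
  shows "\<exists>C>0. \<forall>(Y::'a::complex_banach set) A w. hille_yosida Y A M w \<longrightarrow>
    (\<forall>n\<ge>1. (\<kappa> / w) ^ n \<le> onorm (op_inverse Y A ^^ n)) \<longrightarrow> C * w powr (- p) \<le> onorm (neg_power Y A p)"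
proof -
  obtain N :: nat where N: "real N > p + 2" using reals_Archimedean2 by blast
  define q where "q = real N - (p + 1)"
  define D where "D = Beta (p + 1) q * fact (N - 1) * \<kappa> ^ N / (M\<^sup>2 * Gamma q * p)"
  define C where "C = D / Gamma p"
  have q: "q > 0" using N by (simp add: q_def)
  have "Beta (p + 1) q > 0" using p q by (simp add: Beta_def Gamma_real_pos)
  then have "C > 0" using p q \<kappa> M by (simp add: C_def D_def Gamma_real_pos)
  moreover have "C * w powr (- p) \<le> onorm (neg_power Y A p)"
    if HY: "hille_yosida Y A M w" and *: "\<forall>n\<ge>1. (\<kappa> / w) ^ n \<le> onorm (op_inverse Y A ^^ n)"
    for Y :: "'a set" and A w
  proof -
    interpret hille_yosida Y A M w by (rule HY)
    have "N \<ge> 1" using N p by linarith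
    then have "D * w powr (- p) \<le> onorm (J p)"
      unfolding D_def q_def by (intro J_lower_bound[OF p \<kappa> N] *[rule_format])
    then have "C * w powr (- p) \<le> onorm (J p) / Gamma p"
      using Gamma_real_pos[OF p] by (simp add: C_def field_simps)
    also have "\<dots> = onorm (\<lambda>u. (1 / Gamma p) *\<^sub>R J p u)"
      using Gamma_real_pos[OF p] by (simp add: onorm_scaleR[OF J_bounded_linear[OF p]])
    also have "(\<lambda>u. (1 / Gamma p) *\<^sub>R J p u) = neg_power Y A p" by (simp add: neg_power_eq fun_eq_iff)
    finally show ?thesis .
  qed
  ultimately show ?thesis by blast
qed

subsection \<open>Scalar asymptotic expansions\<close>

text \<open>\<open>expandable F y n f\<close> means that \<open>f\<close> has an asymptotic expansion in powers of the small quantity \<open>y\<close>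
  with remainder \<open>O(y ^ n)\<close>; peeling off one coefficient at a time makes the closure properties inductive.\<close>

primrec expandable :: "'x filter \<Rightarrow> ('x \<Rightarrow> real) \<Rightarrow> nat \<Rightarrow> ('x \<Rightarrow> 'b::real_normed_field) \<Rightarrow> bool" where
  "expandable F y 0 f \<longleftrightarrow> (\<exists>C. \<forall>\<^sub>F x in F. norm (f x) \<le> C)"
| "expandable F y (Suc n) f \<longleftrightarrow> (\<exists>l. expandable F y n (\<lambda>x. (f x - l) / of_real (y x)))"

lemma expandable_cong:
  assumes "\<forall>\<^sub>F x in F. f x = g x" "expandable F y n f"
  shows "expandable F y n g"
  using assms
proof (induction n arbitrary: f g)
  case 0
  then obtain C where "\<forall>\<^sub>F x in F. norm (f x) \<le> C" by auto
  with 0(1) have "\<forall>\<^sub>F x in F. norm (g x) \<le> C" by eventually_elim simp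
  then show ?case by auto
next
  case (Suc n)
  then obtain l where l: "expandable F y n (\<lambda>x. (f x - l) / of_real (y x))" by auto
  have "expandable F y n (\<lambda>x. (g x - l) / of_real (y x))"
    by (rule Suc.IH[OF _ l]) (use Suc(2) in \<open>auto elim: eventually_mono\<close>)
  then show ?case by auto
qed

locale small_quantity =
  fixes F :: "'x filter" and y :: "'x \<Rightarrow> real"
  assumes nontrivial: "F \<noteq> bot" and y_pos: "\<forall>\<^sub>F x in F. y x > 0" and y_lim: "(y \<longlongrightarrow> 0) F"
begin

lemma y_mult_bounded:
  fixes f :: "'x \<Rightarrow> 'b::real_normed_field"
  assumes "\<forall>\<^sub>F x in F. norm (f x) \<le> C"
  shows "((\<lambda>x. of_real (y x) * f x) \<longlongrightarrow> 0) F"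
proof (rule Lim_null_comparison)
  show "((\<lambda>x. y x * C) \<longlongrightarrow> 0) F" by (rule tendsto_mult_left_zero[OF y_lim])
  show "\<forall>\<^sub>F x in F. norm (of_real (y x) * f x) \<le> y x * C"
    using assms y_pos by eventually_elim (simp add: norm_mult)
qed

lemma bounded_of_tendsto:
  fixes f :: "'x \<Rightarrow> 'b::real_normed_field"
  assumes "(f \<longlongrightarrow> l) F" shows "expandable F y 0 f"
proof -
  have "\<forall>\<^sub>F x in F. norm (f x) < norm l + 1"
    by (rule order_tendstoD(2)[OF tendsto_norm[OF assms]]) simp
  then show ?thesis by (auto elim: eventually_mono intro!: exI[of _ "norm l + 1"])
qed

text \<open>A quotient by y that stays bounded forces l to be the limit of f; so the existential in
  \<open>expandable\<close> leaves no choice of coefficient.\<close>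

lemma expandable_limit:
  fixes f :: "'x \<Rightarrow> 'b::real_normed_field"
  assumes "expandable F y n (\<lambda>x. (f x - l) / of_real (y x))"
  shows "(f \<longlongrightarrow> l) F"
  using assms
proof (induction n arbitrary: f l)
  case 0
  then obtain C where "\<forall>\<^sub>F x in F. norm ((f x - l) / of_real (y x)) \<le> C" by auto
  from y_mult_bounded[OF this]
  have "((\<lambda>x. f x - l) \<longlongrightarrow> 0) F"
    by (rule Lim_transform_eventually) (use y_pos in eventually_elim, simp)
  then show ?case by (rule LIM_zero_cancel)
next
  case (Suc n)
  then obtain m where "expandable F y n (\<lambda>x. ((f x - l) / of_real (y x) - m) / of_real (y x))" by auto
  from bounded_of_tendsto[OF Suc.IH[OF this]]
  obtain C where "\<forall>\<^sub>F x in F. norm ((f x - l) / of_real (y x)) \<le> C" by auto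
  from y_mult_bounded[OF this]
  have "((\<lambda>x. f x - l) \<longlongrightarrow> 0) F"
    by (rule Lim_transform_eventually) (use y_pos in eventually_elim, simp)
  then show ?case by (rule LIM_zero_cancel)
qed

lemma expandable_bounded: "expandable F y n f \<Longrightarrow> expandable F y 0 f"
  by (cases n) (auto simp del: expandable.simps(1) dest: expandable_limit bounded_of_tendsto)

lemma expandable_Suc: "expandable F y (Suc n) f \<Longrightarrow> expandable F y n f"
proof (induction n arbitrary: f)
  case 0
  then show ?case by (rule expandable_bounded)
next
  case (Suc n)
  from Suc.prems obtain l where "expandable F y (Suc n) (\<lambda>x. (f x - l) / of_real (y x))"
    by (auto simp only: expandable.simps(2)[of F y "Suc n"])
  from Suc.IH[OF this] show ?case by auto
qed

lemma expandable_SucD: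
  assumes "expandable F y (Suc n) f" "(f \<longlongrightarrow> l) F"
  shows "expandable F y n (\<lambda>x. (f x - l) / of_real (y x))"
proof -
  obtain m where m: "expandable F y n (\<lambda>x. (f x - m) / of_real (y x))" using assms(1) by auto
  then have "m = l" using expandable_limit assms(2) nontrivial tendsto_unique by blast
  with m show ?thesis by simp
qed

lemma expandable_const: "expandable F y n (\<lambda>_. c)"
proof (induction n arbitrary: c)
  case (0 c)
  show ?case by (auto intro!: exI[of _ "norm c"])
next
  case (Suc n)
  have "expandable F y n (\<lambda>x. (c - c) / of_real (y x))" using Suc[of 0] by simp
  then show ?case unfolding expandable.simps by (rule exI)
qed

lemma expandable_add:
  "expandable F y n f \<Longrightarrow> expandable F y n g \<Longrightarrow> expandable F y n (\<lambda>x. f x + g x)"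
proof (induction n arbitrary: f g)
  case 0
  then obtain C D where "\<forall>\<^sub>F x in F. norm (f x) \<le> C" "\<forall>\<^sub>F x in F. norm (g x) \<le> D" by auto
  then have "\<forall>\<^sub>F x in F. norm (f x + g x) \<le> C + D"
    by eventually_elim (rule norm_triangle_mono)
  then show ?case by auto
next
  case (Suc n)
  then obtain l m where "expandable F y n (\<lambda>x. (f x - l) / of_real (y x))"
    "expandable F y n (\<lambda>x. (g x - m) / of_real (y x))" by auto
  from Suc.IH[OF this] have "expandable F y n (\<lambda>x. (f x + g x - (l + m)) / of_real (y x))"
    by (simp add: add_divide_distrib[symmetric] algebra_simps)
  then show ?case by auto
qed

text \<open>The quotient for the product is (f - l) / y times g plus l times (g - m) / y, and every
  piece is expandable to the lower order.\<close>

lemma expandable_mult: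
  "expandable F y n f \<Longrightarrow> expandable F y n g \<Longrightarrow> expandable F y n (\<lambda>x. f x * g x)"
proof (induction n arbitrary: f g)
  case 0
  then obtain C D where "\<forall>\<^sub>F x in F. norm (f x) \<le> C" "\<forall>\<^sub>F x in F. norm (g x) \<le> D" by auto
  then have "\<forall>\<^sub>F x in F. norm (f x * g x) \<le> \<bar>C\<bar> * \<bar>D\<bar>"
    by eventually_elim (auto simp: norm_mult intro!: mult_mono)
  then show ?case by auto
next
  case (Suc n)
  then obtain l m where f: "expandable F y n (\<lambda>x. (f x - l) / of_real (y x))"
    and g: "expandable F y n (\<lambda>x. (g x - m) / of_real (y x))" by auto
  have "expandable F y n (\<lambda>x. (f x - l) / of_real (y x) * g x + l * ((g x - m) / of_real (y x)))"
    by (intro expandable_add Suc.IH f g expandable_const expandable_Suc[OF Suc.prems(2)])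
  then have "expandable F y n (\<lambda>x. (f x * g x - l * m) / of_real (y x))"
    by (simp add: add_divide_distrib[symmetric] algebra_simps)
  then show ?case by auto
qed

text \<open>1/f - 1/l = -(1/l) (f - l) (1/f): the quotient involves 1/f to one order less, which the
  induction supplies.\<close>

lemma expandable_inverse:
  "expandable F y n f \<Longrightarrow> (f \<longlongrightarrow> l) F \<Longrightarrow> l \<noteq> 0 \<Longrightarrow> expandable F y n (\<lambda>x. inverse (f x))"
proof (induction n)
  case 0
  then show ?case using tendsto_inverse bounded_of_tendsto by blast
next
  case (Suc n)
  have ne: "\<forall>\<^sub>F x in F. f x \<noteq> 0" by (rule tendsto_imp_eventually_ne[OF Suc.prems(2,3)])
  have f: "expandable F y n (\<lambda>x. (f x - l) / of_real (y x))"
    by (rule expandable_SucD[OF Suc.prems(1,2)])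
  have "expandable F y n (\<lambda>x. (- inverse l * ((f x - l) / of_real (y x))) * inverse (f x))"
    by (intro expandable_mult f expandable_const Suc.IH Suc.prems expandable_Suc[OF Suc.prems(1)])
  moreover have "\<forall>\<^sub>F x in F. (- inverse l * ((f x - l) / of_real (y x))) * inverse (f x)
      = (inverse (f x) - inverse l) / of_real (y x)"
    using ne
  proof eventually_elim
    case (elim x)
    then have "- inverse l * (f x - l) * inverse (f x) = inverse (f x) - inverse l"
      using Suc.prems(3) by (simp add: field_simps)
    moreover have "(- inverse l * ((f x - l) / of_real (y x))) * inverse (f x)
        = (- inverse l * (f x - l) * inverse (f x)) / of_real (y x)"
      by (simp add: divide_inverse mult_ac)
    ultimately show ?case by (simp only:)
  qed
  ultimately have "expandable F y n (\<lambda>x. (inverse (f x) - inverse l) / of_real (y x))" by (rule expandable_cong[rotated])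
  then show ?case by auto
qed

text \<open>Splitting off the constant term leaves g / y times the power series with shifted
  coefficients, so the induction runs over all coefficient sequences.\<close>

lemma expandable_power_series:
  fixes c :: "nat \<Rightarrow> real"
  assumes K: "K > 0" and g0: "(g \<longlongrightarrow> 0) F"
  shows "summable (\<lambda>k. c k * K ^ k) \<Longrightarrow> expandable F y n g \<Longrightarrow> expandable F y n (\<lambda>x. \<Sum>k. c k * g x ^ k)"
proof (induction n arbitrary: c)
  case 0
  have "isCont (\<lambda>z. \<Sum>k. c k * z ^ k) 0" by (rule isCont_powser[OF 0(1)]) (use K in simp)
  from isCont_tendsto_compose[OF this g0] show ?case by (rule bounded_of_tendsto)
next
  case (Suc n)
  have sm: "summable (\<lambda>k. c (Suc k) * K ^ k)"
    using summable_mult[OF Suc.prems(1)[THEN summable_Suc_iff[THEN iffD2]], of "1 / K"] K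
    by (simp add: field_simps)
  have g: "expandable F y n (\<lambda>x. (g x - 0) / of_real (y x))"
    by (rule expandable_SucD[OF Suc.prems(2) g0])
  have "expandable F y n (\<lambda>x. (g x - 0) / of_real (y x) * (\<Sum>k. c (Suc k) * g x ^ k))"
    by (intro expandable_mult g Suc.IH sm expandable_Suc[OF Suc.prems(2)])
  moreover have "\<forall>\<^sub>F x in F. (g x - 0) / of_real (y x) * (\<Sum>k. c (Suc k) * g x ^ k)
      = ((\<Sum>k. c k * g x ^ k) - c 0) / of_real (y x)"
  proof -
    have "\<forall>\<^sub>F x in F. norm (g x) < K"
      by (rule order_tendstoD(2)[OF tendsto_norm_zero[OF g0] K])
    then show ?thesis
    proof eventually_elim
      case (elim x)
      then have "summable (\<lambda>k. c k * g x ^ k)" "summable (\<lambda>k. c (Suc k) * g x ^ k)"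
        using powser_inside[OF Suc.prems(1), of "g x"] powser_inside[OF sm, of "g x"] K by auto
      from suminf_split_head[OF this(1)] suminf_mult[OF this(2), of "g x"]
      show ?case by (simp add: algebra_simps)
    qed
  qed
  ultimately have "expandable F y n (\<lambda>x. ((\<Sum>k. c k * g x ^ k) - c 0) / of_real (y x))" by (rule expandable_cong[rotated])
  then show ?case by auto
qed

text \<open>With g = l (1 + u) and u tending to 0 this is the binomial series in u.\<close>

lemma expandable_powr:
  fixes g :: "'x \<Rightarrow> real"
  assumes g: "expandable F y n g" "(g \<longlongrightarrow> l) F" and l: "l > 0"
  shows "expandable F y n (\<lambda>x. g x powr r)"
proof -
  define u where "u x = g x * inverse l + - 1" for x
  have u: "expandable F y n u" unfolding u_def by (intro expandable_add expandable_mult g expandable_const)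
  have "(u \<longlongrightarrow> l * inverse l + - 1) F" unfolding u_def by (intro tendsto_intros g)
  then have u0: "(u \<longlongrightarrow> 0) F" using l by simp
  have "summable (\<lambda>k. (r gchoose k) * (1 / 2) ^ k)"
    using gen_binomial_real[of "1 / 2" r] by (simp add: sums_iff)
  then have "expandable F y n (\<lambda>x. \<Sum>k. (r gchoose k) * u x ^ k)"
    by (intro expandable_power_series[OF _ u0 _ u]) auto
  then have "expandable F y n (\<lambda>x. l powr r * (\<Sum>k. (r gchoose k) * u x ^ k))"
    by (intro expandable_mult expandable_const)
  moreover have "\<forall>\<^sub>F x in F. l powr r * (\<Sum>k. (r gchoose k) * u x ^ k) = g x powr r"
  proof -
    have "\<forall>\<^sub>F x in F. norm (u x) < 1"
      by (rule order_tendstoD(2)[OF tendsto_norm_zero[OF u0]]) simp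
    then show ?thesis
    proof eventually_elim
      case (elim x)
      then have "(\<Sum>k. (r gchoose k) * u x ^ k) = (1 + u x) powr r"
        using gen_binomial_real[of "u x" r] by (simp add: sums_iff)
      moreover have "1 + u x > 0" "g x = l * (1 + u x)" using elim l by (auto simp: u_def)
      ultimately show ?case using l by (simp add: powr_mult)
    qed
  qed
  ultimately show ?thesis by (rule expandable_cong[rotated])
qed

lemma expandable_of_real:
  "expandable F y n f \<Longrightarrow> expandable F y n (\<lambda>x. of_real (f x) :: 'b::real_normed_field)"
proof (induction n arbitrary: f)
  case (Suc n)
  then obtain l where "expandable F y n (\<lambda>x. (f x - l) / of_real (y x))" by auto
  from Suc.IH[OF this] have "expandable F y n (\<lambda>x. (of_real (f x) - of_real l) / of_real (y x) :: 'b)" by simp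
  then show ?case by auto
qed simp

section \<open>Poincare expansions and change of the small quantity\<close>

lemma expandable_of_expansion:
  fixes f :: "'x \<Rightarrow> 'b::real_normed_field"
  assumes "\<And>N. \<exists>C. \<forall>\<^sub>F x in F. norm (f x - (\<Sum>s<N. c s * of_real (y x) ^ s)) \<le> C * y x ^ N"
  shows "expandable F y n f"
  using assms
proof (induction n arbitrary: f c)
  case 0
  from 0[of 0] show ?case by simp
next
  case (Suc n)
  have "\<exists>C. \<forall>\<^sub>F x in F. norm ((f x - c 0) / of_real (y x) - (\<Sum>s<N. c (Suc s) * of_real (y x) ^ s)) \<le> C * y x ^ N" for N
  proof -
    obtain C where "\<forall>\<^sub>F x in F. norm (f x - (\<Sum>s<Suc N. c s * of_real (y x) ^ s)) \<le> C * y x ^ Suc N"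
      using Suc.prems by blast
    then have "\<forall>\<^sub>F x in F. norm ((f x - c 0) / of_real (y x) - (\<Sum>s<N. c (Suc s) * of_real (y x) ^ s)) \<le> C * y x ^ N"
      using y_pos
    proof eventually_elim
      case (elim x)
      have "(\<Sum>s<Suc N. c s * of_real (y x) ^ s) = c 0 + of_real (y x) * (\<Sum>s<N. c (Suc s) * of_real (y x) ^ s)"
        unfolding sum.lessThan_Suc_shift by (simp add: sum_distrib_left mult_ac)
      then have "(f x - c 0) / of_real (y x) - (\<Sum>s<N. c (Suc s) * of_real (y x) ^ s)
          = (f x - (\<Sum>s<Suc N. c s * of_real (y x) ^ s)) / of_real (y x)"
        using elim(2) by (simp add: field_simps)
      then show ?case using elim by (simp add: norm_divide field_simps)
    qed
    then show ?thesis by blast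
  qed
  from Suc.IH[OF this] show ?case by auto
qed

lemma expandable_of_poincare:
  fixes f :: "'x \<Rightarrow> 'b::real_normed_field"
  assumes "poincare_expansion F f (\<lambda>s x. y x powr (real s + \<delta>)) c"
  shows "expandable F y n (\<lambda>x. f x / of_real (y x powr \<delta>))" "((\<lambda>x. f x / of_real (y x powr \<delta>)) \<longlongrightarrow> c 0) F"
proof -
  have powr: "y x powr (real s + \<delta>) = y x powr \<delta> * y x ^ s" if "y x > 0" for x s
    using that by (simp add: powr_add powr_realpow)
  have E: "\<exists>C. \<forall>\<^sub>F x in F. norm (f x / of_real (y x powr \<delta>) - (\<Sum>s<N. c s * of_real (y x) ^ s)) \<le> C * y x ^ N" for N
  proof -
    have "(\<lambda>x. f x - (\<Sum>s\<le>N. c s * of_real (y x powr (real s + \<delta>)))) \<in> o[F](\<lambda>x. of_real (y x powr (real N + \<delta>)))"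
      using assms by (simp add: poincare_expansion_def)
    from landau_o.smallD[OF this zero_less_one]
    have "\<forall>\<^sub>F x in F. norm (f x - (\<Sum>s\<le>N. c s * of_real (y x powr (real s + \<delta>)))) \<le> y x powr (real N + \<delta>)"
      by simp
    \<comment> \<open>The term of index N is moved into the remainder, which turns o(y^N) into
      O(y^N) and adds \<open>norm (c N)\<close> to the constant.\<close>
    then have "\<forall>\<^sub>F x in F. norm (f x / of_real (y x powr \<delta>) - (\<Sum>s<N. c s * of_real (y x) ^ s)) \<le> (1 + norm (c N)) * y x ^ N"
      using y_pos
    proof eventually_elim
      case (elim x)
      define S where "S = (\<Sum>s<N. c s * of_real (y x) ^ s)"
      define p where "p = y x powr \<delta>"
      have p: "p > 0" using elim by (simp add: p_def)
      have "(\<Sum>s\<le>N. c s * of_real (y x powr (real s + \<delta>))) = of_real p * (S + c N * of_real (y x) ^ N)"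
        unfolding lessThan_Suc_atMost[symmetric] S_def p_def
        by (simp add: powr[OF elim(2)] sum_distrib_left mult_ac distrib_left)
      then have "norm (f x - of_real p * (S + c N * of_real (y x) ^ N)) \<le> p * y x ^ N"
        using elim powr[OF elim(2), of N] by (simp add: p_def)
      moreover have "f x - of_real p * (S + c N * of_real (y x) ^ N)
          = of_real p * (f x / of_real p - S - c N * of_real (y x) ^ N)"
        using p by (simp add: field_simps)
      ultimately have "norm (f x / of_real p - S - c N * of_real (y x) ^ N) \<le> y x ^ N"
        using p by (simp add: norm_mult)
      then have "norm (f x / of_real p - S) \<le> y x ^ N + norm (c N * of_real (y x) ^ N)"
        using norm_triangle_sub[of "f x / of_real p - S" "c N * of_real (y x) ^ N"] by linarith
      then show ?case using elim by (simp add: norm_mult norm_power S_def p_def algebra_simps)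
    qed
    then show ?thesis by blast
  qed
  show "expandable F y n (\<lambda>x. f x / of_real (y x powr \<delta>))" by (rule expandable_of_expansion[OF E])
  obtain C where "\<forall>\<^sub>F x in F. norm (f x / of_real (y x powr \<delta>) - c 0) \<le> C * y x" using E[of 1] by auto
  then have "((\<lambda>x. f x / of_real (y x powr \<delta>) - c 0) \<longlongrightarrow> 0) F"
    by (rule Lim_null_comparison) (rule tendsto_mult_right_zero[OF y_lim])
  then show "((\<lambda>x. f x / of_real (y x powr \<delta>)) \<longlongrightarrow> c 0) F" by (rule LIM_zero_cancel)
qed

text \<open>Passing from y to v = y V changes a quotient (f - l) / y only by the factor 1/V, so
  coefficients can be peeled off in powers of v instead. Expandability to all orders is carried
  along in \<open>E\<close> because each peeling loses one order.\<close>

lemma expansion_in_equivalent_quantity: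
  fixes f :: "'x \<Rightarrow> 'b::real_normed_field"
  assumes f: "\<And>n. expandable F y n f" and V: "\<And>n. expandable F y n V" "(V \<longlongrightarrow> l) F" "l \<noteq> (0::real)"
  obtains c C where "\<And>N. \<forall>\<^sub>F x in F. norm (f x - (\<Sum>s<N. c s * of_real (y x * V x) ^ s)) \<le> C N * \<bar>y x * V x\<bar> ^ N"
proof -
  define v where "v x = y x * V x" for x
  define E where "E f \<longleftrightarrow> (\<forall>n. expandable F y n f)" for f :: "'x \<Rightarrow> 'b"
  have step: "\<exists>l. E (\<lambda>x. (f x - l) / of_real (v x))" if "E f" for f
  proof -
    have "\<exists>l. expandable F y 0 (\<lambda>x. (f x - l) / of_real (y x))"
      using that by (simp only: E_def flip: expandable.simps(2))
    then obtain m where m: "(f \<longlongrightarrow> m) F" using expandable_limit by blast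
    have fm: "expandable F y n (\<lambda>x. (f x - m) / of_real (y x))" for n
      by (rule expandable_SucD[OF _ m]) (use that in \<open>simp only: E_def\<close>)
    have "expandable F y n (\<lambda>x. (f x - m) / of_real (y x) * of_real (inverse (V x)))" for n
      by (intro expandable_mult fm expandable_of_real expandable_inverse[OF V(1) V(2) V(3)])
    moreover have "(f x - m) / of_real (y x) * of_real (inverse (V x)) = (f x - m) / of_real (v x)" for x
      by (simp add: v_def divide_inverse mult_ac)
    ultimately show ?thesis by (auto simp: E_def)
  qed
  define L where "L f = (SOME l. E (\<lambda>x. (f x - l) / of_real (v x)))" for f
  \<comment> \<open>\<open>g k\<close> is what remains after k peelings: f is a polynomial of degree
    below k in v plus v^k times \<open>g k\<close>.\<close>
  define g where "g k = ((\<lambda>f x. (f x - L f) / of_real (v x)) ^^ k) f" for k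
  have g0: "g 0 = f" and gS: "g (Suc k) = (\<lambda>x. (g k x - L (g k)) / of_real (v x))" for k
    by (simp_all add: g_def)
  have Eg: "E (g k)" for k
  proof (induction k)
    case (Suc k)
    show ?case unfolding gS L_def by (rule someI_ex[OF step[OF Suc]])
  qed (use f in \<open>simp add: g0 E_def\<close>)
  have "\<exists>C. \<forall>\<^sub>F x in F. norm (g k x) \<le> C" for k using Eg[of k] unfolding E_def by (metis expandable.simps(1))
  then obtain C where C: "\<And>k. \<forall>\<^sub>F x in F. norm (g k x) \<le> C k" by metis
  have v: "\<forall>\<^sub>F x in F. v x \<noteq> 0"
    using y_pos tendsto_imp_eventually_ne[OF V(2,3)] by eventually_elim (simp add: v_def)
  have "\<forall>\<^sub>F x in F. norm (f x - (\<Sum>s<N. L (g s) * of_real (v x) ^ s)) \<le> C N * \<bar>v x\<bar> ^ N" for N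
    using v C[of N]
  proof eventually_elim
    case (elim x)
    have "f x = (\<Sum>s<k. L (g s) * of_real (v x) ^ s) + of_real (v x) ^ k * g k x" for k
    proof (induction k)
      case (Suc k)
      have "g k x = L (g k) + of_real (v x) * g (Suc k) x" using elim(1) by (simp add: gS)
      with Suc show ?case by (simp add: algebra_simps)
    qed (simp add: g0)
    then have "f x - (\<Sum>s<N. L (g s) * of_real (v x) ^ s) = of_real (v x) ^ N * g N x"
      by (metis add_diff_cancel_left')
    then show ?case using elim(2) by (simp add: norm_mult norm_power mult.commute mult_right_mono)
  qed
  then show ?thesis using that[of "\<lambda>s. L (g s)" C] by (simp add: v_def)
qed

end

section \<open>Coefficients of the quotient of \<phi> by the derivative of h\<close>

lemma poincare_expansion_unique:
  fixes f :: "'x \<Rightarrow> 'b::real_normed_field"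
  assumes F: "F \<noteq> bot" and g: "\<And>s. \<forall>\<^sub>F x in F. g s x \<noteq> 0"
    and c: "poincare_expansion F f g c" and d: "poincare_expansion F f g d"
  shows "c = d"
proof
  fix N
  show "c N = d N"
  proof (induction N rule: less_induct)
    case (less N)
    let ?r = "\<lambda>c x. f x - (\<Sum>s\<le>N. c s * of_real (g s x))"
    have r: "?r c \<in> o[F](\<lambda>x. of_real (g N x))" "?r d \<in> o[F](\<lambda>x. of_real (g N x))"
      using c d by (auto simp only: poincare_expansion_def)
    have "(\<lambda>x. ?r d x - ?r c x) \<in> o[F](\<lambda>x. of_real (g N x))"
      by (rule sum_in_smallo(2)[OF r(2,1)])
    moreover have "?r d x - ?r c x = (c N - d N) * of_real (g N x)" for x
    proof -
      have "(\<Sum>s<N. c s * of_real (g s x)) = (\<Sum>s<N. d s * of_real (g s x))"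
        using less by (intro sum.cong) auto
      then show ?thesis by (simp add: lessThan_Suc_atMost[symmetric] algebra_simps)
    qed
    ultimately have "(\<lambda>x. (c N - d N) * of_real (g N x)) \<in> o[F](\<lambda>x. of_real (g N x))" by simp
    from smalloD_tendsto[OF this]
    have "((\<lambda>x. (c N - d N) * of_real (g N x) / of_real (g N x)) \<longlongrightarrow> 0) F" .
    then have "((\<lambda>x. c N - d N) \<longlongrightarrow> 0) F"
      by (rule Lim_transform_eventually) (use g[of N] in eventually_elim, simp)
    then show ?case using F by (simp add: tendsto_const_iff)
  qed
qed

text \<open>Divided by their leading powers of y = x - a, the functions t, d and \<phi> become
  \<open>H\<close>, \<open>D\<close>, \<open>P\<close> with ordinary power expansions. Then \<phi>/d
  = t^e \<Phi> with e = (lam - mu)/mu, and t^(1/mu) = y V where V has the positive limit a_0^(1/mu);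
  so \<Phi> can be re-expanded in t^(1/mu), and the gauges are t^e times the powers of that
  quantity.\<close>

lemma ratio_expansion:
  fixes t d :: "real \<Rightarrow> real" and \<phi> :: "real \<Rightarrow> complex" and as :: "nat \<Rightarrow> real" and bs :: "nat \<Rightarrow> complex"
  assumes t: "poincare_expansion (at_right a) t (\<lambda>s x. (x - a) powr (real s + mu)) as"
    and d: "poincare_expansion (at_right a) d (\<lambda>s x. (x - a) powr (real s + mu - 1)) (\<lambda>s. (real s + mu) * as s)"
    and \<phi>: "poincare_expansion (at_right a) \<phi> (\<lambda>s x. (x - a) powr (real s + lam - 1)) bs"
    and pos: "lam > 0" "mu > 0" "as 0 > 0"
  defines "E \<equiv> poincare_expansion (at_right a) (\<lambda>x. \<phi> x / complex_of_real (d x))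
      (\<lambda>s x. t x powr ((real s + lam - mu) / mu))"
  shows ratio_expansion_ex1: "\<exists>!c. E c"
    and ratio_expansion_leading: "E c \<Longrightarrow> c 0 = bs 0 / complex_of_real mu * complex_of_real (as 0 powr (- (lam / mu)))"
    and ratio_expansion_pos: "\<forall>\<^sub>F x in at_right a. t x > 0" "\<forall>\<^sub>F x in at_right a. d x > 0"
    and ratio_expansion_tendsto_0: "(t \<longlongrightarrow> 0) (at_right a)"
proof -
  define y where "y x = x - a" for x
  interpret small_quantity "at_right a" y
  proof
    show "\<forall>\<^sub>F x in at_right a. y x > 0" by (auto simp: y_def eventually_at_filter)
    have "((\<lambda>x. x - a) \<longlongrightarrow> a - a) (at_right a)" by (intro tendsto_intros)
    then show "(y \<longlongrightarrow> 0) (at_right a)" by (simp add: y_def[abs_def])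
  qed simp
  define H where "H x = t x / y x powr mu" for x
  define D where "D x = d x / y x powr (mu - 1)" for x
  define P where "P x = \<phi> x / complex_of_real (y x powr (lam - 1))" for x
  have H: "expandable (at_right a) y n H" "(H \<longlongrightarrow> as 0) (at_right a)" for n
    using expandable_of_poincare[of t mu as] t by (simp_all add: y_def H_def[abs_def])
  have D: "expandable (at_right a) y n D" "(D \<longlongrightarrow> mu * as 0) (at_right a)" for n
    using expandable_of_poincare[of d "mu - 1" "\<lambda>s. (real s + mu) * as s"] d
    by (simp_all add: y_def D_def[abs_def] add_diff_eq)
  have P: "expandable (at_right a) y n P" "(P \<longlongrightarrow> bs 0) (at_right a)" for n
    using expandable_of_poincare[of \<phi> "lam - 1" bs] \<phi> by (simp_all add: y_def P_def[abs_def] add_diff_eq)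
  have H_pos: "\<forall>\<^sub>F x in at_right a. H x > 0" by (rule order_tendstoD(1)[OF H(2) pos(3)])
  have D_pos: "\<forall>\<^sub>F x in at_right a. D x > 0" by (rule order_tendstoD(1)[OF D(2)]) (use pos in simp)
  show t_pos: "\<forall>\<^sub>F x in at_right a. t x > 0"
    using H_pos y_pos by eventually_elim (simp add: H_def zero_less_divide_iff)
  show "\<forall>\<^sub>F x in at_right a. d x > 0"
    using D_pos y_pos by eventually_elim (simp add: D_def zero_less_divide_iff)
  have y_nonneg: "\<forall>\<^sub>F x in at_right a. 0 \<le> y x" using y_pos by eventually_elim simp
  have ymu: "((\<lambda>x. y x powr mu) \<longlongrightarrow> 0) (at_right a)"
    using tendsto_powr'[OF y_lim tendsto_const[of mu]] pos y_nonneg by simp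
  have "\<forall>\<^sub>F x in at_right a. y x powr mu * H x = t x"
    using y_pos by eventually_elim (simp add: H_def)
  from Lim_transform_eventually[OF tendsto_mult[OF ymu H(2)] this]
  show "(t \<longlongrightarrow> 0) (at_right a)" by simp
  define e where "e = (lam - mu) / mu"
  define \<Phi> where "\<Phi> x = P x * of_real (inverse (D x)) * of_real (H x powr (- e))" for x
  define V where "V x = H x powr (1 / mu)" for x
  have \<Phi>: "expandable (at_right a) y n \<Phi>" for n
    unfolding \<Phi>_def[abs_def] using pos
    by (intro expandable_mult P expandable_of_real expandable_inverse[OF D] expandable_powr[OF H]) auto
  have \<Phi>_lim: "(\<Phi> \<longlongrightarrow> bs 0 * of_real (inverse (mu * as 0)) * of_real (as 0 powr (- e))) (at_right a)"
    unfolding \<Phi>_def[abs_def] using pos by (intro tendsto_intros P D H) auto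
  have V: "expandable (at_right a) y n V" "(V \<longlongrightarrow> as 0 powr (1 / mu)) (at_right a)" for n
    unfolding V_def[abs_def] using pos by (intro expandable_powr[OF H] tendsto_intros H; simp)+
  have ratio: "\<forall>\<^sub>F x in at_right a. \<phi> x / complex_of_real (d x) = of_real (t x powr e) * \<Phi> x"
    using H_pos D_pos y_pos
  proof eventually_elim
    case (elim x)
    have eq: "\<phi> x = P x * of_real (y x powr (lam - 1))" "d x = D x * y x powr (mu - 1)" "t x = H x * y x powr mu"
      using elim by (simp_all add: P_def D_def H_def)
    have "t x powr e = H x powr e * y x powr (lam - mu)"
      unfolding eq(3) using elim pos by (simp add: powr_mult powr_powr e_def)
    moreover have "y x powr (lam - 1) = y x powr (lam - mu) * y x powr (mu - 1)"
      by (simp flip: powr_add)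
    moreover have "H x powr e * H x powr (- e) = 1" using elim by (simp flip: powr_add)
    then have "complex_of_real (H x powr e) * of_real (H x powr (- e)) = 1" by (simp flip: of_real_mult)
    ultimately show ?case
      unfolding eq(1,2) \<Phi>_def using elim by (simp add: field_simps)
  qed
  have v: "\<forall>\<^sub>F x in at_right a. y x * V x = t x powr (1 / mu)"
    using H_pos y_pos
  proof eventually_elim
    case (elim x)
    then have "t x = H x * y x powr mu" by (simp add: H_def)
    then show ?case using elim pos by (simp add: V_def powr_mult powr_powr)
  qed
  have gauge: "\<forall>\<^sub>F x in at_right a. \<forall>s. t x powr ((real s + lam - mu) / mu) = t x powr e * (y x * V x) ^ s"
    using v t_pos
  proof eventually_elim
    case (elim x)
    have "t x powr ((real s + lam - mu) / mu) = t x powr e * (y x * V x) ^ s" for s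
    proof -
      have "(real s + lam - mu) / mu = e + (1 / mu) * real s"
        by (simp add: e_def add_divide_distrib diff_divide_distrib)
      then have "t x powr ((real s + lam - mu) / mu) = t x powr e * t x powr ((1 / mu) * real s)"
        by (simp only: powr_add)
      also have "t x powr ((1 / mu) * real s) = (t x powr (1 / mu)) ^ s"
        using powr_realpow[of "t x powr (1 / mu)" s] elim(2) by (simp add: powr_powr)
      finally show ?thesis using elim by simp
    qed
    then show ?case by blast
  qed
  have vpos: "\<forall>\<^sub>F x in at_right a. y x * V x > 0" using v t_pos by eventually_elim simp
  have "\<exists>c. E c"
  proof -
    obtain c C where c: "\<And>N. \<forall>\<^sub>F x in at_right a.
        norm (\<Phi> x - (\<Sum>s<N. c s * of_real (y x * V x) ^ s)) \<le> C N * \<bar>y x * V x\<bar> ^ N"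
      by (rule expansion_in_equivalent_quantity[OF \<Phi> V]) (use pos in auto)
    have "E c"
      unfolding E_def poincare_expansion_def
    proof
      fix N
      let ?g = "\<lambda>s x. complex_of_real (t x powr ((real s + lam - mu) / mu))"
      show "(\<lambda>x. \<phi> x / complex_of_real (d x) - (\<Sum>s\<le>N. c s * ?g s x)) \<in> o[at_right a](?g N)"
      proof (rule smalloI_tendsto)
        show "\<forall>\<^sub>F x in at_right a. ?g N x \<noteq> 0" using t_pos by eventually_elim simp
        have "((\<lambda>x. y x * V x) \<longlongrightarrow> 0 * as 0 powr (1 / mu)) (at_right a)" by (intro tendsto_mult y_lim V)
        \<comment> \<open>The expansion is used at order \<open>Suc N\<close>: after division by the
          N-th power of v = y V its remainder keeps one factor v, which tends to 0.\<close>
        then have z: "((\<lambda>x. C (Suc N) * (y x * V x)) \<longlongrightarrow> 0) (at_right a)"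
          by (intro tendsto_mult_right_zero) simp
        show "((\<lambda>x. (\<phi> x / complex_of_real (d x) - (\<Sum>s\<le>N. c s * ?g s x)) / ?g N x) \<longlongrightarrow> 0) (at_right a)"
        proof (rule Lim_null_comparison[OF _ z])
          show "\<forall>\<^sub>F x in at_right a. norm ((\<phi> x / complex_of_real (d x) - (\<Sum>s\<le>N. c s * ?g s x)) / ?g N x)
              \<le> C (Suc N) * (y x * V x)"
            using c[of "Suc N"] ratio gauge vpos t_pos
          proof eventually_elim
            case (elim x)
            define u where "u = y x * V x"
            define R where "R = \<Phi> x - (\<Sum>s\<le>N. c s * of_real u ^ s)"
            have u: "u > 0" using elim by (simp add: u_def)
            have te: "t x powr e > 0" using elim by simp
            have g: "?g s x = of_real (t x powr e) * of_real u ^ s" for s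
              using elim(3) by (simp add: u_def)
            have "(\<phi> x / complex_of_real (d x) - (\<Sum>s\<le>N. c s * ?g s x)) = of_real (t x powr e) * R"
              unfolding g R_def elim(2) by (simp add: sum_distrib_left algebra_simps)
            then have "norm ((\<phi> x / complex_of_real (d x) - (\<Sum>s\<le>N. c s * ?g s x)) / ?g N x) = norm R / u ^ N"
              unfolding g using te u by (simp add: norm_divide norm_mult norm_power)
            also have "norm R \<le> C (Suc N) * u ^ Suc N"
              using elim(1) u by (simp add: R_def u_def[symmetric] lessThan_Suc_atMost)
            then have "norm R / u ^ N \<le> C (Suc N) * u" using u by (simp add: field_simps)
            finally show ?case by (simp add: u_def)
          qed
        qed
      qed
    qed
    then show ?thesis by blast
  qed
  moreover have "c = c'" if "E c" "E c'" for c c'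
    using that unfolding E_def
    by (rule poincare_expansion_unique[rotated 2]) (use t_pos in \<open>auto elim: eventually_mono\<close>)
  ultimately show "\<exists>!c. E c" by blast
  assume "E c"
  then have "(\<lambda>x. \<phi> x / complex_of_real (d x) - c 0 * of_real (t x powr e)) \<in> o[at_right a](\<lambda>x. of_real (t x powr e))"
    unfolding E_def poincare_expansion_def by (force simp: e_def dest: spec[of _ 0])
  from smalloD_tendsto[OF this]
  have "((\<lambda>x. (\<phi> x / complex_of_real (d x) - c 0 * of_real (t x powr e)) / of_real (t x powr e)) \<longlongrightarrow> 0) (at_right a)" .
  then have "((\<lambda>x. \<Phi> x - c 0) \<longlongrightarrow> 0) (at_right a)"
  proof (rule Lim_transform_eventually)
    show "\<forall>\<^sub>F x in at_right a. (\<phi> x / complex_of_real (d x) - c 0 * of_real (t x powr e)) / of_real (t x powr e) = \<Phi> x - c 0"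
      using ratio t_pos by eventually_elim (simp add: field_simps)
  qed
  then have "(\<Phi> \<longlongrightarrow> c 0) (at_right a)" by (rule LIM_zero_cancel)
  then have "c 0 = bs 0 * of_real (inverse (mu * as 0)) * of_real (as 0 powr (- e))"
    using \<Phi>_lim nontrivial tendsto_unique by blast
  also have "\<dots> = bs 0 * of_real (inverse (mu * as 0) * as 0 powr (- e))" by (simp add: mult.assoc)
  also have "inverse (mu * as 0) * as 0 powr (- e) = inverse mu * as 0 powr (- (lam / mu))"
  proof -
    have "- e = 1 + - (lam / mu)" using pos by (simp add: e_def field_simps)
    then have "as 0 powr (- e) = as 0 * as 0 powr (- (lam / mu))" using pos by (simp only: powr_add) simp
    then show ?thesis using pos by simp
  qed
  finally show "c 0 = bs 0 / complex_of_real mu * complex_of_real (as 0 powr (- (lam / mu)))"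
    by (simp add: divide_inverse)
qed

subsection \<open>Laplace integrals of a semigroup\<close>

text \<open>No measurability of \<open>g\<close> is assumed: where \<open>\<phi>\<close> does not vanish, \<open>exp (- g x)\<close> is the quotient of
  the two integrands.\<close>

lemma truncated_absolutely_integrable:
  fixes \<phi> :: "real \<Rightarrow> complex" and g :: "real \<Rightarrow> real"
  assumes 0: "(\<lambda>x. \<phi> x * of_real (exp (- c * g x))) absolutely_integrable_on S"
    and 1: "(\<lambda>x. \<phi> x * of_real (exp (- (c + 1) * g x))) absolutely_integrable_on S"
  shows "(\<lambda>x. if g x < r then \<phi> x * of_real (exp (- c * g x)) else 0) absolutely_integrable_on S"
proof -
  let ?f = "\<lambda>x. indicator S x *\<^sub>R (\<phi> x * of_real (exp (- c * g x)))"
  let ?f1 = "\<lambda>x. indicator S x *\<^sub>R (\<phi> x * of_real (exp (- (c + 1) * g x)))"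
  have [measurable]: "?f \<in> borel_measurable lebesgue" "?f1 \<in> borel_measurable lebesgue"
    using 0 1 by (auto simp: set_integrable_def)
  \<comment> \<open>At points of \<open>S\<close> where \<phi> is nonzero the inequality says exp
    (-g x) > exp (-r), that is g x < r.\<close>
  define W where "W = {x \<in> space lebesgue. norm (?f1 x) > exp (- r) * norm (?f x)}"
  have W: "W \<in> sets lebesgue" unfolding W_def by measurable
  have iff: "x \<in> W \<longleftrightarrow> x \<in> S \<and> \<phi> x \<noteq> 0 \<and> g x < r" for x
  proof (cases "x \<in> S \<and> \<phi> x \<noteq> 0")
    case True
    have "exp (- (c + 1) * g x) = exp (- g x) * exp (- c * g x)" by (simp add: algebra_simps flip: exp_add)
    then have "norm (?f1 x) = exp (- g x) * norm (?f x)" using True by (simp add: norm_mult)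
    moreover have "norm (?f x) > 0" using True by simp
    ultimately show ?thesis using True by (simp add: W_def)
  qed (auto simp: W_def)
  have "(\<lambda>x. \<phi> x * of_real (exp (- c * g x))) absolutely_integrable_on W"
    by (rule set_integrable_subset[OF 0 W]) (auto simp: iff)
  moreover have "(\<lambda>x. indicator W x *\<^sub>R (\<phi> x * of_real (exp (- c * g x))))
      = (\<lambda>x. indicator S x *\<^sub>R (if g x < r then \<phi> x * of_real (exp (- c * g x)) else 0))"
    by (auto simp: fun_eq_iff indicator_def iff)
  ultimately show ?thesis by (simp add: set_integrable_def)
qed

text \<open>\<open>g\<close> will be h - h(a) and \<open>d\<close> its derivative near a.
  Integrability is recorded at the two exponents c and c + 1 because the quotient of the integrands
  is what gives access to the sublevel sets of \<open>g\<close>.\<close>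

locale laplace_integral =
  fixes a :: real and b :: ereal and g d :: "real \<Rightarrow> real" and \<phi> :: "real \<Rightarrow> complex" and c r :: real
  assumes g_a: "g a = 0" and g_pos: "\<And>x. x \<in> einterval a b \<Longrightarrow> g x > 0"
    and int: "(\<lambda>x. \<phi> x * of_real (exp (- c * g x))) absolutely_integrable_on einterval a b"
      "(\<lambda>x. \<phi> x * of_real (exp (- (c + 1) * g x))) absolutely_integrable_on einterval a b"
    and r: "r > 0" "ereal (a + r) \<le> b"
    and deriv: "\<And>x. x \<in> {a<..<a + r} \<Longrightarrow> (g has_real_derivative d x) (at x)"
    and g_lim: "(g \<longlongrightarrow> 0) (at_right a)"
begin

abbreviation "S \<equiv> einterval (ereal a) b"

lemma truncated_integrable:
  assumes R: "R \<in> sets lebesgue" "R \<subseteq> S"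
  shows "(\<lambda>x. if g x < s then \<phi> x * of_real (exp (- c * g x)) else 0) integrable_on R"
    and "(\<lambda>x. cmod (\<phi> x) * exp (- c * g x)) integrable_on R"
proof -
  show "(\<lambda>x. if g x < s then \<phi> x * of_real (exp (- c * g x)) else 0) integrable_on R"
    by (rule set_lebesgue_integral_eq_integral(1)[OF set_integrable_subset[OF truncated_absolutely_integrable[OF int] R]])
  have "(\<lambda>x. norm (\<phi> x * of_real (exp (- c * g x)))) integrable_on R"
    by (rule set_lebesgue_integral_eq_integral(1)[OF set_integrable_norm[OF set_integrable_subset[OF int(1) R]]])
  then show "(\<lambda>x. cmod (\<phi> x) * exp (- c * g x)) integrable_on R" by (simp add: norm_mult)
qed

lemma S_sets: "S \<in> sets lebesgue"
  by (rule sets_completionI_sets) (simp add: borel_einterval)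

end

section \<open>The Laplace integral of the semigroup\<close>

locale laplace_semigroup = hille_yosida Y A M w + laplace_integral a b g d \<phi> c r
  for Y :: "'a::complex_banach set" and A M w a b g d \<phi> c r +
  assumes w_gt: "w > c"
begin

lemma laplace_integrable:
  assumes R: "R \<in> sets lebesgue" "R \<subseteq> S"
  shows "(\<lambda>x. \<phi> x *\<^sub>C T (g x) u) integrable_on R"
proof (rule kernel_integrable[OF T_continuous _ w_gt _ truncated_integrable[OF R]])
  show "norm (T t u) \<le> M * norm u * exp (- w * t)" if "t \<ge> 0" for t
    using T_norm[OF that, of u] by (simp add: mult_ac)
  show "g x \<ge> 0" if "x \<in> R" for x using g_pos[of x] R(2) that by auto
qed

definition L :: "'a \<Rightarrow> 'a" where "L u = integral S (\<lambda>x. \<phi> x *\<^sub>C T (g x) u)"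

lemma L_bounded_clinear: "bounded_clinear L"
proof (rule bounded_clinearI)
  note i = laplace_integrable[OF S_sets order_refl]
  have g0: "x \<in> S \<Longrightarrow> g x \<ge> 0" for x using g_pos[of x] by simp
  fix u v :: 'a and z
  show "L (u + v) = L u + L v"
    unfolding L_def integral_add[OF i i, symmetric]
    by (rule integral_cong) (use linear_add[OF T_linear[OF g0]] in \<open>simp add: scaleC_add_right\<close>)
  have "L (z *\<^sub>C u) = integral S ((\<lambda>v. z *\<^sub>C v) \<circ> (\<lambda>x. \<phi> x *\<^sub>C T (g x) u))"
    unfolding L_def
    by (rule integral_cong)
       (use T_bounded_clinear[OF g0] in \<open>simp add: bounded_clinear_def scaleC_scaleC mult.commute\<close>)
  also have "\<dots> = z *\<^sub>C L u" unfolding L_def by (rule integral_linear[OF i bounded_linear_scaleC])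
  finally show "L (z *\<^sub>C u) = z *\<^sub>C L u" .
  have "norm (L u) \<le> integral S (\<lambda>x. (M * norm u) * (cmod (\<phi> x) * exp (- c * g x)))"
    unfolding L_def
  proof (rule integral_norm_bound_integral[OF i])
    show "(\<lambda>x. (M * norm u) * (cmod (\<phi> x) * exp (- c * g x))) integrable_on S"
      by (intro integrable_on_mult_right truncated_integrable(2) S_sets order_refl)
    fix x assume x: "x \<in> S"
    have "M * exp (- w * g x) * norm u \<le> M * exp (- c * g x) * norm u"
      using M w_gt g0[OF x] by (intro mult_right_mono mult_left_mono) (auto simp: mult_right_mono)
    then have "norm (T (g x) u) \<le> M * exp (- c * g x) * norm u" using T_norm[OF g0[OF x], of u] by simp
    then have "cmod (\<phi> x) * norm (T (g x) u) \<le> cmod (\<phi> x) * (M * exp (- c * g x) * norm u)"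
      by (intro mult_left_mono) auto
    then show "norm (\<phi> x *\<^sub>C T (g x) u) \<le> (M * norm u) * (cmod (\<phi> x) * exp (- c * g x))"
      by (simp add: norm_scaleC mult_ac)
  qed
  then show "norm (L u) \<le> (M * integral S (\<lambda>x. cmod (\<phi> x) * exp (- c * g x))) * norm u"
    by (simp add: mult_ac)
qed

lemma laplace_op_L: "laplace_op Y A \<phi> g S = L"
proof
  fix u
  have "integral S (\<lambda>x. \<phi> x *\<^sub>C exp_minus Y A (g x) u) = integral S (\<lambda>x. \<phi> x *\<^sub>C T (g x) u)"
    by (rule integral_cong) (use g_pos in \<open>simp add: exp_minus_eq less_imp_le\<close>)
  then show "laplace_op Y A \<phi> g S u = L u" by (simp add: laplace_op_def L_def)
qed

lemma laplace_op_exists_g: "laplace_op_exists Y A \<phi> g S"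
  unfolding laplace_op_exists_def laplace_op_L
proof (intro conjI allI)
  fix u
  show "(\<lambda>x. \<phi> x *\<^sub>C exp_minus Y A (g x) u) integrable_on S"
    by (rule integrable_eq[OF laplace_integrable[OF S_sets order_refl]])
       (use g_pos in \<open>simp add: exp_minus_eq less_imp_le\<close>)
qed (rule L_bounded_clinear)

text \<open>For s < 0 the operator is the inverse of \<open>T (- s)\<close>, and a candidate value
  is verified by applying \<open>T (- s)\<close> to it. If s + t is still negative,
  \<open>T (- (s + t))\<close> inherits injectivity from the bijection \<open>T (- s)\<close>, in
  which it is the factor applied first.\<close>

lemma exp_minus_shift:
  assumes s: "exp_minus_bounded Y A s" and t: "t \<ge> 0"
  shows "exp_minus Y A (s + t) u = exp_minus Y A s (T t u)"
proof (cases "s \<ge> 0")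
  case True
  then show ?thesis using t by (simp add: exp_minus_eq T_semigroup)
next
  case False
  then have s0: "- s \<ge> 0" and bij: "bij (T (- s))"
    using s semigroup_of_eq[of "- s"] by (auto simp: exp_minus_bounded_def)
  have E: "exp_minus Y A s = inv (T (- s))" using False s0 by (simp add: exp_minus_def semigroup_of_eq)
  have inv: "inv (T (- s)) v = x" if "T (- s) x = v" for v x
    using that bij by (auto simp: bij_def inv_f_f)
  show ?thesis
  proof (cases "s + t \<ge> 0")
    case True
    have "T (- s) (T (s + t) u) = T t u" using T_semigroup[OF s0 True, of u] by simp
    from inv[OF this] show ?thesis using True by (simp add: E exp_minus_eq)
  next
    case False
    then have st: "- (s + t) \<ge> 0" by simp
    have 1: "T (- s) v = T t (T (- (s + t)) v)" for v using T_semigroup[OF t st, of v] by simp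
    have 2: "T (- s) v = T (- (s + t)) (T t v)" for v using T_semigroup[OF st t, of v] by (simp add: add.commute)
    have "inj (T (- (s + t)))"
    proof (rule injI)
      fix x y assume "T (- (s + t)) x = T (- (s + t)) y"
      then have "T (- s) x = T (- s) y" by (simp only: 1)
      then show "x = y" using bij by (auto dest: bij_is_inj injD)
    qed
    obtain x where x: "T (- s) x = T t u" using bij by (metis bij_pointE)
    obtain y where y: "T (- s) y = u" using bij by (metis bij_pointE)
    have "T (- s) (T t y) = T t u"
      using T_semigroup[OF s0 t, of y] T_semigroup[OF t s0, of y] y by (simp add: add.commute)
    then have "exp_minus Y A s (T t u) = T t y" unfolding E by (rule inv)
    moreover have "T (- (s + t)) (T t y) = u" using 2[of y] y by simp
    then have "inv (T (- (s + t))) u = T t y" using \<open>inj (T (- (s + t)))\<close> by (metis inv_f_f)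
    ultimately show ?thesis using False st by (simp add: exp_minus_def semigroup_of_eq)
  qed
qed

lemma laplace_op_shift:
  assumes s: "exp_minus_bounded Y A s"
  shows "laplace_op_exists Y A \<phi> (\<lambda>x. s + g x) S"
    and "laplace_op Y A \<phi> (\<lambda>x. s + g x) S = exp_minus Y A s \<circ> laplace_op Y A \<phi> g S"
proof -
  have E: "bounded_clinear (exp_minus Y A s)"
    using s T_bounded_clinear[of s] exp_minus_eq[of s] by (auto simp: exp_minus_bounded_def)
  then have Ebl: "bounded_linear (exp_minus Y A s)" by (simp add: bounded_clinear_def)
  have i: "((\<lambda>x. \<phi> x *\<^sub>C exp_minus Y A (s + g x) u) has_integral exp_minus Y A s (L u)) S" for u
  proof -
    have "((exp_minus Y A s \<circ> (\<lambda>x. \<phi> x *\<^sub>C T (g x) u)) has_integral exp_minus Y A s (L u)) S"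
      unfolding L_def
      by (intro has_integral_linear[OF integrable_integral Ebl] laplace_integrable S_sets order_refl)
    then show ?thesis
      by (rule has_integral_eq[rotated])
         (use E g_pos in \<open>simp add: bounded_clinear_def exp_minus_shift[OF s] less_imp_le\<close>)
  qed
  have eq: "laplace_op Y A \<phi> (\<lambda>x. s + g x) S = exp_minus Y A s \<circ> L"
    using i by (auto simp: laplace_op_def fun_eq_iff integral_unique)
  then show "laplace_op Y A \<phi> (\<lambda>x. s + g x) S = exp_minus Y A s \<circ> laplace_op Y A \<phi> g S"
    by (simp add: laplace_op_L)
  have "bounded_clinear (exp_minus Y A s \<circ> L)"
    using E L_bounded_clinear by (simp add: bounded_clinear_def bounded_linear_compose o_def)
  with i eq show "laplace_op_exists Y A \<phi> (\<lambda>x. s + g x) S"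
    by (auto simp: laplace_op_exists_def dest: has_integral_integrable)
qed

text \<open>The three terms come from the integral over (a, a + k) compared with the truncated gamma
  integrals, from the rest of the interval, where g \<ge> \<rho>, and from the tails of
  \<open>J (p s)\<close> beyond t = g(a + k).\<close>

lemma remainder_norm:
  fixes p :: "nat \<Rightarrow> real" and cs :: "nat \<Rightarrow> complex"
  assumes k: "0 < k" "k < r" and p: "\<And>s. p s > 0"
    and near: "\<And>x. x \<in> {a<..<a + k} \<Longrightarrow> d x > 0 \<and>
      norm (\<phi> x / of_real (d x) - (\<Sum>s\<le>N. cs s * of_real (g x powr (p s - 1)))) \<le> \<epsilon> * g x powr (p N - 1)"
    and far: "\<And>x. a + k \<le> x \<Longrightarrow> ereal x < b \<Longrightarrow> \<rho> \<le> g x"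
  shows "norm (L u - (\<Sum>s\<le>N. cs s *\<^sub>C J (p s) u))
    \<le> (\<epsilon> * M * Gamma (p N) * w powr (- p N)
        + exp (- (w - c) * \<rho>) * M * integral S (\<lambda>x. cmod (\<phi> x) * exp (- c * g x))
        + (\<Sum>s\<le>N. cmod (cs s) * (exp (- (w / 2) * g (a + k)) * (M * Gamma (p s) * (w / 2) powr (- p s)))))
      * norm u"
proof -
  define S1 S2 where "S1 = {a<..<a + k}" and "S2 = {x. a + k \<le> x \<and> ereal x < b}"
  define \<kappa> where "\<kappa> = g (a + k)"
  have "ereal (a + k) < ereal (a + r)" using k by simp
  then have kb: "ereal (a + k) < b" using r(2) by (rule less_le_trans)
  have "ereal x < b" if "x < a + k" for x using that kb by (meson ereal_less_eq(3) less_imp_le order_le_less_trans)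
  then have S: "S = S1 \<union> S2" using k by (auto simp: S1_def S2_def einterval_iff)
  have disj: "S1 \<inter> S2 = {}" by (auto simp: S1_def S2_def)
  have sub: "S1 \<subseteq> S" "S2 \<subseteq> S" unfolding S by auto
  have "S2 = S - S1" using S disj by auto
  then have sets: "S1 \<in> sets lebesgue" "S2 \<in> sets lebesgue"
    using S_sets by (auto simp: S1_def)
  have \<kappa>: "\<kappa> > 0" using g_pos[of "a + k"] k kb by (simp add: \<kappa>_def einterval_iff)
  have gS1: "x \<in> S1 \<Longrightarrow> g x > 0" for x using g_pos sub by auto
  have gcont: "continuous_on {a..a + k} g"
  proof -
    have "isCont g x" if "x \<in> {a<..a + k}" for x using deriv[of x] that k by (auto intro: DERIV_isCont)
    moreover have "continuous (at a within {a..a + k}) g"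
    proof -
      have "at a within {a..a + k} = at_right a" using k by (intro at_within_Icc_at_right) simp
      then show ?thesis using g_lim g_a by (simp add: continuous_within)
    qed
    ultimately show ?thesis
      unfolding continuous_on_eq_continuous_within
      by (metis atLeastAtMost_iff continuous_at_imp_continuous_at_within greaterThanAtMost_iff order_le_less)
  qed
  \<comment> \<open>Stated for all Banach spaces because it serves both the vectors
    \<open>T t u\<close> and their scalar majorant.\<close>
  have subst: "((\<lambda>x. d x *\<^sub>R f (g x)) has_integral integral {0..\<kappa>} f) S1"
    if "\<And>R. f integrable_on {0..R}" "continuous_on {0<..} f" for f :: "real \<Rightarrow> 'z::banach"
    unfolding S1_def \<kappa>_def has_integral_Icc_iff_Ioo[symmetric]
    by (rule primitive_substitution[OF that gcont g_a])
       (use k deriv gS1 in \<open>auto simp: S1_def\<close>)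
  define D where "D s x = (d x * g x powr (p s - 1)) *\<^sub>R T (g x) u" for s x
  define j where "j s = integral {0..\<kappa>} (\<lambda>t. t powr (p s - 1) *\<^sub>R T t u)" for s
  have D: "(D s has_integral j s) S1" for s
  proof -
    have "((\<lambda>x. d x *\<^sub>R (g x powr (p s - 1) *\<^sub>R T (g x) u)) has_integral j s) S1"
      unfolding j_def
    proof (rule subst)
      show "(\<lambda>t. t powr (p s - 1) *\<^sub>R T t u) integrable_on {0..R}" for R
        by (rule J_integrable_interval[OF p]) simp
      show "continuous_on {0<..} (\<lambda>t. t powr (p s - 1) *\<^sub>R T t u)"
        by (intro continuous_intros continuous_on_subset[OF T_continuous]) auto
    qed
    then show ?thesis by (simp add: D_def[abs_def])
  qed
  have e: "((\<lambda>x. d x *\<^sub>R (g x powr (p N - 1) * exp (- w * g x)))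
      has_integral integral {0..\<kappa>} (\<lambda>t. t powr (p N - 1) * exp (- w * t))) S1"
  proof (rule subst)
    show "(\<lambda>t. t powr (p N - 1) * exp (- w * t)) integrable_on {0..R}" for R
      using has_integral_integrable[OF Gamma_integral_scaled[OF p w, unfolded has_integral_Ioi_iff_Ici]]
      by (rule integrable_on_subinterval) auto
    show "continuous_on {0<..} (\<lambda>t. t powr (p N - 1) * exp (- w * t))"
      by (intro continuous_intros) auto
  qed
  have e_le: "integral {0..\<kappa>} (\<lambda>t. t powr (p N - 1) * exp (- w * t)) \<le> Gamma (p N) * w powr (- p N)"
  proof -
    have i: "((\<lambda>t. t powr (p N - 1) * exp (- w * t)) has_integral Gamma (p N) * w powr (- p N)) {0..}"
      using Gamma_integral_scaled[OF p w] by (simp add: has_integral_Ioi_iff_Ici)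
    show ?thesis
      by (rule has_integral_subset_le[OF _ integrable_integral i])
         (use integrable_on_subinterval[OF has_integral_integrable[OF i]] in auto)
  qed
  let ?K = "\<lambda>x. \<phi> x *\<^sub>C T (g x) u" and ?Sj = "\<Sum>s\<le>N. cs s *\<^sub>C j s" and ?SJ = "\<Sum>s\<le>N. cs s *\<^sub>C J (p s) u"
  have near_int: "norm (integral S1 ?K - ?Sj)
      \<le> \<epsilon> * M * Gamma (p N) * w powr (- p N) * norm u"
  proof -
    have "((\<lambda>x. cs s *\<^sub>C D s x) has_integral cs s *\<^sub>C j s) S1" for s
      using has_integral_linear[OF D bounded_linear_scaleC] by (simp add: o_def)
    then have "((\<lambda>x. \<Sum>s\<le>N. cs s *\<^sub>C D s x) has_integral ?Sj) S1"
      by (intro has_integral_sum) auto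
    from has_integral_diff[OF integrable_integral[OF laplace_integrable[OF sets(1) sub(1)]] this]
    have i: "((\<lambda>x. \<phi> x *\<^sub>C T (g x) u - (\<Sum>s\<le>N. cs s *\<^sub>C D s x)) has_integral
        integral S1 ?K - ?Sj) S1" .
    have e': "((\<lambda>x. (\<epsilon> * M * norm u) * (d x *\<^sub>R (g x powr (p N - 1) * exp (- w * g x)))) has_integral
        (\<epsilon> * M * norm u) * integral {0..\<kappa>} (\<lambda>t. t powr (p N - 1) * exp (- w * t))) S1"
      by (rule has_integral_mult_right[OF e])
    have \<epsilon>: "\<epsilon> \<ge> 0"
    proof -
      have x: "a + k / 2 \<in> {a<..<a + k}" using k by simp
      have "0 \<le> \<epsilon> * g (a + k / 2) powr (p N - 1)" using near[OF x] norm_ge_zero order_trans by blast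
      moreover have "g (a + k / 2) powr (p N - 1) > 0" using gS1[of "a + k / 2"] x by (simp add: S1_def)
      ultimately show ?thesis by (simp add: zero_le_mult_iff)
    qed
    have "norm (integral S1 ?K - ?Sj)
        \<le> (\<epsilon> * M * norm u) * integral {0..\<kappa>} (\<lambda>t. t powr (p N - 1) * exp (- w * t))"
      unfolding integral_unique[OF i, symmetric] integral_unique[OF e', symmetric]
    proof (rule integral_norm_bound_integral[OF has_integral_integrable[OF i] has_integral_integrable[OF e']])
      fix x assume x: "x \<in> S1"
      have dx: "d x > 0" and gx: "g x > 0" using near[of x] gS1[OF x] x by (auto simp: S1_def)
      define q where "q = \<phi> x / of_real (d x) - (\<Sum>s\<le>N. cs s * of_real (g x powr (p s - 1)))"
      have q: "norm q \<le> \<epsilon> * g x powr (p N - 1)" using near[of x] x by (simp add: S1_def q_def)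
      have "of_real (d x) * q = \<phi> x - (\<Sum>s\<le>N. cs s * of_real (d x * g x powr (p s - 1)))"
        using dx by (simp add: q_def right_diff_distrib sum_distrib_left mult_ac)
      then have "(of_real (d x) * q) *\<^sub>C T (g x) u
          = \<phi> x *\<^sub>C T (g x) u - (\<Sum>s\<le>N. cs s * of_real (d x * g x powr (p s - 1))) *\<^sub>C T (g x) u"
        by (metis add_diff_cancel_right' diff_add_cancel scaleC_add_left)
      also have "(\<Sum>s\<le>N. cs s * of_real (d x * g x powr (p s - 1))) *\<^sub>C T (g x) u = (\<Sum>s\<le>N. cs s *\<^sub>C D s x)"
      proof -
        have "(sum f A) *\<^sub>C v = (\<Sum>i\<in>A. f i *\<^sub>C v)" if "finite A" for f :: "nat \<Rightarrow> complex" and A and v :: 'a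
          using that by (induction A) (auto simp: scaleC_add_left)
        then show ?thesis by (simp add: D_def scaleR_scaleC scaleC_scaleC)
      qed
      finally have eq: "(of_real (d x) * q) *\<^sub>C T (g x) u = \<phi> x *\<^sub>C T (g x) u - (\<Sum>s\<le>N. cs s *\<^sub>C D s x)" .
      have "norm (\<phi> x *\<^sub>C T (g x) u - (\<Sum>s\<le>N. cs s *\<^sub>C D s x)) = d x * norm q * norm (T (g x) u)"
        unfolding eq[symmetric] using dx by (simp add: norm_scaleC norm_mult)
      also have "\<dots> \<le> d x * (\<epsilon> * g x powr (p N - 1)) * (M * exp (- w * g x) * norm u)"
        using dx gx q \<epsilon> by (intro mult_mono T_norm mult_left_mono) auto
      finally show "norm (\<phi> x *\<^sub>C T (g x) u - (\<Sum>s\<le>N. cs s *\<^sub>C D s x))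
          \<le> (\<epsilon> * M * norm u) * (d x *\<^sub>R (g x powr (p N - 1) * exp (- w * g x)))"
        by (simp add: mult_ac)
    qed
    also have "\<dots> \<le> (\<epsilon> * M * norm u) * (Gamma (p N) * w powr (- p N))"
      using e_le \<epsilon> M by (intro mult_left_mono) auto
    finally show ?thesis by (simp add: mult_ac)
  qed
  have far_int: "norm (integral S2 ?K)
      \<le> exp (- (w - c) * \<rho>) * M * integral S (\<lambda>x. cmod (\<phi> x) * exp (- c * g x)) * norm u"
  proof -
    define C where "C = exp (- (w - c) * \<rho>) * M * norm u"
    have C: "C \<ge> 0" using M by (simp add: C_def)
    note i2 = truncated_integrable(2)[OF sets(2) sub(2)]
    have "norm (integral S2 ?K) \<le> integral S2 (\<lambda>x. C * (cmod (\<phi> x) * exp (- c * g x)))"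
    proof (rule integral_norm_bound_integral[OF laplace_integrable[OF sets(2) sub(2)] integrable_on_mult_right[OF i2]])
      fix x assume x: "x \<in> S2"
      have gx: "g x \<ge> 0" using g_pos[of x] sub(2) x by auto
      \<comment> \<open>Of exp (-w g) = exp (-(w - c) g) exp (-c g) the first factor is small on
        \<open>S2\<close>, and the second is the weight under which \<phi> is integrable.\<close>
      have "(w - c) * \<rho> \<le> (w - c) * g x" using far[of x] x w_gt by (intro mult_left_mono) (auto simp: S2_def)
      then have "exp (- w * g x) \<le> exp (- (w - c) * \<rho>) * exp (- c * g x)"
        by (simp add: algebra_simps flip: exp_add)
      then have "M * exp (- w * g x) * norm u \<le> M * (exp (- (w - c) * \<rho>) * exp (- c * g x)) * norm u"
        using M by (intro mult_right_mono mult_left_mono) auto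
      then have "norm (T (g x) u) \<le> C * exp (- c * g x)"
        using T_norm[OF gx, of u] by (simp add: C_def mult_ac)
      then have "cmod (\<phi> x) * norm (T (g x) u) \<le> cmod (\<phi> x) * (C * exp (- c * g x))"
        by (intro mult_left_mono) auto
      then show "norm (\<phi> x *\<^sub>C T (g x) u) \<le> C * (cmod (\<phi> x) * exp (- c * g x))"
        by (simp add: norm_scaleC mult_ac)
    qed
    also have "\<dots> = C * integral S2 (\<lambda>x. cmod (\<phi> x) * exp (- c * g x))" by simp
    also have "\<dots> \<le> C * integral S (\<lambda>x. cmod (\<phi> x) * exp (- c * g x))"
      using C truncated_integrable(2)[OF S_sets order_refl] i2 sub(2)
      by (intro mult_left_mono integral_subset_le) auto
    finally show ?thesis by (simp add: C_def mult_ac)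
  qed
  have tail: "norm (?SJ - ?Sj)
      \<le> (\<Sum>s\<le>N. cmod (cs s) * (exp (- (w / 2) * \<kappa>) * (M * Gamma (p s) * (w / 2) powr (- p s)))) * norm u"
  proof -
    have "?SJ - ?Sj = (\<Sum>s\<le>N. cs s *\<^sub>C (J (p s) u - j s))"
      by (simp add: sum_subtractf linear_diff[OF bounded_linear.linear[OF bounded_linear_scaleC]])
    also have "norm \<dots> \<le> (\<Sum>s\<le>N. cmod (cs s) * (exp (- (w / 2) * \<kappa>) * (M * Gamma (p s) * (w / 2) powr (- p s) * norm u)))"
      unfolding j_def
      by (rule sum_norm_le) (use \<kappa> in \<open>simp only: norm_scaleC, intro mult_left_mono J_tail_norm p; simp\<close>)
    finally show ?thesis by (simp only: sum_distrib_right mult.assoc)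
  qed
  have tri: "norm (x + y - z) \<le> norm x + norm y + norm z" for x y z :: 'a
    by norm
  have "(?K has_integral
      integral S1 ?K + integral S2 ?K) (S1 \<union> S2)"
    by (rule has_integral_Un[OF integrable_integral[OF laplace_integrable[OF sets(1) sub(1)]]
          integrable_integral[OF laplace_integrable[OF sets(2) sub(2)]]]) (simp add: disj)
  then have "L u = integral S1 ?K + integral S2 ?K"
    unfolding L_def S by (rule integral_unique)
  then have eq: "L u - ?SJ
      = (integral S1 ?K - ?Sj)
        + integral S2 ?K
        - (?SJ - ?Sj)" by simp
  show ?thesis
    unfolding eq distrib_right \<kappa>_def[symmetric]
    by (rule order_trans[OF tri]) (intro add_mono near_int far_int tail)
qed

end

text \<open>The near part takes one half of \<epsilon> by the choice of \<open>\<epsilon>1\<close>;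
  all other errors are exponentially small in w and fall below the other half of \<epsilon> w^(-p_N)
  once w exceeds a \<open>W\<close> found before the operator.\<close>

lemma laplace_op_expansion:
  fixes p :: "nat \<Rightarrow> real" and cs :: "nat \<Rightarrow> complex"
  assumes LI: "laplace_integral a b g d \<phi> c r" and M: "M \<ge> 1" and p: "\<And>s. p s > 0" and \<epsilon>: "\<epsilon> > 0"
    and expansion: "poincare_expansion (at_right a) (\<lambda>x. \<phi> x / complex_of_real (d x)) (\<lambda>s x. g x powr (p s - 1)) cs"
    and d: "\<forall>\<^sub>F x in at_right a. d x > 0"
    and far: "\<And>\<delta>. \<delta> > 0 \<Longrightarrow> \<exists>\<rho>>0. \<forall>x. a + \<delta> \<le> x \<longrightarrow> ereal x < b \<longrightarrow> \<rho> \<le> g x"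
  shows "\<exists>W. \<forall>(Y::'a::complex_banach set) A w. hille_yosida Y A M w \<longrightarrow> w \<ge> W \<longrightarrow>
    (\<forall>u. norm (laplace_op Y A \<phi> g (einterval a b) u
        - (\<Sum>s\<le>N. (complex_of_real (Gamma (p s)) * cs s) *\<^sub>C neg_power Y A (p s) u))
      \<le> \<epsilon> * w powr (- p N) * norm u)"
proof -
  interpret laplace_integral a b g d \<phi> c r by (rule LI)
  define \<epsilon>1 where "\<epsilon>1 = \<epsilon> / (2 * M * Gamma (p N))"
  have G: "Gamma (p s) > 0" for s by (rule Gamma_real_pos[OF p])
  have \<epsilon>1: "\<epsilon>1 > 0" using \<epsilon> M G by (simp add: \<epsilon>1_def)
  have "(\<lambda>x. \<phi> x / complex_of_real (d x) - (\<Sum>s\<le>N. cs s * of_real (g x powr (p s - 1))))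
      \<in> o[at_right a](\<lambda>x. of_real (g x powr (p N - 1)))"
    using expansion by (simp add: poincare_expansion_def)
  from landau_o.smallD[OF this \<epsilon>1] d
  have "\<forall>\<^sub>F x in at_right a. d x > 0 \<and>
      norm (\<phi> x / complex_of_real (d x) - (\<Sum>s\<le>N. cs s * of_real (g x powr (p s - 1)))) \<le> \<epsilon>1 * g x powr (p N - 1)"
    by eventually_elim simp
  then obtain k0 where k0: "k0 > a" "\<And>x. a < x \<Longrightarrow> x < k0 \<Longrightarrow> d x > 0 \<and>
      norm (\<phi> x / complex_of_real (d x) - (\<Sum>s\<le>N. cs s * of_real (g x powr (p s - 1)))) \<le> \<epsilon>1 * g x powr (p N - 1)"
    unfolding eventually_at_right_field by blast
  obtain m where m: "0 < m" "m \<le> k0 - a" "m \<le> r"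
    using k0(1) r(1) by (metis diff_gt_0_iff_gt min.cobounded1 min.cobounded2 min_less_iff_conj)
  \<comment> \<open>Halving puts a + k strictly inside both neighbourhoods.\<close>
  define k where "k = m / 2"
  have k: "0 < k" "k < r" "a + k < k0" using m by (simp_all add: k_def)
  obtain \<rho> where \<rho>: "\<rho> > 0" "\<And>x. a + k \<le> x \<Longrightarrow> ereal x < b \<Longrightarrow> \<rho> \<le> g x" using far[OF k(1)] by blast
  have "ereal (a + k) < ereal (a + r)" using k by simp
  then have "ereal (a + k) < b" using r(2) by (rule less_le_trans)
  then have \<kappa>: "g (a + k) > 0" using g_pos k by (simp add: einterval_iff)
  define K where "K = integral S (\<lambda>x. cmod (\<phi> x) * exp (- c * g x))"
  define err where "err w = exp (- (w - c) * \<rho>) * M * K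
      + (\<Sum>s\<le>N. cmod (cs s) * (exp (- (w / 2) * g (a + k)) * (M * Gamma (p s) * (w / 2) powr (- p s))))" for w
  \<comment> \<open>This is w^(p_N) times \<open>err w\<close>, with every summand written as a
    power of w times a decaying exponential.\<close>
  define err' where "err' w = (exp (c * \<rho>) * M * K) * (w powr p N * exp (- \<rho> * w))
      + (\<Sum>s\<le>N. (cmod (cs s) * M * Gamma (p s) * 2 powr p s) * (w powr (p N - p s) * exp (- (g (a + k) / 2) * w)))" for w
  have "(err' \<longlongrightarrow> (exp (c * \<rho>) * M * K) * 0 + (\<Sum>s\<le>N. (cmod (cs s) * M * Gamma (p s) * 2 powr p s) * 0)) at_top"
    unfolding err'_def[abs_def]
    by (intro tendsto_add tendsto_sum tendsto_mult tendsto_const powr_exp_tendsto_0) (use \<rho> \<kappa> in auto)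
  then have "(err' \<longlongrightarrow> 0) at_top" by simp
  then have "\<forall>\<^sub>F w in at_top. err' w < \<epsilon> / 2" using \<epsilon> by (intro order_tendstoD(2)) auto
  then obtain W where W: "\<And>w. w \<ge> W \<Longrightarrow> err' w < \<epsilon> / 2" by (auto simp: eventually_at_top_linorder)
  have err: "err w \<le> \<epsilon> / 2 * w powr (- p N)" if w: "w > 0" "w \<ge> W" for w
  proof -
    have "err w = w powr (- p N) * err' w"
    proof -
      have "w powr (- p N) * w powr p N = 1" using w by (simp flip: powr_add)
      moreover have "w powr (- p N) * w powr (p N - p s) * 2 powr p s = (w / 2) powr (- p s)" for s
        using w by (simp add: powr_divide powr_minus_divide powr_diff)
      moreover have "exp (c * \<rho>) * exp (- \<rho> * w) = exp (- (w - c) * \<rho>)"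
        by (simp add: algebra_simps flip: exp_add)
      moreover have "exp (- (g (a + k) / 2) * w) = exp (- (w / 2) * g (a + k))" by (simp add: mult.commute)
      moreover have "w powr (- p N) * err' w
          = (exp (c * \<rho>) * exp (- \<rho> * w)) * M * K * (w powr (- p N) * w powr p N)
            + (\<Sum>s\<le>N. cmod (cs s) * (exp (- (g (a + k) / 2) * w)
                * (M * Gamma (p s) * (w powr (- p N) * w powr (p N - p s) * 2 powr p s))))"
        unfolding err'_def by (simp only: distrib_left sum_distrib_left mult_ac)
      ultimately show ?thesis unfolding err_def by (simp only: mult_1_right)
    qed
    also have "\<dots> \<le> w powr (- p N) * (\<epsilon> / 2)" using W[OF w(2)] by (intro mult_left_mono) auto
    finally show ?thesis by (simp add: mult_ac)
  qed
  have "norm (laplace_op Y A \<phi> g S u - (\<Sum>s\<le>N. (complex_of_real (Gamma (p s)) * cs s) *\<^sub>C neg_power Y A (p s) u))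
      \<le> \<epsilon> * w powr (- p N) * norm u"
    if HY: "hille_yosida Y A M w" and large: "w \<ge> max W (c + 1)" for Y :: "'a set" and A w u
  proof -
    interpret hille_yosida Y A M w by (rule HY)
    interpret laplace_semigroup Y A M w a b g d \<phi> c r by unfold_locales (use large in auto)
    have "complex_of_real (Gamma (p s)) *\<^sub>C neg_power Y A (p s) u = J (p s) u" for s
      using G[of s] by (simp add: neg_power_eq flip: scaleR_scaleC)
    then have "(complex_of_real (Gamma (p s)) * cs s) *\<^sub>C neg_power Y A (p s) u = cs s *\<^sub>C J (p s) u" for s
      by (metis mult.commute scaleC_scaleC)
    then have "norm (laplace_op Y A \<phi> g S u - (\<Sum>s\<le>N. (complex_of_real (Gamma (p s)) * cs s) *\<^sub>C neg_power Y A (p s) u))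
        = norm (L u - (\<Sum>s\<le>N. cs s *\<^sub>C J (p s) u))" by (simp add: laplace_op_L)
    also have "\<dots> \<le> (\<epsilon>1 * M * Gamma (p N) * w powr (- p N) + err w) * norm u"
      unfolding err_def add.assoc[symmetric] K_def
      by (rule remainder_norm[OF k(1,2) p _ \<rho>(2)]) (use k0 k in auto)
    also have "\<epsilon>1 * M * Gamma (p N) = \<epsilon> / 2" using M G[of N] by (simp add: \<epsilon>1_def)
    also have "(\<epsilon> / 2 * w powr (- p N) + err w) * norm u \<le> (\<epsilon> / 2 * w powr (- p N) + \<epsilon> / 2 * w powr (- p N)) * norm u"
      using err[of w] w large by (intro mult_right_mono add_left_mono) auto
    finally show ?thesis by simp
  qed
  then show ?thesis by blast
qed

section \<open>The sector condition and the assembly of the theorem\<close>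

lemma sector_norm_bound:
  assumes "\<bar>Arg z\<bar> \<le> pi / 2 - \<Delta>" "\<Delta> \<ge> 0"
  shows "cmod z * sin \<Delta> \<le> Re z"
proof -
  have "sin \<Delta> = cos (pi / 2 - \<Delta>)" by (simp add: cos_diff)
  also have "\<dots> \<le> cos \<bar>Arg z\<bar>"
    using assms pi_gt_zero by (intro cos_monotone_0_pi_le) linarith+
  also have "\<dots> = cos (Arg z)" by (simp add: abs_if)
  finally have "cmod z * sin \<Delta> \<le> cmod z * cos (Arg z)" by (simp add: mult_left_mono)
  also have "\<dots> = Re z" using rcis_cmod_Arg[of z] by (metis Re_rcis)
  finally show ?thesis .
qed

lemma inverse_power_lower_bound:
  assumes HY: "hille_yosida Y A M w"
    and sector: "spectrum Y A \<subseteq> {z. z \<noteq> 0 \<and> \<bar>Arg z\<bar> \<le> pi / 2 - \<Delta>}" and \<Delta>: "\<Delta> > 0"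
    and \<eta>: "\<eta> > 0" "ereal \<eta> * omega Y A \<le> ereal w" and n: "n \<ge> 1"
  shows "(\<eta> * sin \<Delta> / 2 / w) ^ n \<le> onorm (op_inverse Y A ^^ n)" "sin \<Delta> > 0"
proof -
  interpret hille_yosida Y A M w by (rule HY)
  \<comment> \<open>The factor 2 gives a strict inequality, so that an actual spectral point lies
    below the bound; an infinite omega, hence an empty spectrum, is excluded by the hypothesis on
    \<open>omega\<close>.\<close>
  have "omega Y A < ereal (2 * w / \<eta>)"
  proof (cases "omega Y A")
    case (real x)
    then have "\<eta> * x \<le> w" using \<eta> by simp
    then have "x \<le> w / \<eta>" using \<eta>(1) by (simp add: field_simps)
    also have "\<dots> < 2 * w / \<eta>" using w \<eta>(1) by (simp add: field_simps)
    finally show ?thesis using real by simp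
  qed (use \<eta> in auto)
  then obtain z where z: "z \<in> spectrum Y A" "Re z < 2 * w / \<eta>"
    unfolding omega_def by (auto simp: INF_less_iff)
  then have z': "z \<noteq> 0" "\<bar>Arg z\<bar> \<le> pi / 2 - \<Delta>" using sector by auto
  \<comment> \<open>The sector contains a point, which bounds \<Delta> from above.\<close>
  then have "\<Delta> \<le> pi / 2" by linarith
  then show sin: "sin \<Delta> > 0" using \<Delta> pi_gt_zero by (intro sin_gt_zero) linarith+
  have "cmod z * sin \<Delta> \<le> 2 * w / \<eta>" using sector_norm_bound[OF z'(2)] \<Delta> z(2) by simp
  then have "\<eta> * sin \<Delta> / 2 / w \<le> 1 / cmod z" using z'(1) \<eta>(1) w by (simp add: field_simps)
  then have "(\<eta> * sin \<Delta> / 2 / w) ^ n \<le> (1 / cmod z) ^ n" using \<eta>(1) sin w by (intro power_mono) auto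
  also have "\<dots> \<le> onorm (op_inverse Y A ^^ n)" by (rule spectrum_B_power[OF z(1) n])
  finally show "(\<eta> * sin \<Delta> / 2 / w) ^ n \<le> onorm (op_inverse Y A ^^ n)" .
qed


theorem theorem2p1:
  fixes I :: "'i set" and le :: "'i \<Rightarrow> 'i \<Rightarrow> bool"
    and Y :: "'a::complex_banach set" and A :: "'i \<Rightarrow> 'a \<Rightarrow> 'a"
    and \<omega>1 :: "'i \<Rightarrow> real" and \<Delta> M \<eta> :: real
    and a :: real and b :: ereal
    and h :: "real \<Rightarrow> real" and \<phi> :: "real \<Rightarrow> complex"
    and as :: "nat \<Rightarrow> real" and bs :: "nat \<Rightarrow> complex" and lam mu :: real
  assumes net: "directed_set I le"
    and Y: "csubspace Y" "closure Y = UNIV"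
    and A: "\<And>i. i \<in> I \<Longrightarrow> closed_operator Y (A i)"
    and pos: "\<Delta> > 0" "M > 0" "\<eta> > 0"
    and C1: "\<And>i. i \<in> I \<Longrightarrow> spectrum Y (A i) \<subseteq> {z. z \<noteq> 0 \<and> \<bar>Arg z\<bar> \<le> pi / 2 - \<Delta>}"
    and C2: "\<And>i. i \<in> I \<Longrightarrow> 0 < \<omega>1 i" "\<And>i. i \<in> I \<Longrightarrow> ereal (\<omega>1 i) \<le> omega Y (A i)"
      "\<And>i n r. i \<in> I \<Longrightarrow> n \<ge> 1 \<Longrightarrow> r < \<omega>1 i \<Longrightarrow>
         onorm (resolvent Y (A i) (complex_of_real r) ^^ n) \<le> M / (\<omega>1 i - r) ^ n"
    and omega_bound: "\<And>i. i \<in> I \<Longrightarrow> ereal \<eta> * omega Y (A i) \<le> ereal (\<omega>1 i)"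
    and ab: "ereal a < b"
    and h_i: "\<And>x. x \<in> einterval a b \<Longrightarrow> h x > h a"
      "\<And>\<delta>. \<delta> > 0 \<Longrightarrow> 0 < (INF x\<in>{x. a + \<delta> \<le> x \<and> ereal x < b}. ereal (h x - h a))"
    and cont_ii: "\<exists>r>0. ereal (a + r) \<le> b \<and>
      (\<forall>x\<in>{a<..<a + r}. h differentiable (at x)) \<and>
      continuous_on {a<..<a + r} (deriv h) \<and> continuous_on {a<..<a + r} \<phi>"
    and exp_iii:
      "poincare_expansion (at_right a) (\<lambda>x. h x - h a) (\<lambda>s x. (x - a) powr (real s + mu)) as"
      "poincare_expansion (at_right a) (deriv h) (\<lambda>s x. (x - a) powr (real s + mu - 1))
         (\<lambda>s. (real s + mu) * as s)"
      "poincare_expansion (at_right a) \<phi> (\<lambda>s x. (x - a) powr (real s + lam - 1)) bs"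
      "lam > 0" "mu > 0" "as 0 > 0"
    and conv_iv: "\<exists>z0::real. \<forall>z\<ge>z0.
      (\<lambda>x. \<phi> x * complex_of_real (exp (- z * h x))) absolutely_integrable_on einterval a b"
  shows
    "(\<exists>\<delta>>0. \<forall>i\<in>I. onorm (op_inverse Y (A i)) < \<delta> \<longrightarrow>
        laplace_op_exists Y (A i) \<phi> (\<lambda>x. h x - h a) (einterval a b) \<and>
        (exp_minus_bounded Y (A i) (h a) \<longrightarrow>
           laplace_op_exists Y (A i) \<phi> h (einterval a b) \<and>
           laplace_op Y (A i) \<phi> h (einterval a b) =
             exp_minus Y (A i) (h a) \<circ> laplace_op Y (A i) \<phi> (\<lambda>x. h x - h a) (einterval a b)))
     \<and> (\<exists>!c. poincare_expansion (at_right a) (\<lambda>x. \<phi> x / complex_of_real (deriv h x))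
          (\<lambda>s x. (h x - h a) powr ((real s + lam - mu) / mu)) c)
     \<and> (\<forall>c. poincare_expansion (at_right a) (\<lambda>x. \<phi> x / complex_of_real (deriv h x))
          (\<lambda>s x. (h x - h a) powr ((real s + lam - mu) / mu)) c \<longrightarrow>
        op_expansion I Y A
          (\<lambda>i. laplace_op Y (A i) \<phi> (\<lambda>x. h x - h a) (einterval a b))
          (\<lambda>s. (real s + lam) / mu)
          (\<lambda>s. complex_of_real (Gamma ((real s + lam) / mu)) * c s)
        \<and> c 0 = bs 0 / complex_of_real mu * complex_of_real (as 0 powr (- (lam / mu))))"
proof -
  \<comment> \<open>\<open>M'\<close> meets the convention \<open>M \<ge> 1\<close> of the locale;
    \<open>\<kappa> / \<omega>1 i\<close> is the lower bound for the spectral radius of the inverse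
    that the sector provides.\<close>
  define M' \<kappa> where "M' = max M 1" and "\<kappa> = \<eta> * sin \<Delta> / 2"
  define g where "g x = h x - h a" for x
  obtain i0 where i0: "i0 \<in> I" using net by (auto simp: directed_set_def)
  have M': "M' \<ge> 1" by (simp add: M'_def)
  have HY: "hille_yosida Y (A i) M' (\<omega>1 i)" if i: "i \<in> I" for i
  proof
    show "complex_of_real q \<notin> spectrum Y (A i)" if "q < \<omega>1 i" for q
    proof
      assume "complex_of_real q \<in> spectrum Y (A i)"
      then have "omega Y (A i) \<le> ereal q" unfolding omega_def by (metis INF_lower Re_complex_of_real)
      with C2(2)[OF i] have "ereal (\<omega>1 i) \<le> ereal q" by (rule order_trans)
      with that show False by simp
    qed
    show "onorm (resolvent Y (A i) (complex_of_real q) ^^ n) \<le> M' / (\<omega>1 i - q) ^ n"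
      if "n \<ge> 1" "q < \<omega>1 i" for n q
      using that by (intro order_trans[OF C2(3)[OF i that]] divide_right_mono) (auto simp: M'_def)
    show "clinear_on Y (A i)" using A[OF i] by (simp add: closed_operator_def)
  qed (use Y C2(1)[OF i] M' in auto)
  have low: "(\<kappa> / \<omega>1 i) ^ n \<le> onorm (op_inverse Y (A i) ^^ n)" if "i \<in> I" "n \<ge> 1" for i n
    using inverse_power_lower_bound(1)[OF HY C1 pos(1,3) omega_bound] that by (simp add: \<kappa>_def)
  have \<kappa>: "\<kappa> > 0"
    using inverse_power_lower_bound(2)[OF HY C1 pos(1,3) omega_bound, of i0 1] i0 pos by (simp add: \<kappa>_def)
  \<comment> \<open>By the case n = 1 of \<open>low\<close>, a small inverse forces a large
    \<omega>_1, which converts thresholds for \<omega>_1 into thresholds for the norm of A^(-1); the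
    1 in the maximum keeps them positive.\<close>
  have large: "\<omega>1 i \<ge> W" if "i \<in> I" "onorm (op_inverse Y (A i)) < \<kappa> / max W 1" for i W
  proof -
    have "\<kappa> / \<omega>1 i < \<kappa> / max W 1" using low[of i 1] that by simp
    then have "\<kappa> * max W 1 < \<kappa> * \<omega>1 i" using C2(1)[OF that(1)] by (simp add: field_simps)
    then show ?thesis using \<kappa> by simp
  qed
  obtain r where r: "r > 0" "ereal (a + r) \<le> b" "\<And>x. x \<in> {a<..<a + r} \<Longrightarrow> h differentiable (at x)"
    using cont_ii by blast
  obtain z0 where z0: "\<And>z. z \<ge> z0 \<Longrightarrow>
      (\<lambda>x. \<phi> x * complex_of_real (exp (- z * h x))) absolutely_integrable_on einterval a b"
    using conv_iv by blast
  note ratio = ratio_expansion_ex1[OF exp_iii] ratio_expansion_leading[OF exp_iii]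
    ratio_expansion_pos[OF exp_iii] ratio_expansion_tendsto_0[OF exp_iii]
  have LI: "laplace_integral a b g (deriv h) \<phi> z0 r"
  proof
    have "(\<lambda>x. \<phi> x * complex_of_real (exp (- z * g x))) absolutely_integrable_on einterval a b" if "z \<ge> z0" for z
    proof -
      have "(\<lambda>x. complex_of_real (exp (z * h a)) * (\<phi> x * complex_of_real (exp (- z * h x))))
          absolutely_integrable_on einterval a b"
        by (rule set_integrable_mult_right) (rule z0[OF that])
      moreover have "complex_of_real (exp (z * h a)) * (\<phi> x * complex_of_real (exp (- z * h x)))
          = \<phi> x * complex_of_real (exp (- z * g x))" for x
        by (simp add: g_def mult_ac algebra_simps flip: exp_add of_real_mult)
      ultimately show ?thesis by (simp only:)
    qed
    from this[of z0] this[of "z0 + 1"]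
    show "(\<lambda>x. \<phi> x * complex_of_real (exp (- z0 * g x))) absolutely_integrable_on einterval a b"
      "(\<lambda>x. \<phi> x * complex_of_real (exp (- (z0 + 1) * g x))) absolutely_integrable_on einterval a b"
      by (simp_all only: order_refl le_add_same_cancel1 zero_le_one)
    show "(g has_real_derivative deriv h x) (at x)" if "x \<in> {a<..<a + r}" for x
    proof -
      have "(h has_real_derivative deriv h x) (at x)"
        using r(3)[OF that] by (simp add: DERIV_deriv_iff_real_differentiable)
      then show ?thesis unfolding g_def[abs_def] by (auto intro!: derivative_eq_intros)
    qed
    show "(g \<longlongrightarrow> 0) (at_right a)" using ratio(5) by (simp add: g_def[abs_def])
  qed (use h_i(1) r in \<open>auto simp: g_def\<close>)
  have far: "\<exists>\<rho>>0. \<forall>x. a + \<delta> \<le> x \<longrightarrow> ereal x < b \<longrightarrow> \<rho> \<le> g x" if \<delta>: "\<delta> > 0" for \<delta>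
  proof -
    \<comment> \<open>The infimum is infinite if the set is empty, so a real number strictly below
      it is taken.\<close>
    obtain \<rho> where \<rho>: "0 < ereal \<rho>" "ereal \<rho> < (INF x\<in>{x. a + \<delta> \<le> x \<and> ereal x < b}. ereal (h x - h a))"
      using ereal_dense2[OF h_i(2)[OF \<delta>]] by blast
    have "\<rho> \<le> g x" if x: "a + \<delta> \<le> x" "ereal x < b" for x
    proof -
      have "(INF x\<in>{x. a + \<delta> \<le> x \<and> ereal x < b}. ereal (h x - h a)) \<le> ereal (h x - h a)"
        by (rule INF_lower) (use x in simp)
      with \<rho>(2) show ?thesis by (simp add: g_def) (meson ereal_less_eq(3) less_imp_le order_trans)
    qed
    then show ?thesis using \<rho>(1) by auto
  qed
  \<comment> \<open>With p_s = (s + lam)/mu the gauge exponent is p_s - 1, the exponent of t in the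
    integral for Gamma(p_s) A^(-p_s).\<close>
  have gauge: "(\<lambda>s x. (h x - h a) powr ((real s + lam - mu) / mu)) = (\<lambda>s x. g x powr ((real s + lam) / mu - 1))"
    using exp_iii(5) by (simp add: g_def diff_divide_distrib)
  have part1: "\<exists>\<delta>>0. \<forall>i\<in>I. onorm (op_inverse Y (A i)) < \<delta> \<longrightarrow>
        laplace_op_exists Y (A i) \<phi> (\<lambda>x. h x - h a) (einterval a b) \<and>
        (exp_minus_bounded Y (A i) (h a) \<longrightarrow>
           laplace_op_exists Y (A i) \<phi> h (einterval a b) \<and>
           laplace_op Y (A i) \<phi> h (einterval a b) =
             exp_minus Y (A i) (h a) \<circ> laplace_op Y (A i) \<phi> (\<lambda>x. h x - h a) (einterval a b))"
  proof (intro exI[of _ "\<kappa> / max (z0 + 1) 1"] conjI ballI impI)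
    show "\<kappa> / max (z0 + 1) 1 > 0" using \<kappa> by simp
    fix i assume i: "i \<in> I" and small: "onorm (op_inverse Y (A i)) < \<kappa> / max (z0 + 1) 1"
    have "laplace_semigroup Y (A i) M' (\<omega>1 i) a b g (deriv h) \<phi> z0 r"
      using HY[OF i] LI large[OF i small]
      by (auto simp: laplace_semigroup_def laplace_semigroup_axioms_def)
    note ls = laplace_semigroup.laplace_op_exists_g[OF this] laplace_semigroup.laplace_op_shift[OF this]
    show "laplace_op_exists Y (A i) \<phi> (\<lambda>x. h x - h a) (einterval a b)"
      using ls(1) by (simp add: g_def[abs_def])
    show "laplace_op_exists Y (A i) \<phi> h (einterval a b)" if "exp_minus_bounded Y (A i) (h a)"
      using ls(2)[OF that] by (simp add: g_def[abs_def])
    show "laplace_op Y (A i) \<phi> h (einterval a b) =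
        exp_minus Y (A i) (h a) \<circ> laplace_op Y (A i) \<phi> (\<lambda>x. h x - h a) (einterval a b)"
      if "exp_minus_bounded Y (A i) (h a)"
      using ls(3)[OF that] by (simp add: g_def[abs_def])
  qed
  have part3: "op_expansion I Y A (\<lambda>i. laplace_op Y (A i) \<phi> (\<lambda>x. h x - h a) (einterval a b))
      (\<lambda>s. (real s + lam) / mu) (\<lambda>s. complex_of_real (Gamma ((real s + lam) / mu)) * c s)"
    if c: "poincare_expansion (at_right a) (\<lambda>x. \<phi> x / complex_of_real (deriv h x))
      (\<lambda>s x. (h x - h a) powr ((real s + lam - mu) / mu)) c" for c
    unfolding op_expansion_def
  proof (intro allI impI)
    fix N and \<epsilon> :: real assume \<epsilon>: "\<epsilon> > 0"
    define p where "p s = (real s + lam) / mu" for s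
    have p: "p s > 0" for s using exp_iii(4,5) by (simp add: p_def)
    obtain C where C: "C > 0" "\<And>(Y::'a set) A w. hille_yosida Y A M' w \<Longrightarrow>
        \<forall>n\<ge>1. (\<kappa> / w) ^ n \<le> onorm (op_inverse Y A ^^ n) \<Longrightarrow> C * w powr (- p N) \<le> onorm (neg_power Y A (p N))"
      using neg_power_lower_bound[OF p \<kappa> M', of N] by metis
    \<comment> \<open>Accuracy \<epsilon> C relative to w^(-p_N) is accuracy \<epsilon> relative to
      the norm of A^(-p_N), by the lower bound with constant \<open>C\<close>.\<close>
    have "\<epsilon> * C > 0" using \<epsilon> C(1) by simp
    from laplace_op_expansion[OF LI M' p this c[unfolded gauge, folded p_def] ratio(4) far, where 'a='a and N=N]
    obtain W where W: "\<And>(Y::'a set) A w u. hille_yosida Y A M' w \<Longrightarrow> w \<ge> W \<Longrightarrow>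
      norm (laplace_op Y A \<phi> g (einterval a b) u
        - (\<Sum>s\<le>N. (complex_of_real (Gamma (p s)) * c s) *\<^sub>C neg_power Y A (p s) u))
      \<le> \<epsilon> * C * w powr (- p N) * norm u" by blast
    have "onorm (\<lambda>u. laplace_op Y (A i) \<phi> g (einterval a b) u
        - (\<Sum>s\<le>N. (complex_of_real (Gamma (p s)) * c s) *\<^sub>C neg_power Y (A i) (p s) u))
      \<le> \<epsilon> * onorm (neg_power Y (A i) (p N))"
      if i: "i \<in> I" and small: "onorm (op_inverse Y (A i)) < \<kappa> / max W 1" for i
    proof -
      have "onorm (\<lambda>u. laplace_op Y (A i) \<phi> g (einterval a b) u
          - (\<Sum>s\<le>N. (complex_of_real (Gamma (p s)) * c s) *\<^sub>C neg_power Y (A i) (p s) u))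
        \<le> \<epsilon> * C * \<omega>1 i powr (- p N)"
        by (rule onorm_bound[OF _ W[OF HY[OF i] large[OF i small]]]) (use \<epsilon> C(1) in simp)
      also have "\<dots> = \<epsilon> * (C * \<omega>1 i powr (- p N))" by simp
      also have "\<dots> \<le> \<epsilon> * onorm (neg_power Y (A i) (p N))"
        using \<epsilon> by (intro mult_left_mono C(2)[OF HY[OF i]]) (use low[OF i] in auto)
      finally show ?thesis .
    qed
    then show "\<exists>\<delta>>0. \<forall>i\<in>I. onorm (op_inverse Y (A i)) < \<delta> \<longrightarrow>
        onorm (\<lambda>u. laplace_op Y (A i) \<phi> (\<lambda>x. h x - h a) (einterval a b) u
          - (\<Sum>s\<le>N. (complex_of_real (Gamma ((real s + lam) / mu)) * c s) *\<^sub>C neg_power Y (A i) ((real s + lam) / mu) u))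
        \<le> \<epsilon> * onorm (neg_power Y (A i) ((real N + lam) / mu))"
      using \<kappa> by (intro exI[of _ "\<kappa> / max W 1"]) (auto simp: p_def g_def[abs_def])
  qed
  show ?thesis
    using part1 ratio(1) part3 ratio(2) by blast
qed

end
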